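(* Fix a contract $(K,T,r)$ with $K,T>0$, $r\in\mathbb R$, and a local variance $a$; write $\bar a(x,\tau)=a(Ke^x,T-\tau)$ for $x\in\mathbb R$, $\tau\in[0,T]$. Assume: (i) $0<a_-\le\bar a\le a_+<\infty$ for constants $a_-,a_+$; (ii) $\bar a$ is Lipschitz in $x$, uniformly in $\tau$; (iii) the pricing problem and the correction problem (defined in the context) have unique solutions in the class of functions of at most exponential growth in $x$, and the comparison principle holds in that class; (iv) $\bar a\in C_b^{3+\zeta,1+\zeta/2}(\mathbb R\times[0,T])$ for some $0<\zeta<1$. Let $V$ be the call price, $C^{\mathrm{ref}}$ the strike-matched carrier, $W=V-C^{\mathrm{ref}}$, and put $a_*=\bar a(0,0)=a(K,T)$, $b_*=\partial_x\bar a(0,0)=K\partial_Sa(K,T)$, and $g_{a_*}(y)=(2\pi a_* )^{-1/2}e^{-y^2/(2a_* )}$. Then for every fixed $y\in\mathbb R$, with $S_\tau=Ke^{y\sqrt\tau}$, as $\tau\downarrow0$, $$\frac{W(S_\tau,T-\tau)}{K\tau}\to\frac{b_*}{4}\,y\,g_{a_*}(y),$$ $$\frac{\partial_SW(S_\tau,T-\tau)}{\sqrt\tau}\to\frac{b_*}{4}\Bigl(1-\frac{y^2}{a_*}\Bigr)g_{a_*}(y),$$ $$K\,\partial_{SS}W(S_\tau,T-\tau)\to\frac{b_*}{4}\Bigl(\frac{y^3}{a_*^2}-\frac{3y}{a_*}\Bigr)g_{a_*}(y),$$ and $\sqrt\tau\,K\,\partial_{SS}C^{\mathrm{ref}}(S_\tau,T-\tau)\to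 g_{a_*}(y)$. Moreover, if $b_*y\neq0$, then for $\alpha\in\mathbb R$ the quantity $W(S_\tau,T-\tau)/(\tau/T)^\alpha$ has a finite nonzero limit as $\tau\downarrow0$ if and only if $\alpha=1$.
   Context: Setting: European call on a non-dividend-paying asset with strike $K>0$, maturity $T>0$, constant rate $r$, local variance $a(S,t)=\sigma^2(S,t)$; $\tau=T-t$ is the remaining time and $x=\log(S/K)$. Pricing problem: $V(S,t)$ solves $\partial_tV+\tfrac12 a(S,t)S^2\partial_{SS}V+rS\partial_SV-rV=0$ for $S>0$, $t<T$, with $V(S,T)=(S-K)^+$. Equivalently, $u(x,\tau)=V(Ke^x,T-\tau)/K$ solves $\mathcal M u=0$ on $\mathbb R\times(0,T]$, $u(x,0)=(e^x-1)^+$, where $$\mathcal M u=\partial_\tau u-\tfrac12\bar a\,u_{xx}-(r-\tfrac12\bar a)u_x+ru .$$ Carrier: with $A_0(\tau)=\int_0^\tau a(K,T-s)\,ds$, $\Phi$ the standard normal distribution function and $\tau=T-t$, for $S>0$, $\tau>0$, $$C^{\mathrm{ref}}(S,t)=S\Phi(d_+)-Ke^{-r\tau}\Phi(d_-),\qquad d_\pm=\frac{\log(S/K)+r\tau\pm A_0(\tau)/2}{\sqrt{A_0(\tau)}},$$ and $C^{\mathrm{ref}}(S,T)=(S-K)^+$. Correction problem: $w(x,\tau)=W(Ke^x,T-\tau)/K$ is the solution of $\mathcal M w=\widetilde f$ on $\mathbb R\times(0,T]$, $w(\cdot,0)=0$, with $$\widetilde f(x,\tau)=\tfrac12[\bar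 a(x,\tau)-\bar a(0,\tau)]\,(\partial_{xx}-\partial_x)c^{\mathrm{ref}}(x,\tau),\qquad c^{\mathrm{ref}}(x,\tau)=C^{\mathrm{ref}}(Ke^x,T-\tau)/K .$$ Growth class and comparison: the class consists of functions $u$ continuous on $\mathbb R\times[0,T]$, with continuous $u_\tau,u_x,u_{xx}$ on $\mathbb R\times(0,T]$, and $|u(x,\tau)|\le Me^{m|x|}$ for some $M,m$. The comparison principle says: if $u_1,u_2$ are in this class, $\mathcal M u_1\le\mathcal M u_2$ on $\mathbb R\times(0,T]$ and $u_1(\cdot,0)\le u_2(\cdot,0)$, then $u_1\le u_2$. $\bar a\in C_b^{3+\zeta,1+\zeta/2}$ means: $\partial_x^j\bar a$ ($0\le j\le3$) and $\partial_\tau\bar a$ exist, are bounded and continuous, and are Hölder continuous with exponent $\zeta$ in $x$ and $\zeta/2$ in $\tau$, uniformly. *)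

theory Defs
  imports "HOL-Probability.Probability"
begin

section \<open>Partial derivatives of functions of a space and a time variable\<close>

text \<open>
  The time interval is always \<open>[0,T]\<close>; the time derivative is relative to that interval, hence
  one-sided at its two end points (time to maturity \<open>\<tau> = T\<close> belongs to the domain of the equation).
\<close>

definition d_space :: "(real \<Rightarrow> real \<Rightarrow> real) \<Rightarrow> real \<Rightarrow> real \<Rightarrow> real" where
  "d_space f x t = deriv (\<lambda>z. f z t) x"

definition d_time :: "real \<Rightarrow> (real \<Rightarrow> real \<Rightarrow> real) \<Rightarrow> real \<Rightarrow> real \<Rightarrow> real" where
  "d_time T f x t = vector_derivative (f x) (at t within {0..T})"

section \<open>Local variance and log-moneyness coordinates\<close>

definition log_variance :: "real \<Rightarrow> real \<Rightarrow> (real \<Rightarrow> real \<Rightarrow> real) \<Rightarrow> real \<Rightarrow> real \<Rightarrow> real" where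
  "log_variance K T a x \<tau> = a (K * exp x) (T - \<tau>)"

definition log_price :: "real \<Rightarrow> real \<Rightarrow> (real \<Rightarrow> real \<Rightarrow> real) \<Rightarrow> real \<Rightarrow> real \<Rightarrow> real" where
  "log_price K T F x \<tau> = F (K * exp x) (T - \<tau>) / K"

definition pricing_operator ::
    "real \<Rightarrow> real \<Rightarrow> (real \<Rightarrow> real \<Rightarrow> real) \<Rightarrow> (real \<Rightarrow> real \<Rightarrow> real) \<Rightarrow> real \<Rightarrow> real \<Rightarrow> real" where
  "pricing_operator T r a V S t =
     d_time T V S t + 1/2 * a S t * S\<^sup>2 * d_space (d_space V) S t
       + r * S * d_space V S t - r * V S t"

definition log_operator ::
    "real \<Rightarrow> real \<Rightarrow> (real \<Rightarrow> real \<Rightarrow> real) \<Rightarrow> (real \<Rightarrow> real \<Rightarrow> real) \<Rightarrow> real \<Rightarrow> real \<Rightarrow> real" where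
  "log_operator T r abar u x \<tau> =
     d_time T u x \<tau> - 1/2 * abar x \<tau> * d_space (d_space u) x \<tau>
       - (r - 1/2 * abar x \<tau>) * d_space u x \<tau> + r * u x \<tau>"

section \<open>Growth class and comparison principle\<close>

definition growth_class :: "real \<Rightarrow> (real \<Rightarrow> real \<Rightarrow> real) \<Rightarrow> bool" where
  "growth_class T u \<longleftrightarrow>
     continuous_on (UNIV \<times> {0..T}) (\<lambda>(x, \<tau>). u x \<tau>) \<and>
     (\<forall>x. \<forall>\<tau>\<in>{0<..T}.
        (\<lambda>z. u z \<tau>) differentiable (at x) \<and>
        (\<lambda>z. d_space u z \<tau>) differentiable (at x) \<and>
        u x differentiable (at \<tau> within {0..T})) \<and>
     continuous_on (UNIV \<times> {0<..T}) (\<lambda>(x, \<tau>). d_time T u x \<tau>) \<and>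
     continuous_on (UNIV \<times> {0<..T}) (\<lambda>(x, \<tau>). d_space u x \<tau>) \<and>
     continuous_on (UNIV \<times> {0<..T}) (\<lambda>(x, \<tau>). d_space (d_space u) x \<tau>) \<and>
     (\<exists>M m. \<forall>x. \<forall>\<tau>\<in>{0..T}. \<bar>u x \<tau>\<bar> \<le> M * exp (m * \<bar>x\<bar>))"

definition comparison_principle :: "real \<Rightarrow> real \<Rightarrow> (real \<Rightarrow> real \<Rightarrow> real) \<Rightarrow> bool" where
  "comparison_principle T r abar \<longleftrightarrow>
     (\<forall>u1 u2. growth_class T u1 \<longrightarrow> growth_class T u2 \<longrightarrow>
        (\<forall>x. \<forall>\<tau>\<in>{0<..T}. log_operator T r abar u1 x \<tau> \<le> log_operator T r abar u2 x \<tau>) \<longrightarrow>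
        (\<forall>x. u1 x 0 \<le> u2 x 0) \<longrightarrow>
        (\<forall>x. \<forall>\<tau>\<in>{0..T}. u1 x \<tau> \<le> u2 x \<tau>))"

section \<open>The parabolic Hoelder class\<close>

definition parabolic_holder :: "real \<Rightarrow> real \<Rightarrow> (real \<Rightarrow> real \<Rightarrow> real) \<Rightarrow> bool" where
  "parabolic_holder T \<zeta> f \<longleftrightarrow>
     (\<exists>H. \<forall>x x'. \<forall>\<tau>\<in>{0..T}. \<forall>\<tau>'\<in>{0..T}.
        \<bar>f x \<tau> - f x' \<tau>'\<bar> \<le> H * (\<bar>x - x'\<bar> powr \<zeta> + \<bar>\<tau> - \<tau>'\<bar> powr (\<zeta> / 2)))"

definition bounded_continuous_holder :: "real \<Rightarrow> real \<Rightarrow> (real \<Rightarrow> real \<Rightarrow> real) \<Rightarrow> bool" where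
  "bounded_continuous_holder T \<zeta> f \<longleftrightarrow>
     bounded ((\<lambda>(x, \<tau>). f x \<tau>) ` (UNIV \<times> {0..T})) \<and>
     continuous_on (UNIV \<times> {0..T}) (\<lambda>(x, \<tau>). f x \<tau>) \<and>
     parabolic_holder T \<zeta> f"

text \<open>The class \<open>C\<^sub>b\<close> with exponents \<open>3 + \<zeta>\<close> in space and \<open>1 + \<zeta> / 2\<close> in time on
  \<open>\<real> \<times> [0,T]\<close>.\<close>

definition Cb_3_1 :: "real \<Rightarrow> real \<Rightarrow> (real \<Rightarrow> real \<Rightarrow> real) \<Rightarrow> bool" where
  "Cb_3_1 T \<zeta> f \<longleftrightarrow>
     (\<forall>j<3. \<forall>x. \<forall>\<tau>\<in>{0..T}. (\<lambda>z. (d_space ^^ j) f z \<tau>) differentiable (at x)) \<and>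
     (\<forall>x. \<forall>\<tau>\<in>{0..T}. f x differentiable (at \<tau> within {0..T})) \<and>
     (\<forall>j\<le>3. bounded_continuous_holder T \<zeta> ((d_space ^^ j) f)) \<and>
     bounded_continuous_holder T \<zeta> (d_time T f)"

section \<open>Pricing problem\<close>

text \<open>
  The growth condition is imposed on the price in log-moneyness coordinates, where the class is
  defined.  Membership also supplies the derivatives of \<open>V\<close> that occur in the equation.
\<close>

definition pricing_solution ::
    "real \<Rightarrow> real \<Rightarrow> real \<Rightarrow> (real \<Rightarrow> real \<Rightarrow> real) \<Rightarrow> (real \<Rightarrow> real \<Rightarrow> real) \<Rightarrow> bool" where
  "pricing_solution K T r a V \<longleftrightarrow>
     growth_class T (log_price K T V) \<and>
     (\<forall>S>0. \<forall>t\<in>{0..<T}. pricing_operator T r a V S t = 0) \<and>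
     (\<forall>S>0. V S T = max (S - K) 0)"

definition pricing_problem_well_posed ::
    "real \<Rightarrow> real \<Rightarrow> real \<Rightarrow> (real \<Rightarrow> real \<Rightarrow> real) \<Rightarrow> bool" where
  "pricing_problem_well_posed K T r a \<longleftrightarrow>
     (\<exists>V. pricing_solution K T r a V) \<and>
     (\<forall>V1 V2. pricing_solution K T r a V1 \<longrightarrow> pricing_solution K T r a V2 \<longrightarrow>
        (\<forall>S>0. \<forall>t\<in>{0..T}. V1 S t = V2 S t))"

section \<open>Strike-matched carrier\<close>

definition total_variance :: "real \<Rightarrow> real \<Rightarrow> (real \<Rightarrow> real \<Rightarrow> real) \<Rightarrow> real \<Rightarrow> real" where
  "total_variance K T a \<tau> = integral {0..\<tau>} (\<lambda>s. a K (T - s))"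

definition std_normal_cdf :: "real \<Rightarrow> real" where
  "std_normal_cdf = cdf std_normal_distribution"

definition d_plus :: "real \<Rightarrow> real \<Rightarrow> real \<Rightarrow> (real \<Rightarrow> real \<Rightarrow> real) \<Rightarrow> real \<Rightarrow> real \<Rightarrow> real" where
  "d_plus K T r a S \<tau> =
     (ln (S / K) + r * \<tau> + total_variance K T a \<tau> / 2) / sqrt (total_variance K T a \<tau>)"

definition d_minus :: "real \<Rightarrow> real \<Rightarrow> real \<Rightarrow> (real \<Rightarrow> real \<Rightarrow> real) \<Rightarrow> real \<Rightarrow> real \<Rightarrow> real" where
  "d_minus K T r a S \<tau> =
     (ln (S / K) + r * \<tau> - total_variance K T a \<tau> / 2) / sqrt (total_variance K T a \<tau>)"

definition carrier_price :: "real \<Rightarrow> real \<Rightarrow> real \<Rightarrow> (real \<Rightarrow> real \<Rightarrow> real) \<Rightarrow> real \<Rightarrow> real \<Rightarrow> real" where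
  "carrier_price K T r a S t =
     (if t = T then max (S - K) 0
      else S * std_normal_cdf (d_plus K T r a S (T - t))
             - K * exp (- r * (T - t)) * std_normal_cdf (d_minus K T r a S (T - t)))"

section \<open>Correction problem\<close>

definition correction_source ::
    "real \<Rightarrow> real \<Rightarrow> real \<Rightarrow> (real \<Rightarrow> real \<Rightarrow> real) \<Rightarrow> real \<Rightarrow> real \<Rightarrow> real" where
  "correction_source K T r a x \<tau> =
     (let abar = log_variance K T a; c = log_price K T (carrier_price K T r a) in
        1/2 * (abar x \<tau> - abar 0 \<tau>) * (d_space (d_space c) x \<tau> - d_space c x \<tau>))"

definition correction_solution ::
    "real \<Rightarrow> real \<Rightarrow> real \<Rightarrow> (real \<Rightarrow> real \<Rightarrow> real) \<Rightarrow> (real \<Rightarrow> real \<Rightarrow> real) \<Rightarrow> bool" where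
  "correction_solution K T r a w \<longleftrightarrow>
     growth_class T w \<and>
     (\<forall>x. \<forall>\<tau>\<in>{0<..T}. log_operator T r (log_variance K T a) w x \<tau> = correction_source K T r a x \<tau>) \<and>
     (\<forall>x. w x 0 = 0)"

definition correction_problem_well_posed ::
    "real \<Rightarrow> real \<Rightarrow> real \<Rightarrow> (real \<Rightarrow> real \<Rightarrow> real) \<Rightarrow> bool" where
  "correction_problem_well_posed K T r a \<longleftrightarrow>
     (\<exists>w. correction_solution K T r a w) \<and>
     (\<forall>w1 w2. correction_solution K T r a w1 \<longrightarrow> correction_solution K T r a w2 \<longrightarrow>
        (\<forall>x. \<forall>\<tau>\<in>{0..T}. w1 x \<tau> = w2 x \<tau>))"

section \<open>Centred Gaussian density with given variance\<close>

definition gauss_density :: "real \<Rightarrow> real \<Rightarrow> real" where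
  "gauss_density v y = (2 * pi * v) powr (- 1/2) * exp (- (y\<^sup>2 / (2 * v)))"

end

theory Submission
  imports Defs
begin

text \<open>
  Time to maturity is written \<open>t\<close> except in the results that also mention calendar time.

  Let \<open>A t = \<integral>\<^sub>0\<^sup>t abar 0\<close> and \<open>q = c\<^sub>x\<^sub>x - c\<^sub>x\<close> for the carrier \<open>c\<close>, a Gaussian of variance \<open>A\<close> in
  \<open>\<xi> = x + r t - A / 2\<close>.  To leading order the source of the correction problem is
  \<open>b \<xi> q / 2 = - b A q\<^sub>x / 2\<close>.  Since \<open>q\<close> solves the equation with coefficients frozen at the strike,
  this is to leading order the image of \<open>b / (4 a) A \<xi> q\<close>, whose scaled limits are the ones claimed.
  The source \<open>R\<close> left over satisfies \<open>\<partial>\<^sub>x\<^sup>j R = O(t powr (\<zeta> / 2 - j / 2))\<close> for \<open>j = 0, 1, 2\<close>, so the comparison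
  principle bounds the remainder \<open>z\<close> by \<open>O(t powr (1 + \<zeta> / 2))\<close>.  In place of interior Schauder
  estimates, a maximum principle for \<open>z x + z y - 2 z m\<close> gives \<open>z\<^sub>x\<^sub>x = O(t powr (\<zeta> / 2))\<close>, and
  interpolation gives \<open>z\<^sub>x = O(t powr (1 / 2 + \<zeta> / 2))\<close>.
\<close>

section \<open>Second differences of parabolic solutions\<close>

text \<open>Where \<open>b / (4 a)\<close> comes from: \<open>\<xi> q = - A q_x\<close>, so the
  corrector \<open>l A \<xi> q\<close> equals \<open>- l A^2 q_x\<close>. Matching with
  \<open>b \<xi> q / 2\<close> at time 0 gives \<open>l = b / (4 \<alpha> 0)\<close>.

  The obstacle is that members of the growth class need not have third derivatives, so the equation
  for the remainder cannot be differentiated, while the gamma limit needs control of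
  \<open>z_xx\<close>. The three-point functional is the analytic form of a synchronous coupling:
  three log-price diffusions started at \<open>x\<close>, \<open>y\<close>, \<open>m\<close> and
  driven by one Brownian motion. Under it \<open>s = x + y - 2 m\<close> and
  \<open>(x - y)^2\<close> grow at comparable rates, so the generator changes the penalty
  \<open>sqrt (s^2 + (x - y)^4)\<close> by at most a multiple of itself. The source enters through
  second differences of size \<open>t powr (\<zeta> / 2 - 1)\<close>, which is integrable at 0 and
  integrates to the rate \<open>t powr (\<zeta> / 2)\<close>.\<close>

lemma interior_max_derivatives:
  fixes f f' :: "real \<Rightarrow> real"
  assumes d1: "\<And>t. (f has_real_derivative f' t) (at t)"
    and d2: "(f' has_real_derivative l) (at 0)"
    and max: "\<And>t. f t \<le> f 0"
  shows "f' 0 = 0" "l \<le> 0"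
proof -
  show f0: "f' 0 = 0"
    using DERIV_local_max[OF d1, of 1 0] max by auto
  show "l \<le> 0"
  proof (rule ccontr)
    assume "\<not> l \<le> 0"
    then obtain d where d: "d > 0" "\<And>h. 0 < h \<Longrightarrow> h < d \<Longrightarrow> f' 0 < f' (0 + h)"
      using DERIV_pos_inc_right[OF d2] by auto
    \<comment> \<open>\<open>f'\<close> vanishes at 0 and increases there, hence is positive just to
      the right; differentiability of \<open>f'\<close> at the single point 0 suffices.\<close>
    have "f 0 < f (d / 2)"
    proof (rule DERIV_pos_imp_increasing_open[of 0 "d / 2"])
      show "\<exists>y. (f has_real_derivative y) (at t) \<and> 0 < y" if "0 < t" "t < d / 2" for t
        using d1[of t] d(2)[of t] f0 that by (intro exI[of _ "f' t"]) simp
      show "continuous_on {0..d / 2} f"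
        by (intro continuous_at_imp_continuous_on ballI DERIV_isCont[OF d1])
    qed (use d in simp)
    with max show False by (meson not_le)
  qed
qed

text \<open>Only times before \<open>t\<close> are compared, so the end point \<open>t = T\<close>,
  where the derivative is one-sided, is included.\<close>

lemma derivative_within_nonneg_at_max:
  fixes f :: "real \<Rightarrow> real"
  assumes d: "(f has_real_derivative l) (at t within {0..T})"
    and t: "0 < t" "t \<le> T"
    and max: "\<And>s. s \<in> {0..T} \<Longrightarrow> f s \<le> f t"
  shows "0 \<le> l"
proof (rule ccontr)
  assume "\<not> 0 \<le> l"
  then obtain \<delta> where \<delta>: "\<delta> > 0" "\<And>h. h > 0 \<Longrightarrow> t - h \<in> {0..T} \<Longrightarrow> h < \<delta> \<Longrightarrow> f t < f (t - h)"
    using has_real_derivative_neg_dec_left[OF d] by auto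
  define h where "h = min t (\<delta> / 2)"
  have "f t < f (t - h)" by (rule \<delta>(2)) (use t \<delta>(1) in \<open>auto simp: h_def\<close>)
  moreover have "t - h \<in> {0..T}" using t \<delta>(1) by (auto simp: h_def)
  ultimately show False using max by fastforce
qed

text \<open>At a maximum of the penalised three-point functional, its restriction to the line
  through \<open>(x, y, m)\<close> with direction \<open>(u, v, w)\<close> satisfies the first and
  second order conditions. The direction is free: the drift coefficients go into the first
  condition, the dispersion coefficients into the second. The term with \<open>E\<close> is the
  localisation that makes maxima exist.\<close>

lemma line_max_conditions:
  fixes f f' f'' :: "real \<Rightarrow> real"
  assumes f1: "\<And>x. (f has_real_derivative f' x) (at x)"
    and f2: "\<And>x. (f' has_real_derivative f'' x) (at x)"
    and N: "N = sqrt ((x + y - 2 * m)\<^sup>2 + (x - y) ^ 4 + \<theta>\<^sup>2)" and \<theta>: "\<theta> > 0" and A: "A \<ge> 0"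
    and max: "\<And>x' y' m'. f x' + f y' - 2 * f m' - A * sqrt ((x' + y' - 2 * m')\<^sup>2 + (x' - y') ^ 4 + \<theta>\<^sup>2)
                  - E * (1 + x'\<^sup>2 + y'\<^sup>2 + m'\<^sup>2)
               \<le> f x + f y - 2 * f m - A * N - E * (1 + x\<^sup>2 + y\<^sup>2 + m\<^sup>2)"
  shows "u * f' x + v * f' y - 2 * w * f' m
           = A * ((x + y - 2 * m) * (u + v - 2 * w) + 2 * (x - y) ^ 3 * (u - v)) / N
             + 2 * E * (x * u + y * v + m * w)" (is ?first)
    and "u\<^sup>2 * f'' x + v\<^sup>2 * f'' y - 2 * w\<^sup>2 * f'' m
           \<le> A * ((u + v - 2 * w)\<^sup>2 + 6 * (x - y)\<^sup>2 * (u - v)\<^sup>2) / N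
             + 2 * E * (u\<^sup>2 + v\<^sup>2 + w\<^sup>2)" (is ?second)
proof -
  define \<Phi> where "\<Phi> t = (x + y - 2 * m + (u + v - 2 * w) * t)\<^sup>2 + (x - y + (u - v) * t) ^ 4 + \<theta>\<^sup>2" for t
  have \<Phi>_pos: "\<Phi> t > 0" for t
    unfolding \<Phi>_def using \<theta> by (intro add_nonneg_pos) auto
  have N_eq: "N = sqrt (\<Phi> 0)" unfolding N \<Phi>_def by simp
  have N_pos: "N > 0" using \<Phi>_pos[of 0] unfolding N_eq by simp
  \<comment> \<open>\<open>g\<close> lies below the restricted functional and touches it at
    \<open>t = 0\<close>, so it inherits the maximum. Being free of square roots it is easily
    differentiated twice; only the favourable curvature term of the root is given up.\<close>
  define g where "g t = f (x + u * t) + f (y + v * t) - 2 * f (m + w * t)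
      - A * (\<Phi> t / (2 * N) + N / 2)
      - E * (1 + (x + u * t)\<^sup>2 + (y + v * t)\<^sup>2 + (m + w * t)\<^sup>2)" for t
  define g' where "g' t = u * f' (x + u * t) + v * f' (y + v * t) - 2 * w * f' (m + w * t)
      - A * ((x + y - 2 * m + (u + v - 2 * w) * t) * (u + v - 2 * w) + 2 * (x - y + (u - v) * t) ^ 3 * (u - v)) / N
      - 2 * E * ((x + u * t) * u + (y + v * t) * v + (m + w * t) * w)" for t
  define \<Phi>' where "\<Phi>' t = 2 * ((x + y - 2 * m + (u + v - 2 * w) * t) * (u + v - 2 * w) + 2 * (x - y + (u - v) * t) ^ 3 * (u - v))" for t
  have d\<Phi>: "(\<Phi> has_real_derivative \<Phi>' t) (at t)" for t
    unfolding \<Phi>_def \<Phi>'_def by (auto intro!: derivative_eq_intros simp: algebra_simps)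
  have d\<Phi>': "(\<Phi>' has_real_derivative 2 * ((u + v - 2 * w)\<^sup>2 + 6 * (x - y)\<^sup>2 * (u - v)\<^sup>2)) (at 0)"
    unfolding \<Phi>'_def
    by (auto intro!: derivative_eq_intros simp: power2_eq_square algebra_simps)
  have lin: "((\<lambda>t. c + k * t) has_real_derivative k) (at t)" for c k t :: real
    by (auto intro!: derivative_eq_intros)
  note chain1 = DERIV_chain2[OF f1 lin] and chain2 = DERIV_chain2[OF f2 lin]
  have 1: "(g has_real_derivative g' t) (at t)" for t
  proof -
    have "(g has_real_derivative
       (f' (x + u * t) * u + f' (y + v * t) * v - 2 * (f' (m + w * t) * w)
        - A * (\<Phi>' t / (2 * N) + 0)
        - E * (0 + 2 * (x + u * t) * u + 2 * (y + v * t) * v + 2 * (m + w * t) * w))) (at t)"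
      unfolding g_def
      by (intro DERIV_diff DERIV_add DERIV_cmult chain1 DERIV_cdivide d\<Phi> DERIV_const)
         (auto intro!: derivative_eq_intros)
    thus ?thesis
      by (rule DERIV_cong) (use N_pos in \<open>simp add: g'_def \<Phi>'_def field_simps\<close>)
  qed
  have g'_eq: "g' = (\<lambda>t. u * f' (x + u * t) + v * f' (y + v * t) - 2 * w * f' (m + w * t)
      - A * (\<Phi>' t / (2 * N)) - 2 * E * ((x + u * t) * u + (y + v * t) * v + (m + w * t) * w))"
    using N_pos by (simp add: fun_eq_iff g'_def \<Phi>'_def field_simps)
  have 2: "(g' has_real_derivative u\<^sup>2 * f'' x + v\<^sup>2 * f'' y - 2 * w\<^sup>2 * f'' m
      - A * ((u + v - 2 * w)\<^sup>2 + 6 * (x - y)\<^sup>2 * (u - v)\<^sup>2) / N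
      - 2 * E * (u\<^sup>2 + v\<^sup>2 + w\<^sup>2)) (at 0)"
  proof -
    have "(g' has_real_derivative
       (u * (f'' (x + u * 0) * u) + v * (f'' (y + v * 0) * v) - 2 * w * (f'' (m + w * 0) * w)
        - A * (2 * ((u + v - 2 * w)\<^sup>2 + 6 * (x - y)\<^sup>2 * (u - v)\<^sup>2) / (2 * N))
        - 2 * E * (u * u + v * v + w * w))) (at 0)"
      unfolding g'_eq
      by (intro DERIV_diff DERIV_add DERIV_cmult chain2 DERIV_cdivide d\<Phi>')
         (auto intro!: derivative_eq_intros)
    thus ?thesis
      by (rule DERIV_cong) (use N_pos in \<open>simp add: field_simps power2_eq_square\<close>)
  qed
  have max_g: "g t \<le> g 0" for t
  proof -
    \<comment> \<open>The square root is replaced by its tangent line, which lies above it.\<close>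
    have "sqrt (\<Phi> t) \<le> \<Phi> t / (2 * N) + N / 2"
    proof -
      have "\<Phi> t / (2 * N) + N / 2 - sqrt (\<Phi> t) = (sqrt (\<Phi> t) - N)\<^sup>2 / (2 * N)"
        using N_pos \<Phi>_pos[of t] by (simp add: field_simps power2_eq_square)
      also have "\<dots> \<ge> 0" using N_pos by simp
      finally show ?thesis by simp
    qed
    hence "A * sqrt (\<Phi> t) \<le> A * (\<Phi> t / (2 * N) + N / 2)" using A by (rule mult_left_mono)
    moreover have "\<Phi> t = ((x + u * t) + (y + v * t) - 2 * (m + w * t))\<^sup>2 + ((x + u * t) - (y + v * t)) ^ 4 + \<theta>\<^sup>2"
      unfolding \<Phi>_def by (simp add: algebra_simps)
    moreover have "\<Phi> 0 / (2 * N) + N / 2 = N"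
      using N_pos \<Phi>_pos[of 0] unfolding N_eq by (simp add: field_simps)
    ultimately show ?thesis
      using max[of "x + u * t" "y + v * t" "m + w * t"] unfolding g_def by simp
  qed
  from interior_max_derivatives[OF 1 2 max_g]
  show ?first ?second unfolding g'_def by simp_all
qed

text \<open>The left-hand side is the generator of the coupled motion applied to
  \<open>(s^2 + d^4) / 2\<close>. In parabolic weight \<open>s\<close> counts like
  \<open>d^2\<close>, so all terms have the weight of \<open>s^2 + d^4\<close>, and mixed terms
  close by \<open>2 |s| d^2 \<le> s^2 + d^4\<close>. The noise contributes
  \<open>L^2 + 3 L^2\<close> to the constant, the drift at most \<open>3 L\<close>.\<close>

lemma coupled_generator_bound:
  fixes s d L :: real
  assumes L: "L \<ge> 0" and ps: "\<bar>ps\<bar> \<le> L * (\<bar>s\<bar> + d\<^sup>2)" and pb: "\<bar>pb\<bar> \<le> L * (\<bar>s\<bar> + d\<^sup>2)"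
    and ds: "\<bar>ds\<bar> \<le> L * \<bar>d\<bar>" and db: "\<bar>db\<bar> \<le> L * \<bar>d\<bar>"
  shows "(ps\<^sup>2 + 6 * d\<^sup>2 * ds\<^sup>2) / 2 + (s * pb + 2 * d ^ 3 * db) \<le> (4 * L\<^sup>2 + 3 * L) * (s\<^sup>2 + d ^ 4)"
proof -
  have d4: "d ^ 4 = (d\<^sup>2)\<^sup>2" by simp
  have mix: "2 * \<bar>s\<bar> * d\<^sup>2 \<le> s\<^sup>2 + d ^ 4"
    using sum_squares_bound[of "\<bar>s\<bar>" "d\<^sup>2"] unfolding d4 by simp
  have "ps\<^sup>2 \<le> (L * (\<bar>s\<bar> + d\<^sup>2))\<^sup>2"
    using ps by (metis abs_ge_zero power2_abs power_mono)
  also have "\<dots> = L\<^sup>2 * (s\<^sup>2 + d ^ 4 + 2 * \<bar>s\<bar> * d\<^sup>2)"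
    by (simp add: power2_eq_square algebra_simps power4_eq_xxxx flip: abs_mult)
  also have "\<dots> \<le> L\<^sup>2 * (2 * (s\<^sup>2 + d ^ 4))"
    using mix by (intro mult_left_mono) auto
  finally have 1: "ps\<^sup>2 \<le> 2 * L\<^sup>2 * (s\<^sup>2 + d ^ 4)" by (simp add: algebra_simps)
  have "ds\<^sup>2 \<le> (L * \<bar>d\<bar>)\<^sup>2"
    using ds by (metis abs_ge_zero power2_abs power_mono)
  hence "d\<^sup>2 * ds\<^sup>2 \<le> d\<^sup>2 * (L * \<bar>d\<bar>)\<^sup>2" by (intro mult_left_mono) auto
  also have "\<dots> = L\<^sup>2 * d ^ 4" by (simp add: power_mult_distrib d4 power2_eq_square)
  also have "\<dots> \<le> L\<^sup>2 * (s\<^sup>2 + d ^ 4)" by (intro mult_left_mono) auto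
  finally have 2: "d\<^sup>2 * ds\<^sup>2 \<le> L\<^sup>2 * (s\<^sup>2 + d ^ 4)" .
  have "s * pb \<le> \<bar>s\<bar> * \<bar>pb\<bar>" by (metis abs_ge_self abs_mult)
  also have "\<dots> \<le> \<bar>s\<bar> * (L * (\<bar>s\<bar> + d\<^sup>2))" using pb by (intro mult_left_mono) auto
  also have "\<dots> = L * (s\<^sup>2 + (2 * \<bar>s\<bar> * d\<^sup>2) / 2)"
    by (simp add: power2_eq_square algebra_simps flip: abs_mult)
  also have "\<dots> \<le> L * (s\<^sup>2 + (s\<^sup>2 + d ^ 4) / 2)"
    using mix L by (intro mult_left_mono add_left_mono divide_right_mono) auto
  finally have 3: "s * pb \<le> L * (s\<^sup>2 + (s\<^sup>2 + d ^ 4) / 2)" .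
  have "d ^ 3 * db \<le> \<bar>d\<bar> ^ 3 * \<bar>db\<bar>" by (metis abs_ge_self abs_mult power_abs)
  also have "\<dots> \<le> \<bar>d\<bar> ^ 3 * (L * \<bar>d\<bar>)" using db by (intro mult_left_mono) auto
  also have "\<dots> = L * \<bar>d\<bar> ^ 4" by (simp add: power4_eq_xxxx power3_eq_cube)
  finally have 4: "d ^ 3 * db \<le> L * d ^ 4" by simp
  have 5: "L * (s\<^sup>2 + (s\<^sup>2 + d ^ 4) / 2) + 2 * (L * d ^ 4) \<le> 3 * L * (s\<^sup>2 + d ^ 4)"
  proof -
    have "L * (s\<^sup>2 + (s\<^sup>2 + d ^ 4) / 2) + 2 * (L * d ^ 4) = L * (3 / 2 * s\<^sup>2 + 5 / 2 * d ^ 4)"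
      by (simp add: field_simps)
    also have "\<dots> \<le> L * (3 * (s\<^sup>2 + d ^ 4))"
    proof (intro mult_left_mono[OF _ L])
      have "3 / 2 * p + 5 / 2 * q \<le> 3 * (p + q)" if "0 \<le> p" "0 \<le> q" for p q :: real
        using that by simp
      thus "3 / 2 * s\<^sup>2 + 5 / 2 * d ^ 4 \<le> 3 * (s\<^sup>2 + d ^ 4)"
        by (metis zero_le_power2 zero_le_even_power even_numeral)
    qed
    finally show ?thesis by (simp add: algebra_simps)
  qed
  have "(ps\<^sup>2 + 6 * d\<^sup>2 * ds\<^sup>2) / 2 + (s * pb + 2 * d ^ 3 * db)
      = ps\<^sup>2 / 2 + 3 * (d\<^sup>2 * ds\<^sup>2) + (s * pb + 2 * (d ^ 3 * db))" by simp
  also have "\<dots> \<le> 4 * (L\<^sup>2 * (s\<^sup>2 + d ^ 4)) + 3 * L * (s\<^sup>2 + d ^ 4)"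
    using 1 2 3 4 5 by simp
  finally show ?thesis by (simp add: algebra_simps)
qed

section \<open>Estimates from the mean value theorem\<close>

lemma mean_value_between:
  fixes f f' :: "real \<Rightarrow> real"
  assumes "\<And>x. (f has_real_derivative f' x) (at x)"
  obtains \<xi> where "\<bar>\<xi> - a\<bar> \<le> \<bar>b - a\<bar>" "f b - f a = (b - a) * f' \<xi>"
proof -
  consider "a < b" | "b < a" | "a = b" by linarith
  thus thesis
  proof cases
    case 1
    from MVT2[OF this, of f f'] assms obtain \<xi> where "a < \<xi>" "\<xi> < b" "f b - f a = (b - a) * f' \<xi>" by blast
    thus thesis by (intro that[of \<xi>]) auto
  next
    case 2
    from MVT2[OF this, of f f'] assms obtain \<xi> where "b < \<xi>" "\<xi> < a" "f a - f b = (a - b) * f' \<xi>" by blast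
    thus thesis by (intro that[of \<xi>]) (auto simp: algebra_simps)
  qed (use that in auto)
qed

lemma lipschitz_of_bounded_derivative:
  fixes f f' :: "real \<Rightarrow> real"
  assumes "\<And>x. (f has_real_derivative f' x) (at x)" "\<And>x. \<bar>f' x\<bar> \<le> C"
  shows "\<bar>f x - f y\<bar> \<le> C * \<bar>x - y\<bar>"
proof -
  obtain \<xi> where "f x - f y = (x - y) * f' \<xi>"
    using mean_value_between[OF assms(1)] by blast
  thus ?thesis using mult_right_mono[OF assms(2)[of \<xi>], of "\<bar>x - y\<bar>"] by (simp add: abs_mult mult.commute)
qed

text \<open>The midpoint \<open>c\<close> separates two defects: passing from \<open>m\<close> to
  \<open>c\<close> costs first derivatives times \<open>|x + y - 2 m|\<close>, while the symmetric
  difference about \<open>c\<close> costs the variation of \<open>f'\<close> over a distance of at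
  most \<open>|x - y|\<close>.\<close>

lemma three_point_of_bounded_derivatives:
  fixes f f' f'' :: "real \<Rightarrow> real"
  assumes d1: "\<And>x. (f has_real_derivative f' x) (at x)" and d2: "\<And>x. (f' has_real_derivative f'' x) (at x)"
    and b1: "\<And>x. \<bar>f' x\<bar> \<le> C1" and b2: "\<And>x. \<bar>f'' x\<bar> \<le> C2"
  shows "\<bar>f x + f y - 2 * f m\<bar> \<le> C1 * \<bar>x + y - 2 * m\<bar> + C2 * (x - y)\<^sup>2"
proof -
  define c where "c = (x + y) / 2"
  obtain \<xi> where \<xi>: "\<bar>\<xi> - c\<bar> \<le> \<bar>x - c\<bar>" "f x - f c = (x - c) * f' \<xi>"
    using mean_value_between[OF d1] by blast
  obtain \<eta> where \<eta>: "\<bar>\<eta> - c\<bar> \<le> \<bar>y - c\<bar>" "f y - f c = (y - c) * f' \<eta>"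
    using mean_value_between[OF d1] by blast
  have xc: "x - c = (x - y) / 2" "y - c = - ((x - y) / 2)" unfolding c_def by (simp_all add: field_simps)
  have "\<bar>f' \<xi> - f' \<eta>\<bar> \<le> C2 * \<bar>\<xi> - \<eta>\<bar>" by (rule lipschitz_of_bounded_derivative[OF d2 b2])
  also have "\<dots> \<le> C2 * \<bar>x - y\<bar>"
  proof (rule mult_left_mono)
    show "\<bar>\<xi> - \<eta>\<bar> \<le> \<bar>x - y\<bar>" using \<xi>(1) \<eta>(1) xc by linarith
    show "0 \<le> C2" using b2[of 0] by linarith
  qed
  finally have "\<bar>x - y\<bar> * \<bar>f' \<xi> - f' \<eta>\<bar> \<le> \<bar>x - y\<bar> * (C2 * \<bar>x - y\<bar>)" by (rule mult_left_mono) simp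
  also have "\<dots> = C2 * (x - y)\<^sup>2" by (simp add: power2_eq_square mult_ac flip: abs_mult)
  finally have far: "\<bar>(x - y) * (f' \<xi> - f' \<eta>)\<bar> \<le> C2 * (x - y)\<^sup>2" by (simp add: abs_mult)
  have "f x + f y - 2 * f c = (f x - f c) + (f y - f c)" by simp
  also have "\<dots> = (x - y) * (f' \<xi> - f' \<eta>) / 2" unfolding \<xi>(2) \<eta>(2) xc by (simp add: field_simps)
  finally have far': "\<bar>f x + f y - 2 * f c\<bar> \<le> C2 * (x - y)\<^sup>2" using far by linarith
  have "2 * \<bar>f c - f m\<bar> \<le> 2 * (C1 * \<bar>c - m\<bar>)"
    using lipschitz_of_bounded_derivative[OF d1 b1, of c m] by simp
  also have "\<dots> = C1 * \<bar>2 * (c - m)\<bar>" by (simp only: abs_mult)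
  also have "2 * (c - m) = x + y - 2 * m" unfolding c_def by (simp add: field_simps)
  finally have near: "2 * \<bar>f c - f m\<bar> \<le> C1 * \<bar>x + y - 2 * m\<bar>" .
  have "\<bar>f x + f y - 2 * f m\<bar> = \<bar>2 * (f c - f m) + (f x + f y - 2 * f c)\<bar>" by simp
  also have "\<dots> \<le> \<bar>2 * (f c - f m)\<bar> + \<bar>f x + f y - 2 * f c\<bar>" by (rule abs_triangle_ineq)
  also have "\<bar>2 * (f c - f m)\<bar> = 2 * \<bar>f c - f m\<bar>" by (simp only: abs_mult abs_numeral)
  finally have "\<bar>f x + f y - 2 * f m\<bar> \<le> 2 * \<bar>f c - f m\<bar> + \<bar>f x + f y - 2 * f c\<bar>" .
  from order_trans[OF this add_mono[OF near far']] show ?thesis .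
qed

text \<open>Landau-type inequality: \<open>f'\<close> is a difference quotient with step
  \<open>h\<close> up to its own variation. The step stays free so that it can be matched to the
  parabolic scale.\<close>

lemma first_derivative_interpolation:
  fixes f f' f'' :: "real \<Rightarrow> real"
  assumes d1: "\<And>x. (f has_real_derivative f' x) (at x)" and d2: "\<And>x. (f' has_real_derivative f'' x) (at x)"
    and b0: "\<And>x. \<bar>f x\<bar> \<le> C0" and b2: "\<And>x. \<bar>f'' x\<bar> \<le> C2" and h: "h > 0"
  shows "\<bar>f' x\<bar> \<le> 2 * C0 / h + C2 * h"
proof -
  obtain \<xi> where \<xi>: "\<bar>\<xi> - x\<bar> \<le> \<bar>x + h - x\<bar>" "f (x + h) - f x = (x + h - x) * f' \<xi>"
    using mean_value_between[OF d1] by blast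
  have "\<bar>f' \<xi>\<bar> = \<bar>f (x + h) - f x\<bar> / h" using \<xi>(2) h by (simp add: abs_mult)
  also have "\<dots> \<le> 2 * C0 / h"
    using b0[of "x + h"] b0[of x] h by (intro divide_right_mono) auto
  finally have 1: "\<bar>f' \<xi>\<bar> \<le> 2 * C0 / h" .
  have "\<bar>f' \<xi> - f' x\<bar> \<le> C2 * \<bar>\<xi> - x\<bar>" by (rule lipschitz_of_bounded_derivative[OF d2 b2])
  also have "\<dots> \<le> C2 * h" using \<xi>(1) h b2[of 0] by (intro mult_left_mono) auto
  finally show ?thesis using 1 by linarith
qed

text \<open>After subtracting \<open>C h^2\<close> the second difference is maximal at
  \<open>h = 0\<close>, where it vanishes and has second derivative
  \<open>2 l - 2 C\<close>.\<close>

lemma second_derivative_le_of_second_difference: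
  fixes f f' :: "real \<Rightarrow> real"
  assumes d1: "\<And>x. (f has_real_derivative f' x) (at x)" and d2: "(f' has_real_derivative l) (at x)"
    and le: "\<And>h. f (x + h) + f (x - h) - 2 * f x \<le> C * h\<^sup>2"
  shows "l \<le> C"
proof -
  have lin: "((\<lambda>h. x + h) has_real_derivative 1) (at h)" "((\<lambda>h. x - h) has_real_derivative -1) (at h)" for h
    by (auto intro!: derivative_eq_intros)
  have d2': "(f' has_real_derivative l) (at (x + 0))" "(f' has_real_derivative l) (at (x - 0))" using d2 by simp_all
  have 1: "((\<lambda>h. f (x + h) + f (x - h) - 2 * f x - C * h\<^sup>2) has_real_derivative
      f' (x + h) * 1 + f' (x - h) * (-1) - 0 - C * (2 * h)) (at h)" for h
    by (intro DERIV_diff DERIV_add DERIV_chain2[OF d1] lin DERIV_const DERIV_cmult)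
       (auto intro!: derivative_eq_intros)
  have 2: "((\<lambda>h. f' (x + h) * 1 + f' (x - h) * (-1) - 0 - C * (2 * h)) has_real_derivative
      l * 1 * 1 + l * (-1) * (-1) - 0 - C * (2 * 1)) (at 0)"
    by (intro DERIV_diff DERIV_add DERIV_cmult_right DERIV_chain2[where g = "\<lambda>h. x + h", OF d2'(1)] DERIV_chain2[where g = "\<lambda>h. x - h", OF d2'(2)] lin
          DERIV_const DERIV_cmult DERIV_ident)
  show ?thesis using interior_max_derivatives(2)[OF 1 2] le by simp
qed

text \<open>\<open>\<sigma>\<close> and \<open>\<beta>\<close> play the roles of dispersion and
  drift of the log price. The three-point inequalities stand for bounded second derivatives, in the
  form in which the coupled motion of \<open>x + y - 2 m\<close> sees them.\<close>

locale coupled_coefficients =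
  fixes T L :: real and \<sigma> \<beta> :: "real \<Rightarrow> real \<Rightarrow> real"
  assumes L: "0 \<le> L"
    and \<sigma>_bdd: "\<And>x t. t \<in> {0<..T} \<Longrightarrow> \<bar>\<sigma> x t\<bar> \<le> L"
    and \<beta>_bdd: "\<And>x t. t \<in> {0<..T} \<Longrightarrow> \<bar>\<beta> x t\<bar> \<le> L"
    and \<sigma>_lip: "\<And>x y t. t \<in> {0<..T} \<Longrightarrow> \<bar>\<sigma> x t - \<sigma> y t\<bar> \<le> L * \<bar>x - y\<bar>"
    and \<beta>_lip: "\<And>x y t. t \<in> {0<..T} \<Longrightarrow> \<bar>\<beta> x t - \<beta> y t\<bar> \<le> L * \<bar>x - y\<bar>"
    and \<sigma>_3: "\<And>x y m t. t \<in> {0<..T} \<Longrightarrow>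
        \<bar>\<sigma> x t + \<sigma> y t - 2 * \<sigma> m t\<bar> \<le> L * (\<bar>x + y - 2 * m\<bar> + (x - y)\<^sup>2)"
    and \<beta>_3: "\<And>x y m t. t \<in> {0<..T} \<Longrightarrow>
        \<bar>\<beta> x t + \<beta> y t - 2 * \<beta> m t\<bar> \<le> L * (\<bar>x + y - 2 * m\<bar> + (x - y)\<^sup>2)"
begin

text \<open>
  Second differences are controlled by letting the three points \<open>x\<close>, \<open>y\<close>, \<open>m\<close> move independently
  and penalising \<open>x + y - 2 m\<close> linearly and \<open>x - y\<close> quadratically.  The maximum principle is
  applied along the single direction \<open>(\<sigma> x, \<sigma> y, \<sigma> m)\<close>, which makes the second-order terms of the
  three copies of the equation combine; no derivative of the equation is ever taken.
\<close>

lemma three_point_bound: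
  fixes z zt zx zxx R :: "real \<Rightarrow> real \<Rightarrow> real"
  assumes \<gamma>: "0 < \<gamma>" and H: "0 \<le> H"
    and cont: "continuous_on (UNIV \<times> {0..T}) (\<lambda>(x, t). z x t)"
    and bdd: "\<And>x t. t \<in> {0..T} \<Longrightarrow> \<bar>z x t\<bar> \<le> B"
    and init: "\<And>x. z x 0 = 0"
    and dt: "\<And>x t. t \<in> {0<..T} \<Longrightarrow> (z x has_real_derivative zt x t) (at t within {0..T})"
    and dx: "\<And>x t. t \<in> {0<..T} \<Longrightarrow> ((\<lambda>x. z x t) has_real_derivative zx x t) (at x)"
    and dxx: "\<And>x t. t \<in> {0<..T} \<Longrightarrow> ((\<lambda>x. zx x t) has_real_derivative zxx x t) (at x)"
    and eq: "\<And>x t. t \<in> {0<..T} \<Longrightarrow> zt x t = (\<sigma> x t)\<^sup>2 * zxx x t / 2 + \<beta> x t * zx x t + R x t"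
    and R_3: "\<And>x y m t. t \<in> {0<..T} \<Longrightarrow>
        R x t + R y t - 2 * R m t \<le> H * t powr (\<gamma> - 1) * (\<bar>x + y - 2 * m\<bar> + (x - y)\<^sup>2)"
    and t: "t \<in> {0<..T}"
  shows "z (x + h) t + z (x - h) t - 2 * z x t
           \<le> 4 * (2 * H / \<gamma>) * exp ((4 * L\<^sup>2 + 3 * L) * T) * t powr \<gamma> * h\<^sup>2"
proof -
  define k where "k = 4 * L\<^sup>2 + 3 * L"
  \<comment> \<open>\<open>A\<close> solves
    \<open>A' = k A + 2 H t powr (\<gamma> - 1) exp (k t)\<close> with \<open>A 0 = 0\<close>: the
    first term pays for the coupled generator, the second for the source. The factor 2 comes from
    bounding \<open>|s| + d^2\<close> by twice the smoothed penalty.\<close>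
  define A where "A t = 2 * H / \<gamma> * t powr \<gamma> * exp (k * t)" for t
  \<comment> \<open>Large enough for the quadratic localisation times
    \<open>exp (\<kappa> t)\<close> to be a strict supersolution.\<close>
  define \<kappa> where "\<kappa> = 3 * L\<^sup>2 + 3 * L + 1"
  have k0: "k \<ge> 0" using L unfolding k_def by simp
  have A0: "A t \<ge> 0" for t using H \<gamma> unfolding A_def by simp
  have T0: "T > 0" using t by auto
  have A_cont: "continuous_on {0..T} A"
    unfolding A_def using \<gamma> by (auto intro!: continuous_intros continuous_on_powr')
  have dA: "(A has_real_derivative k * A t + 2 * H * t powr (\<gamma> - 1) * exp (k * t)) (at t within {0..T})"
    if "t > 0" for t
    unfolding A_def using that \<gamma>
    by (auto intro!: derivative_eq_intros simp: field_simps powr_diff)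
  have z_comp: "continuous_on Q (\<lambda>p. z (f p) (g p))"
    if "continuous_on Q f" "continuous_on Q g" "g ` Q \<subseteq> {0..T}" for f g and Q :: "(real \<times> real \<times> real \<times> real) set"
  proof -
    have "continuous_on Q ((\<lambda>(x, t). z x t) \<circ> (\<lambda>p. (f p, g p)))"
      using that by (intro continuous_on_compose continuous_on_Pair continuous_on_subset[OF cont]) auto
    thus ?thesis by (simp add: o_def)
  qed
  \<comment> \<open>\<open>\<theta>\<close> smooths the penalty at its zero, and
    \<open>\<epsilon>\<close> makes the maximum be attained although space is unbounded; both are
    removed afterwards.\<close>
  have main: "z x t + z y t - 2 * z m t
      \<le> A t * sqrt ((x + y - 2 * m)\<^sup>2 + (x - y) ^ 4 + \<theta>\<^sup>2) + \<epsilon> * (exp (\<kappa> * t) * (1 + x\<^sup>2 + y\<^sup>2 + m\<^sup>2))"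
    if \<theta>: "\<theta> > 0" and \<epsilon>: "\<epsilon> > 0" and t: "t \<in> {0..T}" for x y m t \<theta> \<epsilon>
  proof (rule ccontr)
    define N where "N x y m = sqrt ((x + y - 2 * m)\<^sup>2 + (x - y) ^ 4 + \<theta>\<^sup>2)" for x y m
    define F where "F x y m t = z x t + z y t - 2 * z m t - A t * N x y m
        - \<epsilon> * exp (\<kappa> * t) * (1 + x\<^sup>2 + y\<^sup>2 + m\<^sup>2)" for x y m t
    assume "\<not> ?thesis"
    hence F_pos: "F x y m t > 0" unfolding F_def N_def by simp
    have N0: "N x y m > 0" for x y m
      unfolding N_def using \<theta> by (simp add: add_nonneg_pos)
    have B0: "B \<ge> 0" using bdd[OF t, of x] by linarith
    define \<rho> where "\<rho> = sqrt (4 * B / \<epsilon>)"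
    \<comment> \<open>\<open>z\<close> is bounded, so \<open>F\<close> can be positive only on a
      bounded set of points, uniformly in time.\<close>
    have coercive: "1 + x\<^sup>2 + y\<^sup>2 + m\<^sup>2 < 4 * B / \<epsilon>" if "t \<in> {0..T}" "F x y m t > 0" for x y m t
    proof -
      have "0 < 4 * B - \<epsilon> * exp (\<kappa> * t) * (1 + x\<^sup>2 + y\<^sup>2 + m\<^sup>2)"
        using that(2) bdd[OF that(1), of x] bdd[OF that(1), of y] bdd[OF that(1), of m]
          mult_nonneg_nonneg[OF A0[of t] less_imp_le[OF N0[of x y m]]]
        unfolding F_def by linarith
      moreover have "\<epsilon> * exp (\<kappa> * t) * (1 + x\<^sup>2 + y\<^sup>2 + m\<^sup>2) \<ge> \<epsilon> * 1 * (1 + x\<^sup>2 + y\<^sup>2 + m\<^sup>2)"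
        using \<epsilon> L that(1) by (intro mult_right_mono mult_left_mono) (auto simp: \<kappa>_def)
      ultimately show ?thesis using \<epsilon> by (simp add: field_simps)
    qed
    have inside: "x \<in> {-\<rho>..\<rho>}" "y \<in> {-\<rho>..\<rho>}" "m \<in> {-\<rho>..\<rho>}"
      if "t \<in> {0..T}" "F x y m t > 0" for x y m t
    proof -
      have *: "\<bar>a\<bar> \<le> \<rho>" if "a\<^sup>2 \<le> 4 * B / \<epsilon>" for a
        using that unfolding \<rho>_def by (metis real_sqrt_abs real_sqrt_le_mono)
      have "x\<^sup>2 \<le> 4 * B / \<epsilon>" "y\<^sup>2 \<le> 4 * B / \<epsilon>" "m\<^sup>2 \<le> 4 * B / \<epsilon>"
        using coercive[OF that] by (smt (verit) zero_le_power2)+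
      from this[THEN *] show "x \<in> {-\<rho>..\<rho>}" "y \<in> {-\<rho>..\<rho>}" "m \<in> {-\<rho>..\<rho>}" by auto
    qed
    define Q where "Q = {-\<rho>..\<rho>} \<times> {-\<rho>..\<rho>} \<times> {-\<rho>..\<rho>} \<times> {0..T}"
    have "compact Q" unfolding Q_def by (intro compact_Times compact_Icc)
    moreover have "(x, y, m, t) \<in> Q" unfolding Q_def using inside[OF t F_pos] t by auto
    moreover have "continuous_on Q (\<lambda>p. F (fst p) (fst (snd p)) (fst (snd (snd p))) (snd (snd (snd p))))"
      unfolding F_def N_def Q_def
      by (intro continuous_intros z_comp continuous_on_compose2[OF A_cont]) auto
    ultimately obtain p where p: "p \<in> Q"
      "\<And>q. q \<in> Q \<Longrightarrow> F (fst q) (fst (snd q)) (fst (snd (snd q))) (snd (snd (snd q)))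
         \<le> F (fst p) (fst (snd p)) (fst (snd (snd p))) (snd (snd (snd p)))"
      using continuous_attains_sup[of Q] by blast
    obtain x0 y0 m0 t0 where p_eq: "p = (x0, y0, m0, t0)" by (metis prod_cases4)
    have t0: "t0 \<in> {0..T}" using p(1) unfolding p_eq Q_def by auto
    have F0_pos: "F x0 y0 m0 t0 > 0"
      using p(2)[OF \<open>(x, y, m, t) \<in> Q\<close>] F_pos unfolding p_eq by simp
    have max: "F x y m t \<le> F x0 y0 m0 t0" if "t \<in> {0..T}" for x y m t
    proof (cases "F x y m t > 0")
      case True
      with p(2)[of "(x, y, m, t)"] inside[OF that True] that show ?thesis unfolding p_eq Q_def by auto
    qed (use F0_pos in simp)
    \<comment> \<open>The maximum is not at time 0: \<open>z\<close> vanishes there, and so does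
      \<open>A\<close>, because \<open>0 powr \<gamma> = 0\<close>.\<close>
    have "F x0 y0 m0 0 \<le> 0"
      using \<epsilon> \<gamma> unfolding F_def A_def by (simp add: init)
    hence t0_pos: "t0 > 0" using F0_pos t0 by (cases "t0 = 0") auto
    hence t0': "t0 \<in> {0<..T}" using t0 by auto
    define s d n E where "s = x0 + y0 - 2 * m0" and "d = x0 - y0" and "n = N x0 y0 m0"
      and "E = \<epsilon> * exp (\<kappa> * t0)"
    have n0: "n > 0" and n2: "s\<^sup>2 + d ^ 4 \<le> n\<^sup>2"
      unfolding n_def N_def s_def d_def using \<theta> by (simp_all add: add_nonneg_pos)
    have n2': "s\<^sup>2 \<le> n\<^sup>2" "(d\<^sup>2)\<^sup>2 \<le> n\<^sup>2"
    proof -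
      have "(d\<^sup>2)\<^sup>2 = d ^ 4" by simp
      thus "s\<^sup>2 \<le> n\<^sup>2" "(d\<^sup>2)\<^sup>2 \<le> n\<^sup>2"
        using n2 zero_le_power2[of s] zero_le_power2[of "d\<^sup>2"] by linarith+
    qed
    have sd: "\<bar>s\<bar> + d\<^sup>2 \<le> 2 * n"
      using n0 abs_le_square_iff[of s n] n2'(1) power2_le_imp_le[OF n2'(2)] by simp
    have E0: "E > 0" using \<epsilon> unfolding E_def by simp

    have time: "0 \<le> zt x0 t0 + zt y0 t0 - 2 * zt m0 t0
        - (k * A t0 + 2 * H * t0 powr (\<gamma> - 1) * exp (k * t0)) * n
        - \<kappa> * E * (1 + x0\<^sup>2 + y0\<^sup>2 + m0\<^sup>2)"
    proof (rule derivative_within_nonneg_at_max)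
      show "((\<lambda>t. F x0 y0 m0 t) has_real_derivative zt x0 t0 + zt y0 t0 - 2 * zt m0 t0
          - (k * A t0 + 2 * H * t0 powr (\<gamma> - 1) * exp (k * t0)) * n
          - \<kappa> * E * (1 + x0\<^sup>2 + y0\<^sup>2 + m0\<^sup>2)) (at t0 within {0..T})"
      proof -
        have dE: "((\<lambda>t. \<epsilon> * exp (\<kappa> * t) * (1 + x0\<^sup>2 + y0\<^sup>2 + m0\<^sup>2)) has_real_derivative
            \<kappa> * E * (1 + x0\<^sup>2 + y0\<^sup>2 + m0\<^sup>2)) (at t0 within {0..T})"
          unfolding E_def by (auto intro!: derivative_eq_intros)
        show ?thesis
          unfolding n_def F_def[abs_def]
          by (intro DERIV_diff DERIV_add DERIV_cmult DERIV_cmult_right dt[OF t0'] dA t0_pos dE)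
      qed
    qed (use t0 t0_pos max in auto)

    note line = line_max_conditions[where f = "\<lambda>x. z x t0", OF dx[OF t0'] dxx[OF t0'] _ \<theta> A0[of t0]]
    have max': "z x' t0 + z y' t0 - 2 * z m' t0 - A t0 * sqrt ((x' + y' - 2 * m')\<^sup>2 + (x' - y') ^ 4 + \<theta>\<^sup>2)
          - E * (1 + x'\<^sup>2 + y'\<^sup>2 + m'\<^sup>2)
        \<le> z x0 t0 + z y0 t0 - 2 * z m0 t0 - A t0 * n - E * (1 + x0\<^sup>2 + y0\<^sup>2 + m0\<^sup>2)" for x' y' m'
      using max[OF t0, of x' y' m'] unfolding F_def N_def E_def n_def .
    have n_eq: "n = sqrt ((x0 + y0 - 2 * m0)\<^sup>2 + (x0 - y0) ^ 4 + \<theta>\<^sup>2)" by (simp add: n_def N_def)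
    define ps ds pb db where "ps = \<sigma> x0 t0 + \<sigma> y0 t0 - 2 * \<sigma> m0 t0" and "ds = \<sigma> x0 t0 - \<sigma> y0 t0"
      and "pb = \<beta> x0 t0 + \<beta> y0 t0 - 2 * \<beta> m0 t0" and "db = \<beta> x0 t0 - \<beta> y0 t0"
    \<comment> \<open>Direction \<open>\<beta>\<close> combines the three drift terms into one
      expression, so the derivatives \<open>zx\<close> never have to be bounded separately.\<close>
    have first: "\<beta> x0 t0 * zx x0 t0 + \<beta> y0 t0 * zx y0 t0 - 2 * \<beta> m0 t0 * zx m0 t0
        = A t0 * (s * pb + 2 * d ^ 3 * db) / n
          + 2 * E * (x0 * \<beta> x0 t0 + y0 * \<beta> y0 t0 + m0 * \<beta> m0 t0)"
      using line(1)[OF n_eq max', of "\<beta> x0 t0" "\<beta> y0 t0" "\<beta> m0 t0"]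
      unfolding s_def d_def pb_def db_def .
    have second: "(\<sigma> x0 t0)\<^sup>2 * zxx x0 t0 + (\<sigma> y0 t0)\<^sup>2 * zxx y0 t0 - 2 * (\<sigma> m0 t0)\<^sup>2 * zxx m0 t0
        \<le> A t0 * (ps\<^sup>2 + 6 * d\<^sup>2 * ds\<^sup>2) / n
          + 2 * E * ((\<sigma> x0 t0)\<^sup>2 + (\<sigma> y0 t0)\<^sup>2 + (\<sigma> m0 t0)\<^sup>2)"
      using line(2)[OF n_eq max', of "\<sigma> x0 t0" "\<sigma> y0 t0" "\<sigma> m0 t0"]
      unfolding d_def ps_def ds_def .
    have "(ps\<^sup>2 + 6 * d\<^sup>2 * ds\<^sup>2) / 2 + (s * pb + 2 * d ^ 3 * db) \<le> k * (s\<^sup>2 + d ^ 4)"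
      unfolding k_def
      by (rule coupled_generator_bound[OF L])
         (use \<sigma>_3 \<beta>_3 \<sigma>_lip \<beta>_lip t0' in \<open>auto simp: ps_def pb_def ds_def db_def s_def d_def\<close>)
    also have "\<dots> \<le> k * n\<^sup>2" using n2 k0 by (intro mult_left_mono) auto
    finally have "A t0 * ((ps\<^sup>2 + 6 * d\<^sup>2 * ds\<^sup>2) / 2 + (s * pb + 2 * d ^ 3 * db)) / n \<le> A t0 * (k * n\<^sup>2) / n"
      using A0 n0 by (intro divide_right_mono mult_left_mono) auto
    also have "\<dots> = k * A t0 * n" using n0 by (simp add: power2_eq_square)
    finally have gen: "A t0 * (ps\<^sup>2 + 6 * d\<^sup>2 * ds\<^sup>2) / n / 2 + A t0 * (s * pb + 2 * d ^ 3 * db) / n \<le> k * A t0 * n"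
      by (simp add: add_divide_distrib ring_distribs)
    have \<sigma>2: "(\<sigma> x t0)\<^sup>2 \<le> L\<^sup>2" for x
      using \<sigma>_bdd[OF t0', of x] L by (simp add: abs_le_square_iff[symmetric])
    have x\<beta>: "2 * (x * \<beta> x t0) \<le> L * (1 + x\<^sup>2)" for x
    proof -
      have "x * \<beta> x t0 \<le> \<bar>x\<bar> * \<bar>\<beta> x t0\<bar>" by (metis abs_ge_self abs_mult)
      also have "\<dots> \<le> \<bar>x\<bar> * L" using \<beta>_bdd[OF t0'] by (intro mult_left_mono) auto
      finally have "2 * (x * \<beta> x t0) \<le> L * (2 * \<bar>x\<bar>)" by (simp add: mult_ac)
      also have "2 * \<bar>x\<bar> \<le> 1 + x\<^sup>2" using sum_squares_bound[of 1 "\<bar>x\<bar>"] by simp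
      finally show ?thesis using L by (simp add: mult_left_mono)
    qed
    \<comment> \<open>The dispersion gives \<open>3 L^2\<close> and the drift
      \<open>L (3 + X)\<close>, by \<open>2 |x| \<le> 1 + x^2\<close>. The summand 1 in
      \<open>\<kappa>\<close> makes the inequality strict, and this strictness produces the
      contradiction with the time condition.\<close>
    have pen: "(\<sigma> x0 t0)\<^sup>2 + (\<sigma> y0 t0)\<^sup>2 + (\<sigma> m0 t0)\<^sup>2 + 2 * (x0 * \<beta> x0 t0 + y0 * \<beta> y0 t0 + m0 * \<beta> m0 t0)
        < \<kappa> * (1 + x0\<^sup>2 + y0\<^sup>2 + m0\<^sup>2)"
    proof -
      define X where "X = x0\<^sup>2 + y0\<^sup>2 + m0\<^sup>2"
      have X0: "X \<ge> 0" unfolding X_def by simp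
      have "(\<sigma> x0 t0)\<^sup>2 + (\<sigma> y0 t0)\<^sup>2 + (\<sigma> m0 t0)\<^sup>2 + 2 * (x0 * \<beta> x0 t0 + y0 * \<beta> y0 t0 + m0 * \<beta> m0 t0)
          \<le> 3 * L\<^sup>2 + L * (3 + X)"
        using \<sigma>2[of x0] \<sigma>2[of y0] \<sigma>2[of m0] x\<beta>[of x0] x\<beta>[of y0] x\<beta>[of m0]
        unfolding X_def by (simp add: algebra_simps)
      also have "\<dots> < \<kappa> * (1 + X)"
      proof -
        have "0 \<le> L * X" "0 \<le> L\<^sup>2 * X" using L X0 by simp_all
        moreover have "\<kappa> * (1 + X) = 3 * L\<^sup>2 + L * (3 + X) + (3 * (L\<^sup>2 * X) + 2 * (L * X) + 1 + X)"
          unfolding \<kappa>_def by (simp add: algebra_simps)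
        ultimately show ?thesis using X0 by linarith
      qed
      finally show ?thesis unfolding X_def by (simp add: add.assoc)
    qed
    have src: "R x0 t0 + R y0 t0 - 2 * R m0 t0 \<le> 2 * H * t0 powr (\<gamma> - 1) * exp (k * t0) * n"
    proof -
      have "R x0 t0 + R y0 t0 - 2 * R m0 t0 \<le> H * t0 powr (\<gamma> - 1) * (\<bar>s\<bar> + d\<^sup>2)"
        using R_3[OF t0', of x0 y0 m0] unfolding s_def d_def .
      also have "\<dots> \<le> H * t0 powr (\<gamma> - 1) * (2 * n)" using sd H by (intro mult_left_mono) auto
      also have "\<dots> = 2 * H * t0 powr (\<gamma> - 1) * 1 * n" by simp
      also have "\<dots> \<le> 2 * H * t0 powr (\<gamma> - 1) * exp (k * t0) * n"
        using H n0 k0 t0_pos by (intro mult_right_mono mult_left_mono) auto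
      finally show ?thesis .
    qed
    have "zt x0 t0 + zt y0 t0 - 2 * zt m0 t0
        = ((\<sigma> x0 t0)\<^sup>2 * zxx x0 t0 + (\<sigma> y0 t0)\<^sup>2 * zxx y0 t0 - 2 * (\<sigma> m0 t0)\<^sup>2 * zxx m0 t0) / 2
          + (\<beta> x0 t0 * zx x0 t0 + \<beta> y0 t0 * zx y0 t0 - 2 * \<beta> m0 t0 * zx m0 t0)
          + (R x0 t0 + R y0 t0 - 2 * R m0 t0)"
      unfolding eq[OF t0'] by (simp add: field_simps)
    also have "\<dots> \<le> (A t0 * (ps\<^sup>2 + 6 * d\<^sup>2 * ds\<^sup>2) / n / 2 + A t0 * (s * pb + 2 * d ^ 3 * db) / n)
        + E * ((\<sigma> x0 t0)\<^sup>2 + (\<sigma> y0 t0)\<^sup>2 + (\<sigma> m0 t0)\<^sup>2 + 2 * (x0 * \<beta> x0 t0 + y0 * \<beta> y0 t0 + m0 * \<beta> m0 t0))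
        + 2 * H * t0 powr (\<gamma> - 1) * exp (k * t0) * n"
    proof -
      have gen: "a / 2 + b + c \<le> (p / 2 + q) + E * (w + 2 * u) + v"
        if "a \<le> p + 2 * E * w" "b = q + 2 * E * u" "c \<le> v" for a b c p q w u v
        using that by (simp add: algebra_simps)
      show ?thesis by (rule gen[OF second first src])
    qed
    also have "\<dots> < k * A t0 * n + E * (\<kappa> * (1 + x0\<^sup>2 + y0\<^sup>2 + m0\<^sup>2)) + 2 * H * t0 powr (\<gamma> - 1) * exp (k * t0) * n"
      using gen mult_strict_left_mono[OF pen E0] by linarith
    finally show False using time by (simp add: algebra_simps)
  qed
  \<comment> \<open>Both parameters are set to the same value and sent to 0. On the configuration
    \<open>(x + h, x - h, x)\<close> the linear defect is 0 and the distance is \<open>2 h\<close>,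
    so the penalty becomes \<open>4 h^2\<close>.\<close>
  have lim: "((\<lambda>\<epsilon>. A t * sqrt ((2 * h) ^ 4 + \<epsilon>\<^sup>2) + \<epsilon> * (exp (\<kappa> * t) * (1 + (x + h)\<^sup>2 + (x - h)\<^sup>2 + x\<^sup>2)))
      \<longlongrightarrow> A t * sqrt ((2 * h) ^ 4 + 0\<^sup>2) + 0 * (exp (\<kappa> * t) * (1 + (x + h)\<^sup>2 + (x - h)\<^sup>2 + x\<^sup>2))) (at_right 0)"
    by (intro tendsto_intros)
  have "z (x + h) t + z (x - h) t - 2 * z x t \<le> A t * sqrt ((2 * h) ^ 4 + 0\<^sup>2) + 0 * (exp (\<kappa> * t) * (1 + (x + h)\<^sup>2 + (x - h)\<^sup>2 + x\<^sup>2))"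
    by (rule tendsto_lowerbound[OF lim])
       (use main[of _ _ t "x + h" "x - h" x] t in \<open>auto simp: eventually_at_right_field intro!: exI[of _ 1]\<close>)
  also have "\<dots> = A t * (4 * h\<^sup>2)"
  proof -
    have "sqrt ((2 * h) ^ 4 + 0\<^sup>2) = 4 * h\<^sup>2"
      by (rule real_sqrt_unique) (simp_all add: power_mult_distrib)
    thus ?thesis by simp
  qed
  also have "\<dots> \<le> 2 * H / \<gamma> * t powr \<gamma> * exp (k * T) * (4 * h\<^sup>2)"
    unfolding A_def using H \<gamma> t k0 by (intro mult_right_mono mult_left_mono) (auto intro: mult_left_mono)
  finally show ?thesis unfolding k_def by (simp add: mult_ac)
qed

text \<open>The three-point bound is one-sided, hence it is applied to \<open>z\<close> and to
  \<open>- z\<close> through the sign \<open>s\<close>; this is why the source is now controlled in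
  absolute value. Symmetric second differences then turn into a bound on \<open>zxx\<close>.\<close>

lemma second_derivative_bound:
  fixes z zt zx zxx R :: "real \<Rightarrow> real \<Rightarrow> real"
  assumes \<gamma>: "0 < \<gamma>" and H: "0 \<le> H"
    and cont: "continuous_on (UNIV \<times> {0..T}) (\<lambda>(x, t). z x t)"
    and bdd: "\<And>x t. t \<in> {0..T} \<Longrightarrow> \<bar>z x t\<bar> \<le> B"
    and init: "\<And>x. z x 0 = 0"
    and dt: "\<And>x t. t \<in> {0<..T} \<Longrightarrow> (z x has_real_derivative zt x t) (at t within {0..T})"
    and dx: "\<And>x t. t \<in> {0<..T} \<Longrightarrow> ((\<lambda>x. z x t) has_real_derivative zx x t) (at x)"
    and dxx: "\<And>x t. t \<in> {0<..T} \<Longrightarrow> ((\<lambda>x. zx x t) has_real_derivative zxx x t) (at x)"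
    and eq: "\<And>x t. t \<in> {0<..T} \<Longrightarrow>
        zt x t = (\<sigma> x t)\<^sup>2 * zxx x t / 2 + \<beta> x t * zx x t - r * z x t + R x t"
    and R_3: "\<And>x y m t. t \<in> {0<..T} \<Longrightarrow>
        \<bar>R x t + R y t - 2 * R m t\<bar> \<le> H * t powr (\<gamma> - 1) * (\<bar>x + y - 2 * m\<bar> + (x - y)\<^sup>2)"
  shows "\<exists>C\<ge>0. \<forall>x. \<forall>t\<in>{0<..T}. \<bar>zxx x t\<bar> \<le> C * t powr \<gamma>"
proof (intro exI conjI allI ballI)
  define H' where "H' = exp (\<bar>r\<bar> * T) * H"
  define K where "K = 4 * (2 * H' / \<gamma>) * exp ((4 * L\<^sup>2 + 3 * L) * T)"
  have H': "H' \<ge> 0" using H unfolding H'_def by simp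
  have K: "K \<ge> 0" using H' \<gamma> unfolding K_def by simp
  show "0 \<le> exp (\<bar>r\<bar> * T) * K" using K by simp
  have one_sided: "s * zxx x t \<le> exp (\<bar>r\<bar> * T) * K * t powr \<gamma>"
    if s: "s = 1 \<or> s = -1" and t: "t \<in> {0<..T}" for s x t
  proof -
    \<comment> \<open>The factor \<open>exp (r t)\<close> removes the zero-order term.\<close>
    define e where "e t = s * exp (r * t)" for t
    have e_abs: "\<bar>e t\<bar> \<le> exp (\<bar>r\<bar> * T)" if "t \<in> {0..T}" for t
    proof -
      have "r * t \<le> \<bar>r\<bar> * T" using that by (intro mult_mono) auto
      thus ?thesis using s unfolding e_def by auto
    qed
    have e_d: "(e has_real_derivative r * e t) (at t within {0..T})" for t
      unfolding e_def by (auto intro!: derivative_eq_intros)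
    have "e t * z (x + h) t + e t * z (x - h) t - 2 * (e t * z x t) \<le> K * t powr \<gamma> * h\<^sup>2" for h
      unfolding K_def
    proof (rule three_point_bound[where z = "\<lambda>x t. e t * z x t" and zx = "\<lambda>x t. e t * zx x t"
          and zxx = "\<lambda>x t. e t * zxx x t" and R = "\<lambda>x t. e t * R x t"
          and zt = "\<lambda>x t. r * e t * z x t + zt x t * e t" and B = "exp (\<bar>r\<bar> * T) * B", OF \<gamma> H'])
      show "continuous_on (UNIV \<times> {0..T}) (\<lambda>(x, t). e t * z x t)"
        using cont unfolding e_def split_def by (intro continuous_intros)
      show "\<bar>e t * z x t\<bar> \<le> exp (\<bar>r\<bar> * T) * B" if "t \<in> {0..T}" for x t
        unfolding abs_mult using e_abs[OF that] bdd[OF that] by (intro mult_mono) auto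
      show "((\<lambda>t. e t * z x t) has_real_derivative r * e t * z x t + zt x t * e t) (at t within {0..T})"
        if "t \<in> {0<..T}" for x t
        by (rule DERIV_mult[OF e_d dt[OF that]])
      show "((\<lambda>x. e t * z x t) has_real_derivative e t * zx x t) (at x)" if "t \<in> {0<..T}" for x t
        by (rule DERIV_cmult[OF dx[OF that]])
      show "((\<lambda>x. e t * zx x t) has_real_derivative e t * zxx x t) (at x)" if "t \<in> {0<..T}" for x t
        by (rule DERIV_cmult[OF dxx[OF that]])
      show "r * e t * z x t + zt x t * e t
          = (\<sigma> x t)\<^sup>2 * (e t * zxx x t) / 2 + \<beta> x t * (e t * zx x t) + e t * R x t"
        if "t \<in> {0<..T}" for x t
        unfolding eq[OF that] by (simp add: algebra_simps)
      show "e t * R x t + e t * R y t - 2 * (e t * R m t)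
          \<le> H' * t powr (\<gamma> - 1) * (\<bar>x + y - 2 * m\<bar> + (x - y)\<^sup>2)" if "t \<in> {0<..T}" for x y m t
      proof -
        have "e t * R x t + e t * R y t - 2 * (e t * R m t) = e t * (R x t + R y t - 2 * R m t)"
          by (simp add: algebra_simps)
        also have "\<dots> \<le> \<bar>e t\<bar> * \<bar>R x t + R y t - 2 * R m t\<bar>" by (metis abs_ge_self abs_mult)
        also have "\<dots> \<le> exp (\<bar>r\<bar> * T) * (H * t powr (\<gamma> - 1) * (\<bar>x + y - 2 * m\<bar> + (x - y)\<^sup>2))"
          using e_abs[of t] R_3[OF that] that by (intro mult_mono) auto
        finally show ?thesis unfolding H'_def by (simp add: mult_ac)
      qed
    qed (use init t in auto)
    hence "e t * zxx x t \<le> K * t powr \<gamma>"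
      by (rule second_derivative_le_of_second_difference
            [where f = "\<lambda>x. e t * z x t" and f' = "\<lambda>x. e t * zx x t",
             OF DERIV_cmult[OF dx[OF t]] DERIV_cmult[OF dxx[OF t]]])
    hence "exp (- r * t) * (e t * zxx x t) \<le> exp (- r * t) * (K * t powr \<gamma>)"
      by (rule mult_left_mono) simp
    also have "exp (- r * t) * (e t * zxx x t) = s * zxx x t"
      unfolding e_def by (simp add: exp_minus)
    also have "exp (- r * t) * (K * t powr \<gamma>) \<le> exp (\<bar>r\<bar> * T) * (K * t powr \<gamma>)"
    proof (intro mult_right_mono)
      show "exp (- r * t) \<le> exp (\<bar>r\<bar> * T)" using t mult_mono[of "- r" "\<bar>r\<bar>" t T] by auto
    qed (use K in auto)
    finally show ?thesis by (simp add: mult_ac)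
  qed
  show "\<bar>zxx x t\<bar> \<le> exp (\<bar>r\<bar> * T) * K * t powr \<gamma>" if "t \<in> {0<..T}" for x t
    using one_sided[of 1 t x] one_sided[of "-1" t x] that by auto
qed

end

section \<open>The strike-matched carrier\<close>

lemma std_normal_cdf_range: "0 \<le> std_normal_cdf x" "std_normal_cdf x \<le> 1"
proof -
  interpret real_distribution std_normal_distribution by (rule real_dist_normal_dist)
  show "0 \<le> std_normal_cdf x" "std_normal_cdf x \<le> 1"
    unfolding std_normal_cdf_def by (simp_all add: cdf_nonneg cdf_bounded_prob)
qed

lemma std_normal_cdf_limits:
  "(std_normal_cdf \<longlongrightarrow> 1) at_top" "(std_normal_cdf \<longlongrightarrow> 0) at_bot"
proof -
  interpret real_distribution std_normal_distribution by (rule real_dist_normal_dist)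
  show "(std_normal_cdf \<longlongrightarrow> 1) at_top" "(std_normal_cdf \<longlongrightarrow> 0) at_bot"
    unfolding std_normal_cdf_def by (rule cdf_lim_at_top_prob cdf_lim_at_bot)+
qed

text \<open>Increments of the distribution function are masses of half-open intervals; up to a null
  end point they are integrals of the continuous density over a compact window, where the
  fundamental theorem of calculus applies.\<close>

lemma std_normal_cdf_has_derivative:
  "(std_normal_cdf has_real_derivative std_normal_density x) (at x)"
proof -
  interpret real_distribution std_normal_distribution by (rule real_dist_normal_dist)
  have cont: "continuous_on S std_normal_density" for S
    unfolding std_normal_density_def by (intro continuous_intros) auto
  have eq: "std_normal_cdf y = std_normal_cdf (x - 1) + integral {x - 1..y} std_normal_density"
    if "y \<in> {x - 1..x + 1}" for y
  proof (cases "y = x - 1")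
    case False
    hence lt: "x - 1 < y" using that by simp
    have int: "set_integrable lborel {x - 1..y} std_normal_density"
      unfolding set_integrable_def by (rule borel_integrable_atLeastAtMost'[unfolded set_integrable_def, OF cont])
    have "std_normal_cdf y - std_normal_cdf (x - 1) = measure std_normal_distribution {x - 1<..y}"
      unfolding std_normal_cdf_def by (rule cdf_diff_eq[OF lt])
    also have "\<dots> = (LINT t|std_normal_distribution. indicator {x - 1<..y} t)" by simp
    also have "\<dots> = (LINT t|lborel. std_normal_density t *\<^sub>R indicator {x - 1<..y} t)"
      by (subst integral_density) auto
    also have "\<dots> = (LINT t:{x - 1<..y}|lborel. std_normal_density t)"
      unfolding set_lebesgue_integral_def by (simp add: mult.commute)
    also have "\<dots> = (LINT t:{x - 1..y}|lborel. std_normal_density t)"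
      unfolding set_lebesgue_integral_def
    proof (rule integral_cong_AE)
      show "AE t in lborel. indicator {x - 1<..y} t *\<^sub>R std_normal_density t
          = indicator {x - 1..y} t *\<^sub>R std_normal_density t"
        using AE_lborel_singleton[of "x - 1"] by eventually_elim (auto simp: indicator_def)
    qed auto
    also have "\<dots> = integral {x - 1..y} std_normal_density"
      by (rule set_borel_integral_eq_integral(2)[OF int])
    finally show ?thesis by simp
  qed simp
  have "((\<lambda>y. integral {x - 1..y} std_normal_density) has_real_derivative std_normal_density x) (at x within {x - 1..x + 1})"
    by (rule integral_has_real_derivative[OF cont]) simp
  hence "((\<lambda>y. std_normal_cdf (x - 1) + integral {x - 1..y} std_normal_density) has_real_derivative 0 + std_normal_density x)
      (at x within {x - 1..x + 1})"
    by (intro DERIV_add DERIV_const)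
  hence "(std_normal_cdf has_real_derivative 0 + std_normal_density x) (at x within {x - 1..x + 1})"
    by (rule has_field_derivative_transform_within[where d = 1]) (auto simp: eq[symmetric])
  moreover have "at x within {x - 1..x + 1} = at x"
    by (rule at_within_interior) simp
  ultimately show ?thesis by simp
qed

lemma std_normal_density_le_1: "std_normal_density x \<le> 1"
proof -
  have "1 \<le> sqrt (2 * pi)" using pi_gt3 by simp
  hence "1 / sqrt (2 * pi) * exp (- x\<^sup>2 / 2) \<le> 1 * 1"
    by (intro mult_mono) auto
  thus ?thesis unfolding std_normal_density_def by simp
qed

lemma std_normal_cdf_lipschitz: "\<bar>std_normal_cdf x - std_normal_cdf y\<bar> \<le> \<bar>x - y\<bar>"
proof -
  have "\<bar>std_normal_density t\<bar> \<le> 1" for t using std_normal_density_le_1[of t] by simp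
  from lipschitz_of_bounded_derivative[OF std_normal_cdf_has_derivative this] show ?thesis by simp
qed

lemma std_normal_cdf_continuous: "continuous_on S std_normal_cdf"
  by (intro continuous_at_imp_continuous_on ballI DERIV_isCont[OF std_normal_cdf_has_derivative])

text \<open>Formulas with \<open>sqrt (A t)\<close> in a denominator degenerate at
  \<open>t = 0\<close>. Approach inside the initial line and approach from positive times are
  therefore treated separately; together they exhaust the closed strip.\<close>

lemma continuous_on_closed_strip:
  fixes f :: "real \<Rightarrow> real \<Rightarrow> real"
  assumes cont: "continuous_on (UNIV \<times> {0<..T}) (\<lambda>(x, t). f x t)"
    and init: "continuous_on UNIV (\<lambda>x. f x 0)"
    and lim: "\<And>x. ((\<lambda>(x, t). f x t) \<longlongrightarrow> f x 0) (at (x, 0) within UNIV \<times> {0<..T})"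
  shows "continuous_on (UNIV \<times> {0..T}) (\<lambda>(x, t). f x t)"
proof (cases "T \<ge> 0")
  case True
  have split: "UNIV \<times> {0..T} = UNIV \<times> {0} \<union> UNIV \<times> {0<..T}" using True by auto
  show ?thesis
  proof (unfold continuous_on_def, intro ballI)
    fix p :: "real \<times> real" assume p: "p \<in> UNIV \<times> {0..T}"
    obtain x t where px: "p = (x, t)" by (cases p)
    show "((\<lambda>(x, t). f x t) \<longlongrightarrow> (case p of (x, t) \<Rightarrow> f x t)) (at p within UNIV \<times> {0..T})"
    proof (cases "t = 0")
      case True
      have "continuous_on (UNIV \<times> {0::real}) ((\<lambda>x. f x 0) \<circ> fst)"
        by (intro continuous_on_compose continuous_on_fst continuous_on_id continuous_on_subset[OF init]) auto
      hence "continuous_on (UNIV \<times> {0::real}) (\<lambda>(x, t). f x t)"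
        by (rule continuous_on_eq) auto
      hence "((\<lambda>(x, t). f x t) \<longlongrightarrow> f x 0) (at (x, 0) within UNIV \<times> {0})"
        unfolding continuous_on_def by force
      thus ?thesis unfolding px True split using lim[of x] by (simp add: Lim_within_Un)
    next
      case False
      hence t: "t \<in> {0<..T}" using p unfolding px by auto
      have "at p within UNIV \<times> {0..T} = at p within UNIV \<times> {0<..T}"
        by (rule at_within_nhd[of _ "UNIV \<times> {0<..}"]) (use t in \<open>auto simp: px intro!: open_Times\<close>)
      moreover have "p \<in> UNIV \<times> {0<..T}" using t px by simp
      ultimately show ?thesis using bspec[OF cont[unfolded continuous_on_def]] by simp
    qed
  qed
qed simp

section \<open>Gaussian kernel and carrier for a time-dependent variance\<close>

locale strike_variance =
  fixes T r a_minus a_plus :: real and \<alpha> :: "real \<Rightarrow> real"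
  assumes T_pos: "0 < T" and a_minus_pos: "0 < a_minus"
    and \<alpha>_cont: "continuous_on {0..T} \<alpha>"
    and \<alpha>_bounds: "\<And>t. t \<in> {0..T} \<Longrightarrow> a_minus \<le> \<alpha> t \<and> \<alpha> t \<le> a_plus"
begin

definition A :: "real \<Rightarrow> real" where
  "A t = integral {0..t} \<alpha>"

definition \<xi> :: "real \<Rightarrow> real \<Rightarrow> real" where
  "\<xi> x t = x + r * t - A t / 2"

text \<open>The discounted centred Gaussian density with variance \<open>A t\<close>, evaluated at
  \<open>\<xi> x t\<close>. It turns out to be \<open>c_xx - c_x\<close>, the gamma of the carrier
  in log coordinates.\<close>

definition q :: "real \<Rightarrow> real \<Rightarrow> real" where
  "q x t = exp (- r * t) / sqrt (2 * pi * A t) * exp (- (\<xi> x t)\<^sup>2 / (2 * A t))"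

definition dp :: "real \<Rightarrow> real \<Rightarrow> real" where
  "dp x t = (\<xi> x t + A t) / sqrt (A t)"

definition dm :: "real \<Rightarrow> real \<Rightarrow> real" where
  "dm x t = \<xi> x t / sqrt (A t)"

definition c :: "real \<Rightarrow> real \<Rightarrow> real" where
  "c x t = (if t = 0 then max (exp x - 1) 0
     else exp x * std_normal_cdf (dp x t) - exp (- r * t) * std_normal_cdf (dm x t))"

lemma a_minus_le_a_plus: "a_minus \<le> a_plus"
  using \<alpha>_bounds[of 0] T_pos by simp

lemma A_0 [simp]: "A 0 = 0"
  unfolding A_def by simp

lemma \<alpha>_integrable: "t \<le> T \<Longrightarrow> \<alpha> integrable_on {0..t}"
  by (rule integrable_continuous_real) (rule continuous_on_subset[OF \<alpha>_cont], auto)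

lemma A_bounds:
  assumes "t \<in> {0..T}"
  shows "a_minus * t \<le> A t" "A t \<le> a_plus * t"
proof -
  have "integral {0..t} (\<lambda>_. a_minus) \<le> integral {0..t} \<alpha>"
    using assms \<alpha>_bounds by (intro integral_le \<alpha>_integrable integrable_const_ivl) auto
  thus "a_minus * t \<le> A t" using assms unfolding A_def by (simp add: mult.commute)
  have "integral {0..t} \<alpha> \<le> integral {0..t} (\<lambda>_. a_plus)"
    using assms \<alpha>_bounds by (intro integral_le \<alpha>_integrable integrable_const_ivl) auto
  thus "A t \<le> a_plus * t" using assms unfolding A_def by (simp add: mult.commute)
qed

lemma A_nonneg: "t \<in> {0..T} \<Longrightarrow> 0 \<le> A t"
  using order_trans[OF _ A_bounds(1), of 0 t] a_minus_pos by simp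

lemma A_pos: "t \<in> {0<..T} \<Longrightarrow> 0 < A t"
  using less_le_trans[OF _ A_bounds(1), of 0 t] a_minus_pos by simp

lemma A_has_derivative:
  "t \<in> {0..T} \<Longrightarrow> (A has_real_derivative \<alpha> t) (at t within {0..T})"
  unfolding A_def by (rule integral_has_real_derivative[OF \<alpha>_cont])

lemma A_cont: "continuous_on {0..T} A"
  by (rule DERIV_continuous_on) (rule A_has_derivative)

lemma A_over_tendsto: "((\<lambda>t. A t / t) \<longlongrightarrow> \<alpha> 0) (at_right 0)"
proof -
  have "((\<lambda>t. (A t - A 0) / (t - 0)) \<longlongrightarrow> \<alpha> 0) (at 0 within {0..T})"
    using A_has_derivative[of 0] T_pos unfolding has_field_derivative_iff by simp
  thus ?thesis using T_pos by (simp add: at_within_Icc_at_right)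
qed

lemma \<xi>_dx: "((\<lambda>x. \<xi> x t) has_real_derivative 1) (at x)"
  unfolding \<xi>_def by (auto intro!: derivative_eq_intros)

lemma \<xi>_dt:
  "t \<in> {0..T} \<Longrightarrow> (\<xi> x has_real_derivative r - \<alpha> t / 2) (at t within {0..T})"
  unfolding \<xi>_def[abs_def] by (auto intro!: derivative_eq_intros A_has_derivative)

lemma q_dx:
  assumes "t \<in> {0<..T}"
  shows "((\<lambda>x. q x t) has_real_derivative - (\<xi> x t / A t) * q x t) (at x)"
proof -
  define k where "k = exp (- r * t) / sqrt (2 * pi * A t)"
  have "((\<lambda>x. - (\<xi> x t)\<^sup>2 / (2 * A t)) has_real_derivative - (2 * \<xi> x t) / (2 * A t)) (at x)"
    by (intro DERIV_cdivide DERIV_minus) (auto intro!: derivative_eq_intros \<xi>_dx)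
  hence "((\<lambda>x. k * exp (- (\<xi> x t)\<^sup>2 / (2 * A t))) has_real_derivative
      k * (exp (- (\<xi> x t)\<^sup>2 / (2 * A t)) * (- (2 * \<xi> x t) / (2 * A t)))) (at x)"
    by (intro DERIV_cmult DERIV_fun_exp)
  thus ?thesis unfolding q_def k_def[symmetric] by (simp add: mult_ac)
qed

text \<open>Logarithmic differentiation: the four terms come from discounting, from the
  normalisation, from the moving centre and from the growing variance.\<close>

lemma q_dt:
  assumes "t \<in> {0<..T}"
  shows "(q x has_real_derivative
    (- r - \<alpha> t / (2 * A t) - \<xi> x t * (r - \<alpha> t / 2) / A t + (\<xi> x t)\<^sup>2 * \<alpha> t / (2 * (A t)\<^sup>2)) * q x t)
    (at t within {0..T})"
proof -
  define s where "s t = 1 / sqrt (2 * pi * A t)" for t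
  define e where "e t = - r * t - (\<xi> x t)\<^sup>2 / (2 * A t)" for t
  have t: "t \<in> {0..T}" using assms by auto
  have q_eq: "q x = (\<lambda>t. s t * exp (e t))"
    unfolding q_def s_def e_def fun_eq_iff by (simp add: exp_add[symmetric])
  have ds: "(s has_real_derivative - \<alpha> t / (2 * A t) * s t) (at t within {0..T})"
  proof -
    define i where "i = inverse (sqrt (2 * pi * A t))"
    have ii: "i * i = 1 / (2 * pi * A t)"
      unfolding i_def using A_pos[OF assms]
      by (simp only: inverse_mult_distrib[symmetric] real_sqrt_mult_self inverse_eq_divide) simp
    have "((\<lambda>t. sqrt (2 * pi * A t)) has_real_derivative i / 2 * (2 * pi * \<alpha> t)) (at t within {0..T})"
      unfolding i_def using A_pos[OF assms]
      by (intro DERIV_chain2[OF DERIV_real_sqrt] DERIV_cmult A_has_derivative[OF t]) simp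
    hence "((\<lambda>t. inverse (sqrt (2 * pi * A t))) has_real_derivative - (i * (i / 2 * (2 * pi * \<alpha> t)) * i))
        (at t within {0..T})"
      unfolding i_def using A_pos[OF assms] by (intro DERIV_inverse') auto
    hence "(s has_real_derivative - (i * (i / 2 * (2 * pi * \<alpha> t)) * i)) (at t within {0..T})"
      unfolding s_def inverse_eq_divide .
    moreover have "- (i * (i / 2 * (2 * pi * \<alpha> t)) * i) = - \<alpha> t / (2 * A t) * s t"
    proof -
      have "- (i * (i / 2 * (2 * pi * \<alpha> t)) * i) = - (pi * \<alpha> t) * (i * i) * i" by simp
      also have "- (pi * \<alpha> t) * (i * i) = - \<alpha> t / (2 * A t)" unfolding ii by simp
      finally show ?thesis unfolding i_def s_def inverse_eq_divide .
    qed
    ultimately show ?thesis by simp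
  qed
  have de: "(e has_real_derivative - r - (2 * \<xi> x t * (r - \<alpha> t / 2) * (2 * A t) - (\<xi> x t)\<^sup>2 * (2 * \<alpha> t)) / (2 * A t)\<^sup>2)
      (at t within {0..T})"
  proof -
    have "((\<lambda>t. (\<xi> x t)\<^sup>2) has_real_derivative 2 * \<xi> x t * (r - \<alpha> t / 2)) (at t within {0..T})"
      using DERIV_power[OF \<xi>_dt[OF t], of x 2] by (simp add: mult_ac)
    moreover have "((\<lambda>t. - r * t) has_real_derivative - r) (at t within {0..T})"
      by (auto intro!: derivative_eq_intros)
    ultimately show ?thesis
      unfolding e_def power2_eq_square[of "2 * A t"] using A_pos[OF assms]
      by (intro DERIV_diff DERIV_divide DERIV_cmult A_has_derivative[OF t]) auto
  qed
  have "(q x has_real_derivative (- \<alpha> t / (2 * A t) * s t) * exp (e t)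
      + (exp (e t) * (- r - (2 * \<xi> x t * (r - \<alpha> t / 2) * (2 * A t) - (\<xi> x t)\<^sup>2 * (2 * \<alpha> t)) / (2 * A t)\<^sup>2)) * s t)
      (at t within {0..T})"
    unfolding q_eq by (intro DERIV_mult ds DERIV_chain2[OF DERIV_exp de])
  thus ?thesis
  proof (rule DERIV_cong)
    have frac: "(2 * \<xi> x t * (r - \<alpha> t / 2) * (2 * A t) - (\<xi> x t)\<^sup>2 * (2 * \<alpha> t)) / (2 * A t)\<^sup>2
        = \<xi> x t * (r - \<alpha> t / 2) / A t - (\<xi> x t)\<^sup>2 * \<alpha> t / (2 * (A t)\<^sup>2)"
      using A_pos[OF assms] by (simp add: field_simps power2_eq_square)
    show "(- \<alpha> t / (2 * A t) * s t) * exp (e t)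
      + (exp (e t) * (- r - (2 * \<xi> x t * (r - \<alpha> t / 2) * (2 * A t) - (\<xi> x t)\<^sup>2 * (2 * \<alpha> t)) / (2 * A t)\<^sup>2)) * s t
      = (- r - \<alpha> t / (2 * A t) - \<xi> x t * (r - \<alpha> t / 2) / A t + (\<xi> x t)\<^sup>2 * \<alpha> t / (2 * (A t)\<^sup>2)) * q x t"
      unfolding q_eq frac by (simp add: algebra_simps)
  qed
qed

lemma q_eq_dm:
  assumes "t \<in> {0<..T}"
  shows "exp (- r * t) * std_normal_density (dm x t) = sqrt (A t) * q x t"
  using A_pos[OF assms]
  by (simp add: std_normal_density_def q_def dm_def power_divide real_sqrt_mult field_simps)

text \<open>Black-Scholes identity: \<open>x - dp^2 / 2 = - r t - dm^2 / 2\<close>, so spot and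
  discounted strike weigh the normal density equally. It is behind the cancellation of density terms
  in the derivatives of \<open>c\<close>.\<close>

lemma q_eq_dp:
  assumes "t \<in> {0<..T}"
  shows "exp x * std_normal_density (dp x t) = sqrt (A t) * q x t"
proof -
  have "x - (dp x t)\<^sup>2 / 2 = - r * t - (dm x t)\<^sup>2 / 2"
    using A_pos[OF assms] unfolding dp_def dm_def \<xi>_def
    by (simp add: power_divide field_simps power2_eq_square)
  hence "exp (x - (dp x t)\<^sup>2 / 2) = exp (- r * t - (dm x t)\<^sup>2 / 2)" by simp
  hence "exp x * exp (- (dp x t)\<^sup>2 / 2) = exp (- r * t) * exp (- (dm x t)\<^sup>2 / 2)"
    unfolding exp_add[symmetric] by simp
  thus ?thesis unfolding q_eq_dm[OF assms, symmetric] std_normal_density_def by simp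
qed

lemma c_dx:
  assumes "t \<in> {0<..T}"
  shows "((\<lambda>x. c x t) has_real_derivative exp x * std_normal_cdf (dp x t)) (at x)"
proof -
  have A: "A t > 0" "t \<noteq> 0" using A_pos[OF assms] assms by auto
  have d: "((\<lambda>x. dp x t) has_real_derivative 1 / sqrt (A t)) (at x)"
    "((\<lambda>x. dm x t) has_real_derivative 1 / sqrt (A t)) (at x)"
    unfolding dp_def dm_def
    using DERIV_cdivide[OF DERIV_add[OF \<xi>_dx[of t x] DERIV_const[of "A t"]], of "sqrt (A t)"]
      DERIV_cdivide[OF \<xi>_dx[of t x], of "sqrt (A t)"] by simp_all
  have D: "((\<lambda>x. c x t) has_real_derivative
      exp x * std_normal_cdf (dp x t) + std_normal_density (dp x t) * (1 / sqrt (A t)) * exp x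
      - exp (- r * t) * (std_normal_density (dm x t) * (1 / sqrt (A t)))) (at x)"
    unfolding c_def if_not_P[OF A(2)]
    by (intro DERIV_diff DERIV_mult DERIV_exp DERIV_cmult DERIV_chain2[OF std_normal_cdf_has_derivative] d)
  have e: "std_normal_density (dp x t) * (1 / sqrt (A t)) * exp x
      = exp (- r * t) * (std_normal_density (dm x t) * (1 / sqrt (A t)))"
    using q_eq_dp[OF assms, of x] q_eq_dm[OF assms, of x] by (simp add: mult_ac)
  show ?thesis using D unfolding e by simp
qed

lemma c_dxx:
  assumes "t \<in> {0<..T}"
  shows "((\<lambda>x. exp x * std_normal_cdf (dp x t)) has_real_derivative
    exp x * std_normal_cdf (dp x t) + q x t) (at x)"
proof -
  have A: "A t > 0" using A_pos[OF assms] assms by auto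
  have d: "((\<lambda>x. dp x t) has_real_derivative 1 / sqrt (A t)) (at x)"
    unfolding dp_def
    using DERIV_cdivide[OF DERIV_add[OF \<xi>_dx[of t x] DERIV_const[of "A t"]], of "sqrt (A t)"] by simp
  have "((\<lambda>x. exp x * std_normal_cdf (dp x t)) has_real_derivative
      exp x * std_normal_cdf (dp x t) + std_normal_density (dp x t) * (1 / sqrt (A t)) * exp x) (at x)"
    by (intro DERIV_mult DERIV_exp DERIV_chain2[OF std_normal_cdf_has_derivative] d)
  moreover have "std_normal_density (dp x t) * (1 / sqrt (A t)) * exp x = q x t"
    using q_eq_dp[OF assms, of x] A by (simp add: field_simps)
  ultimately show ?thesis by simp
qed

text \<open>The derivative \<open>m\<close> of \<open>dm\<close> enters both density terms with
  equal weight and cancels; what survives comes from \<open>dp - dm = sqrt A\<close>. Since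
  \<open>q = c_xx - c_x\<close>, the result is the pricing equation with the variance frozen at the
  strike.\<close>

lemma c_dt:
  assumes "t \<in> {0<..T}"
  shows "(c x has_real_derivative
      \<alpha> t / 2 * q x t + r * (exp x * std_normal_cdf (dp x t) - c x t)) (at t within {0..T})"
proof -
  have t: "t \<in> {0..T}" "t > 0" and A: "A t > 0" using A_pos[OF assms] assms by auto
  define m where "m = ((r - \<alpha> t / 2) * sqrt (A t) - \<xi> x t * (\<alpha> t / (2 * sqrt (A t)))) / (sqrt (A t) * sqrt (A t))"
  have ds: "((\<lambda>t. sqrt (A t)) has_real_derivative \<alpha> t / (2 * sqrt (A t))) (at t within {0..T})"
    using A A_has_derivative[OF t(1)] by (auto intro!: derivative_eq_intros simp: field_simps)
  have dm: "(dm x has_real_derivative m) (at t within {0..T})"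
    unfolding dm_def[abs_def] m_def using A by (intro DERIV_divide \<xi>_dt[OF t(1)] ds) auto
  have "((\<lambda>t. dm x t + sqrt (A t)) has_real_derivative m + \<alpha> t / (2 * sqrt (A t))) (at t within {0..T})"
    by (intro DERIV_add dm ds)
  hence dp: "(dp x has_real_derivative m + \<alpha> t / (2 * sqrt (A t))) (at t within {0..T})"
  proof (rule has_field_derivative_transform_within[OF _ zero_less_one t(1)])
    \<comment> \<open>For \<open>A s = 0\<close> all three terms are 0 by the convention for
      division by 0.\<close>
    show "dm x s + sqrt (A s) = dp x s" if "s \<in> {0..T}" for s
      using A_nonneg[OF that] unfolding dm_def dp_def
      by (cases "A s = 0") (auto simp: field_simps)
  qed
  have de: "((\<lambda>t. exp (- r * t)) has_real_derivative exp (- r * t) * (- r)) (at t within {0..T})"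
    by (auto intro!: derivative_eq_intros)
  have "((\<lambda>t. exp x * std_normal_cdf (dp x t) - exp (- r * t) * std_normal_cdf (dm x t)) has_real_derivative
      exp x * (std_normal_density (dp x t) * (m + \<alpha> t / (2 * sqrt (A t))))
      - (exp (- r * t) * (- r) * std_normal_cdf (dm x t) + std_normal_density (dm x t) * m * exp (- r * t)))
      (at t within {0..T})"
    by (intro DERIV_diff DERIV_mult DERIV_cmult de dp dm DERIV_chain2[OF std_normal_cdf_has_derivative])
  \<comment> \<open>A neighbourhood of radius \<open>t\<close> avoids time 0, where \<open>c\<close>
    is the payoff.\<close>
  hence "(c x has_real_derivative
      exp x * (std_normal_density (dp x t) * (m + \<alpha> t / (2 * sqrt (A t))))
      - (exp (- r * t) * (- r) * std_normal_cdf (dm x t) + std_normal_density (dm x t) * m * exp (- r * t)))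
      (at t within {0..T})"
    by (rule has_field_derivative_transform_within[OF _ t(2,1)]) (auto simp: c_def dist_real_def)
  thus ?thesis
  proof (rule DERIV_cong)
    have e1: "exp x * (std_normal_density (dp x t) * (m + \<alpha> t / (2 * sqrt (A t))))
        = sqrt (A t) * q x t * (m + \<alpha> t / (2 * sqrt (A t)))"
      using q_eq_dp[OF assms, of x] by (simp add: mult.assoc[symmetric])
    have e2: "std_normal_density (dm x t) * m * exp (- r * t) = sqrt (A t) * q x t * m"
      unfolding q_eq_dm[OF assms, symmetric] by (simp only: mult_ac)
    have e3: "sqrt (A t) * q x t * (m + \<alpha> t / (2 * sqrt (A t))) = sqrt (A t) * q x t * m + \<alpha> t / 2 * q x t"
      using A by (simp add: field_simps)
    have c_eq: "c x t = exp x * std_normal_cdf (dp x t) - exp (- r * t) * std_normal_cdf (dm x t)"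
      using t(2) by (simp add: c_def)
    show "exp x * (std_normal_density (dp x t) * (m + \<alpha> t / (2 * sqrt (A t))))
      - (exp (- r * t) * (- r) * std_normal_cdf (dm x t) + std_normal_density (dm x t) * m * exp (- r * t))
      = \<alpha> t / 2 * q x t + r * (exp x * std_normal_cdf (dp x t) - c x t)"
      unfolding e1 e2 e3 c_eq by (simp add: algebra_simps)
  qed
qed

end

section \<open>Orders in parabolic scaling\<close>

text \<open>The polynomial weight is absorbed by the Gaussian \<open>q\<close>, which supplies all decay in \<open>x / sqrt t\<close>.\<close>

definition par_bound :: "real \<Rightarrow> real \<Rightarrow> (real \<Rightarrow> real \<Rightarrow> real) \<Rightarrow> bool" where
  "par_bound T s F \<longleftrightarrow>
     (\<exists>C n. 0 \<le> C \<and> (\<forall>x. \<forall>t\<in>{0<..T}. \<bar>F x t\<bar> \<le> C * t powr s * (1 + x\<^sup>2 / t) ^ n))"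

text \<open>The derivatives are existentially quantified, so that the order of a composite
  expression follows from sums and products without its derivatives being written out.\<close>

definition par_order :: "real \<Rightarrow> real \<Rightarrow> (real \<Rightarrow> real \<Rightarrow> real) \<Rightarrow> bool" where
  "par_order T s F \<longleftrightarrow>
     (\<exists>F1 F2. (\<forall>x. \<forall>t\<in>{0<..T}.
          ((\<lambda>x. F x t) has_real_derivative F1 x t) (at x) \<and>
          ((\<lambda>x. F1 x t) has_real_derivative F2 x t) (at x)) \<and>
        par_bound T s F \<and> par_bound T (s - 1/2) F1 \<and> par_bound T (s - 1) F2)"

lemma par_boundI:
  assumes "0 \<le> C" "\<And>x t. t \<in> {0<..T} \<Longrightarrow> \<bar>F x t\<bar> \<le> C * t powr s * (1 + x\<^sup>2 / t) ^ n"
  shows "par_bound T s F"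
  using assms unfolding par_bound_def by blast

lemma par_boundE:
  assumes "par_bound T s F"
  obtains C n where "0 \<le> C" "\<And>x t. t \<in> {0<..T} \<Longrightarrow> \<bar>F x t\<bar> \<le> C * t powr s * (1 + x\<^sup>2 / t) ^ n"
  using assms unfolding par_bound_def by blast

lemma par_bound_time:
  assumes "\<And>t. t \<in> {0<..T} \<Longrightarrow> \<bar>f t\<bar> \<le> C * t powr s"
  shows "par_bound T s (\<lambda>x. f)"
proof (rule par_boundI[of "\<bar>C\<bar>" _ _ _ 0])
  show "\<bar>f t\<bar> \<le> \<bar>C\<bar> * t powr s * (1 + x\<^sup>2 / t) ^ 0" if "t \<in> {0<..T}" for x t :: real
    using order_trans[OF assms[OF that] mult_right_mono[of C "\<bar>C\<bar>" "t powr s"]] by simp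
qed simp

lemma par_bound_const: "par_bound T 0 (\<lambda>x t. k)"
  by (rule par_bound_time[of _ _ "\<bar>k\<bar>"]) simp

lemma par_bound_zero: "par_bound T s (\<lambda>x t. 0)"
  by (rule par_bound_time[of _ _ 0]) simp

lemma par_bound_space: "par_bound T (1/2) (\<lambda>x t. x)"
proof (rule par_boundI[of 1 _ _ _ 1])
  show "\<bar>x\<bar> \<le> 1 * t powr (1/2) * (1 + x\<^sup>2 / t) ^ 1" if "t \<in> {0<..T}" for x t :: real
  proof -
    have t: "t > 0" using that by simp
    define y where "y = \<bar>x\<bar> / sqrt t"
    have x: "\<bar>x\<bar> = sqrt t * y" unfolding y_def using t by simp
    have y2: "y\<^sup>2 = x\<^sup>2 / t" unfolding y_def using t by (simp add: power_divide)
    have "y \<le> 1 + y\<^sup>2" using sum_squares_bound[of 1 y] zero_le_power2[of y] by (simp only: power_one mult_1_right)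
    hence "sqrt t * y \<le> sqrt t * (1 + y\<^sup>2)" using t by (intro mult_left_mono) auto
    thus ?thesis unfolding x y2 using t by (simp add: powr_half_sqrt)
  qed
qed simp

text \<open>On a bounded time interval a surplus power of \<open>t\<close> is absorbed into the
  constant, as \<open>T powr (s - s')\<close>.\<close>

lemma par_bound_weaken:
  assumes "par_bound T s F" "s' \<le> s"
  shows "par_bound T s' F"
proof -
  from assms(1) obtain C n where C: "0 \<le> C"
    and b: "\<And>x t. t \<in> {0<..T} \<Longrightarrow> \<bar>F x t\<bar> \<le> C * t powr s * (1 + x\<^sup>2 / t) ^ n"
    by (rule par_boundE) blast
  show ?thesis
  proof (rule par_boundI[of "C * T powr (s - s')"])
    show "0 \<le> C * T powr (s - s')" using C by simp
    fix x t :: real assume t: "t \<in> {0<..T}"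
    have "t powr s = t powr (s - s') * t powr s'" using t by (simp flip: powr_add)
    also have "\<dots> \<le> T powr (s - s') * t powr s'"
      using t assms(2) by (intro mult_right_mono powr_mono2) auto
    finally have "C * t powr s * (1 + x\<^sup>2 / t) ^ n \<le> C * (T powr (s - s') * t powr s') * (1 + x\<^sup>2 / t) ^ n"
      using C t by (intro mult_right_mono mult_left_mono) auto
    thus "\<bar>F x t\<bar> \<le> C * T powr (s - s') * t powr s' * (1 + x\<^sup>2 / t) ^ n"
      using b[OF t, of x] by (simp only: mult.assoc)
  qed
qed

lemma par_bound_mult:
  assumes "par_bound T s F" "par_bound T p G"
  shows "par_bound T (s + p) (\<lambda>x t. F x t * G x t)"
proof -
  from assms(1) obtain C n where C: "0 \<le> C"
    and F: "\<And>x t. t \<in> {0<..T} \<Longrightarrow> \<bar>F x t\<bar> \<le> C * t powr s * (1 + x\<^sup>2 / t) ^ n"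
    by (rule par_boundE) blast
  from assms(2) obtain D m where D: "0 \<le> D"
    and G: "\<And>x t. t \<in> {0<..T} \<Longrightarrow> \<bar>G x t\<bar> \<le> D * t powr p * (1 + x\<^sup>2 / t) ^ m"
    by (rule par_boundE) blast
  show ?thesis
  proof (rule par_boundI[of "C * D" _ _ _ "n + m"])
    fix x t :: real assume t: "t \<in> {0<..T}"
    have "\<bar>F x t * G x t\<bar> \<le> (C * t powr s * (1 + x\<^sup>2 / t) ^ n) * (D * t powr p * (1 + x\<^sup>2 / t) ^ m)"
      unfolding abs_mult using F[OF t, of x] G[OF t, of x] by (intro mult_mono) auto
    thus "\<bar>F x t * G x t\<bar> \<le> C * D * t powr (s + p) * (1 + x\<^sup>2 / t) ^ (n + m)"
      by (simp add: powr_add power_add mult_ac)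
  qed (use C D in simp)
qed

lemma par_bound_add:
  assumes "par_bound T s F" "par_bound T s G"
  shows "par_bound T s (\<lambda>x t. F x t + G x t)"
proof -
  from assms(1) obtain C n where C: "0 \<le> C"
    and F: "\<And>x t. t \<in> {0<..T} \<Longrightarrow> \<bar>F x t\<bar> \<le> C * t powr s * (1 + x\<^sup>2 / t) ^ n"
    by (rule par_boundE) blast
  from assms(2) obtain D m where D: "0 \<le> D"
    and G: "\<And>x t. t \<in> {0<..T} \<Longrightarrow> \<bar>G x t\<bar> \<le> D * t powr s * (1 + x\<^sup>2 / t) ^ m"
    by (rule par_boundE) blast
  show ?thesis
  proof (rule par_boundI[of "C + D" _ _ _ "n + m"])
    fix x t :: real assume t: "t \<in> {0<..T}"
    hence w: "1 \<le> 1 + x\<^sup>2 / t" by simp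
    have "C * t powr s * (1 + x\<^sup>2 / t) ^ n \<le> C * t powr s * (1 + x\<^sup>2 / t) ^ (n + m)"
      using C by (intro mult_left_mono power_increasing w) auto
    moreover have "D * t powr s * (1 + x\<^sup>2 / t) ^ m \<le> D * t powr s * (1 + x\<^sup>2 / t) ^ (n + m)"
      using D by (intro mult_left_mono power_increasing w) auto
    ultimately have "\<bar>F x t + G x t\<bar> \<le> C * t powr s * (1 + x\<^sup>2 / t) ^ (n + m) + D * t powr s * (1 + x\<^sup>2 / t) ^ (n + m)"
      using F[OF t, of x] G[OF t, of x] abs_triangle_ineq[of "F x t" "G x t"] by linarith
    thus "\<bar>F x t + G x t\<bar> \<le> (C + D) * t powr s * (1 + x\<^sup>2 / t) ^ (n + m)"
      by (simp only: distrib_right)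
  qed (use C D in simp)
qed

lemma par_bound_cmult:
  "par_bound T s F \<Longrightarrow> par_bound T s (\<lambda>x t. k * F x t)"
  using par_bound_mult[OF par_bound_const[of T k], of s F] by simp

lemma par_bound_diff:
  assumes "par_bound T s F" "par_bound T s G"
  shows "par_bound T s (\<lambda>x t. F x t - G x t)"
  using par_bound_add[OF assms(1) par_bound_cmult[OF assms(2), of "-1"]] by simp

lemma par_bound_mono:
  assumes "par_bound T s G" "\<And>x t. t \<in> {0<..T} \<Longrightarrow> \<bar>F x t\<bar> \<le> \<bar>G x t\<bar>"
  shows "par_bound T s F"
  using assms unfolding par_bound_def by (meson order_trans)

lemma par_bound_abs: "par_bound T s F \<Longrightarrow> par_bound T s (\<lambda>x t. \<bar>F x t\<bar>)"
  unfolding par_bound_def by simp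

lemma par_orderI:
  assumes "\<And>x t. t \<in> {0<..T} \<Longrightarrow> ((\<lambda>x. F x t) has_real_derivative F1 x t) (at x)"
    and "\<And>x t. t \<in> {0<..T} \<Longrightarrow> ((\<lambda>x. F1 x t) has_real_derivative F2 x t) (at x)"
    and "par_bound T s F" "par_bound T (s - 1/2) F1" "par_bound T (s - 1) F2"
  shows "par_order T s F"
  using assms unfolding par_order_def by blast

lemma par_orderE:
  assumes "par_order T s F"
  obtains F1 F2 where "\<And>x t. t \<in> {0<..T} \<Longrightarrow> ((\<lambda>x. F x t) has_real_derivative F1 x t) (at x)"
    and "\<And>x t. t \<in> {0<..T} \<Longrightarrow> ((\<lambda>x. F1 x t) has_real_derivative F2 x t) (at x)"
    and "par_bound T s F" "par_bound T (s - 1/2) F1" "par_bound T (s - 1) F2"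
  using assms unfolding par_order_def by blast

lemma par_order_weaken:
  assumes "par_order T s F" "s' \<le> s"
  shows "par_order T s' F"
  using assms(1)
  by (rule par_orderE, intro par_orderI) (assumption | erule par_bound_weaken, use assms(2) in simp)+

lemma par_order_time:
  assumes "\<And>t. t \<in> {0<..T} \<Longrightarrow> \<bar>f t\<bar> \<le> C * t powr s"
  shows "par_order T s (\<lambda>x. f)"
  by (rule par_orderI[of _ _ "\<lambda>x t. 0" "\<lambda>x t. 0"]) (auto intro!: par_bound_zero par_bound_time assms)

lemma par_order_const: "par_order T 0 (\<lambda>x t. k)"
  by (rule par_order_time[of _ _ "\<bar>k\<bar>"]) simp

lemma par_order_space: "par_order T (1/2) (\<lambda>x t. x)"
  by (rule par_orderI[of _ _ "\<lambda>x t. 1" "\<lambda>x t. 0"])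
     (use par_bound_space par_bound_const in \<open>auto intro: par_bound_zero\<close>)

lemma par_order_add:
  assumes "par_order T s F" "par_order T s G"
  shows "par_order T s (\<lambda>x t. F x t + G x t)"
proof -
  from assms(1) obtain F1 F2 where F:
    "\<And>x t. t \<in> {0<..T} \<Longrightarrow> ((\<lambda>x. F x t) has_real_derivative F1 x t) (at x)"
    "\<And>x t. t \<in> {0<..T} \<Longrightarrow> ((\<lambda>x. F1 x t) has_real_derivative F2 x t) (at x)"
    "par_bound T s F" "par_bound T (s - 1/2) F1" "par_bound T (s - 1) F2" by (rule par_orderE) blast
  from assms(2) obtain G1 G2 where G:
    "\<And>x t. t \<in> {0<..T} \<Longrightarrow> ((\<lambda>x. G x t) has_real_derivative G1 x t) (at x)"
    "\<And>x t. t \<in> {0<..T} \<Longrightarrow> ((\<lambda>x. G1 x t) has_real_derivative G2 x t) (at x)"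
    "par_bound T s G" "par_bound T (s - 1/2) G1" "par_bound T (s - 1) G2" by (rule par_orderE) blast
  show ?thesis
    by (rule par_orderI[of _ _ "\<lambda>x t. F1 x t + G1 x t" "\<lambda>x t. F2 x t + G2 x t"])
       (intro DERIV_add par_bound_add F G; assumption)+
qed

lemma par_order_mult:
  assumes "par_order T s F" "par_order T p G"
  shows "par_order T (s + p) (\<lambda>x t. F x t * G x t)"
proof -
  from assms(1) obtain F1 F2 where F:
    "\<And>x t. t \<in> {0<..T} \<Longrightarrow> ((\<lambda>x. F x t) has_real_derivative F1 x t) (at x)"
    "\<And>x t. t \<in> {0<..T} \<Longrightarrow> ((\<lambda>x. F1 x t) has_real_derivative F2 x t) (at x)"
    "par_bound T s F" "par_bound T (s - 1/2) F1" "par_bound T (s - 1) F2" by (rule par_orderE) blast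
  from assms(2) obtain G1 G2 where G:
    "\<And>x t. t \<in> {0<..T} \<Longrightarrow> ((\<lambda>x. G x t) has_real_derivative G1 x t) (at x)"
    "\<And>x t. t \<in> {0<..T} \<Longrightarrow> ((\<lambda>x. G1 x t) has_real_derivative G2 x t) (at x)"
    "par_bound T p G" "par_bound T (p - 1/2) G1" "par_bound T (p - 1) G2" by (rule par_orderE) blast
  show ?thesis
  proof (rule par_orderI[of _ _ "\<lambda>x t. F1 x t * G x t + G1 x t * F x t"
        "\<lambda>x t. (F2 x t * G x t + G1 x t * F1 x t) + (G2 x t * F x t + F1 x t * G1 x t)"])
    show "par_bound T (s + p) (\<lambda>x t. F x t * G x t)" by (rule par_bound_mult[OF F(3) G(3)])
    have 1: "par_bound T (s + p - 1/2) (\<lambda>x t. F1 x t * G x t)" "par_bound T (s + p - 1/2) (\<lambda>x t. G1 x t * F x t)"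
      using par_bound_mult[OF F(4) G(3)] par_bound_mult[OF G(4) F(3)] by (simp_all add: algebra_simps)
    show "par_bound T (s + p - 1/2) (\<lambda>x t. F1 x t * G x t + G1 x t * F x t)"
      by (rule par_bound_add[OF 1])
    have 2: "par_bound T (s + p - 1) (\<lambda>x t. F2 x t * G x t)" "par_bound T (s + p - 1) (\<lambda>x t. G1 x t * F1 x t)"
      "par_bound T (s + p - 1) (\<lambda>x t. G2 x t * F x t)" "par_bound T (s + p - 1) (\<lambda>x t. F1 x t * G1 x t)"
      using par_bound_mult[OF F(5) G(3)] par_bound_mult[OF G(4) F(4)] par_bound_mult[OF G(5) F(3)]
        par_bound_mult[OF F(4) G(4)] by (simp_all add: algebra_simps)
    show "par_bound T (s + p - 1) (\<lambda>x t. (F2 x t * G x t + G1 x t * F1 x t) + (G2 x t * F x t + F1 x t * G1 x t))"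
      by (intro par_bound_add 2)
  qed (intro DERIV_add DERIV_mult F G; assumption)+
qed

lemma par_order_cmult: "par_order T s F \<Longrightarrow> par_order T s (\<lambda>x t. k * F x t)"
  using par_order_mult[OF par_order_const[of T k], of s F] by simp

lemma par_order_diff:
  assumes "par_order T s F" "par_order T s G"
  shows "par_order T s (\<lambda>x t. F x t - G x t)"
  using par_order_add[OF assms(1) par_order_cmult[OF assms(2), of "-1"]] by simp

section \<open>Absorption of polynomial weights by the Gaussian\<close>

lemma power_times_exp_bound:
  fixes \<kappa> :: real
  assumes "\<kappa> > 0"
  obtains C where "0 \<le> C" "\<And>y. 0 \<le> y \<Longrightarrow> (1 + y) ^ n * exp (- \<kappa> * y) \<le> C"
proof -
  \<comment> \<open>The product of \<open>n\<close> factors \<open>exp (\<delta> y)\<close> has to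
    stay below \<open>exp (\<kappa> y)\<close>; dividing by \<open>n + 1\<close> also covers
    \<open>n = 0\<close>.\<close>
  define \<delta> where "\<delta> = \<kappa> / (real n + 1)"
  have \<delta>: "\<delta> > 0" using assms unfolding \<delta>_def by simp
  define M where "M = max 1 (1 / \<delta>)"
  have M: "M \<ge> 1" "M * \<delta> \<ge> 1" using \<delta> unfolding M_def by (auto simp: max_def field_simps)
  have "(1 + y) ^ n * exp (- \<kappa> * y) \<le> M ^ n" if y: "0 \<le> y" for y
  proof -
    have "1 + y \<le> M * 1 + (M * \<delta>) * y" using M y by (intro add_mono mult_right_mono[of 1 "M * \<delta>" y, simplified]) auto
    also have "\<dots> = M * (1 + \<delta> * y)" by (simp add: algebra_simps)
    also have "\<dots> \<le> M * exp (\<delta> * y)" using M by (intro mult_left_mono exp_ge_add_one_self) auto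
    finally have "(1 + y) ^ n \<le> (M * exp (\<delta> * y)) ^ n" using y by (intro power_mono) auto
    also have "\<dots> = M ^ n * exp (real n * (\<delta> * y))" by (simp add: power_mult_distrib exp_of_nat_mult)
    also have "\<dots> \<le> M ^ n * exp (\<kappa> * y)"
    proof (intro mult_left_mono)
      have "real n * \<delta> \<le> \<kappa>" using assms unfolding \<delta>_def by (simp add: field_simps)
      thus "exp (real n * (\<delta> * y)) \<le> exp (\<kappa> * y)" using y by (simp add: mult.assoc[symmetric] mult_right_mono)
    qed (use M in auto)
    finally have "(1 + y) ^ n * exp (- \<kappa> * y) \<le> M ^ n * exp (\<kappa> * y) * exp (- \<kappa> * y)" by (rule mult_right_mono) simp
    thus ?thesis by (simp add: mult.assoc flip: exp_add)
  qed
  thus thesis using that[of "M ^ n"] M by auto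
qed

context strike_variance
begin

lemma a_plus_pos: "0 < a_plus"
  using a_minus_pos a_minus_le_a_plus by simp

lemma par_order_A: "par_order T 1 (\<lambda>x. A)"
  by (rule par_order_time[of _ _ a_plus]) (use A_bounds A_nonneg in \<open>auto simp: abs_of_nonneg\<close>)

lemma par_order_inverse_A: "par_order T (-1) (\<lambda>x t. inverse (A t))"
proof (rule par_order_time)
  fix t assume t: "t \<in> {0<..T}"
  have "inverse (A t) \<le> inverse (a_minus * t)"
    using A_bounds(1)[of t] t a_minus_pos by (intro le_imp_inverse_le) auto
  thus "\<bar>inverse (A t)\<bar> \<le> inverse a_minus * t powr (-1)"
    using A_pos[OF t] t by (simp add: powr_minus_divide divide_inverse)
qed

lemma par_order_drift: "par_order T 1 (\<lambda>x t. r * t - A t / 2)"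
proof -
  have "par_order T 1 (\<lambda>x t. r * t)" by (rule par_order_time[of _ _ "\<bar>r\<bar>"]) (auto simp: abs_mult)
  from par_order_diff[OF this par_order_cmult[OF par_order_A, of "1/2"]] show ?thesis by simp
qed

lemma par_order_\<xi>: "par_order T (1/2) \<xi>"
proof -
  have "par_order T (1/2) (\<lambda>x t. x + (r * t - A t / 2))"
    by (intro par_order_add par_order_space par_order_weaken[OF par_order_drift]) simp
  thus ?thesis unfolding \<xi>_def[abs_def] by (simp add: add_diff_eq)
qed

text \<open>\<open>\<xi>\<close> differs from \<open>x\<close> by at most \<open>D t\<close>, so
  \<open>\<xi>^2 \<ge> x^2 / 2 - (D t)^2\<close>. Halving the square turns the variance bound
  \<open>a_plus t\<close> into the rate \<open>1 / (4 a_plus)\<close>, and the drift leaves only a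
  bounded factor.\<close>

lemma gaussian_decay:
  "\<exists>C\<ge>0. \<forall>x. \<forall>t\<in>{0<..T}. \<bar>q x t\<bar> \<le> C * t powr (-1/2) * exp (- (1 / (4 * a_plus)) * (x\<^sup>2 / t))"
proof -
  define D where "D = \<bar>r\<bar> + a_plus / 2"
  define C where "C = exp (\<bar>r\<bar> * T) / sqrt (2 * pi * a_minus) * exp (D\<^sup>2 * T / (2 * a_plus))"
  have "\<bar>q x t\<bar> \<le> C * t powr (-1/2) * exp (- (1 / (4 * a_plus)) * (x\<^sup>2 / t))" if t: "t \<in> {0<..T}" for x t
  proof -
    have t': "t > 0" "t \<le> T" "t \<in> {0..T}" using t by auto
    note A = A_bounds[OF t'(3)] A_pos[OF t]
    have drift: "\<bar>\<xi> x t - x\<bar> \<le> D * t"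
    proof -
      have "\<bar>\<xi> x t - x\<bar> \<le> \<bar>r * t\<bar> + \<bar>A t / 2\<bar>" unfolding \<xi>_def by linarith
      also have "\<dots> \<le> \<bar>r\<bar> * t + a_plus * t / 2" using A t' by (simp add: abs_mult)
      finally show ?thesis unfolding D_def by (simp add: algebra_simps)
    qed
    have "x\<^sup>2 / 2 \<le> (\<xi> x t)\<^sup>2 + (\<xi> x t - x)\<^sup>2"
      using zero_le_power2[of "2 * \<xi> x t - x"] by (simp add: power2_eq_square algebra_simps)
    moreover have "(\<xi> x t - x)\<^sup>2 \<le> (D * t)\<^sup>2"
      using drift by (metis abs_ge_zero power2_abs power_mono)
    ultimately have "x\<^sup>2 / 2 - (D * t)\<^sup>2 \<le> (\<xi> x t)\<^sup>2" by linarith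
    hence "(x\<^sup>2 / 2 - (D * t)\<^sup>2) / (2 * (a_plus * t)) \<le> (\<xi> x t)\<^sup>2 / (2 * (a_plus * t))"
      using t' a_plus_pos by (intro divide_right_mono) auto
    also have "\<dots> \<le> (\<xi> x t)\<^sup>2 / (2 * A t)"
      using A by (intro divide_left_mono) (auto intro!: mult_pos_pos a_plus_pos t')
    finally have le: "(x\<^sup>2 / 2 - (D * t)\<^sup>2) / (2 * (a_plus * t)) \<le> (\<xi> x t)\<^sup>2 / (2 * A t)" .
    hence "- (\<xi> x t)\<^sup>2 / (2 * A t) \<le> D\<^sup>2 * t / (2 * a_plus) + (- (1 / (4 * a_plus)) * (x\<^sup>2 / t))"
    proof -
      have "(x\<^sup>2 / 2 - (D * t)\<^sup>2) / (2 * (a_plus * t)) = 1 / (4 * a_plus) * (x\<^sup>2 / t) - D\<^sup>2 * t / (2 * a_plus)"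
      proof -
        have "(x\<^sup>2 / 2) / (2 * (a_plus * t)) = 1 / (4 * a_plus) * (x\<^sup>2 / t)" by simp
        moreover have "(D * t)\<^sup>2 / (2 * (a_plus * t)) = D\<^sup>2 * t / (2 * a_plus)"
          using t' by (simp add: power2_eq_square)
        ultimately show ?thesis by (simp only: diff_divide_distrib)
      qed
      moreover have "- (\<xi> x t)\<^sup>2 / (2 * A t) = - ((\<xi> x t)\<^sup>2 / (2 * A t))" by simp
      ultimately show ?thesis using le by linarith
    qed
    also have "D\<^sup>2 * t / (2 * a_plus) \<le> D\<^sup>2 * T / (2 * a_plus)"
      using t' a_plus_pos by (intro divide_right_mono mult_left_mono) auto
    finally have e: "exp (- (\<xi> x t)\<^sup>2 / (2 * A t))
        \<le> exp (D\<^sup>2 * T / (2 * a_plus)) * exp (- (1 / (4 * a_plus)) * (x\<^sup>2 / t))"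
      by (simp flip: exp_add)
    have "sqrt (2 * pi * a_minus) * t powr (1/2) = sqrt (2 * pi * (a_minus * t))"
      using t' by (simp add: powr_half_sqrt real_sqrt_mult)
    also have "\<dots> \<le> sqrt (2 * pi * A t)" using A by simp
    finally have s: "sqrt (2 * pi * a_minus) * t powr (1/2) \<le> sqrt (2 * pi * A t)" .
    have rt: "exp (- r * t) \<le> exp (\<bar>r\<bar> * T)"
      using t' mult_mono[of "- r" "\<bar>r\<bar>" t T] by auto
    have "exp (- r * t) / sqrt (2 * pi * A t) \<le> exp (\<bar>r\<bar> * T) / (sqrt (2 * pi * a_minus) * t powr (1/2))"
      using s rt t' a_minus_pos by (intro frac_le) auto
    hence "exp (- r * t) / sqrt (2 * pi * A t) * exp (- (\<xi> x t)\<^sup>2 / (2 * A t))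
        \<le> exp (\<bar>r\<bar> * T) / (sqrt (2 * pi * a_minus) * t powr (1/2))
          * (exp (D\<^sup>2 * T / (2 * a_plus)) * exp (- (1 / (4 * a_plus)) * (x\<^sup>2 / t)))"
      using e A a_minus_pos by (intro mult_mono) auto
    moreover have "0 \<le> q x t" unfolding q_def using A by simp
    moreover have "t powr (-1/2) = inverse (t powr (1/2))" by (simp flip: powr_minus)
    ultimately show ?thesis unfolding C_def by (simp only: abs_of_nonneg q_def divide_inverse inverse_mult_distrib mult_ac)
  qed
  moreover have "C \<ge> 0" unfolding C_def using a_minus_pos by simp
  ultimately show ?thesis by blast
qed

lemma q_times_par_bound:
  assumes "par_bound T s F"
  shows "\<exists>C\<ge>0. \<forall>x. \<forall>t\<in>{0<..T}. \<bar>q x t * F x t\<bar> \<le> C * t powr (s - 1/2)"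
proof -
  obtain K where K: "K \<ge> 0" "\<And>x t. t \<in> {0<..T} \<Longrightarrow> \<bar>q x t\<bar> \<le> K * t powr (-1/2) * exp (- (1 / (4 * a_plus)) * (x\<^sup>2 / t))"
    using gaussian_decay by blast
  from assms obtain C n where C: "0 \<le> C"
    and F: "\<And>x t. t \<in> {0<..T} \<Longrightarrow> \<bar>F x t\<bar> \<le> C * t powr s * (1 + x\<^sup>2 / t) ^ n"
    by (rule par_boundE) blast
  obtain M where M: "0 \<le> M" "\<And>y. 0 \<le> y \<Longrightarrow> (1 + y) ^ n * exp (- (1 / (4 * a_plus)) * y) \<le> M"
    using power_times_exp_bound[of "1 / (4 * a_plus)" n] a_plus_pos by auto
  have "\<bar>q x t * F x t\<bar> \<le> (K * C * M) * t powr (s - 1/2)" if t: "t \<in> {0<..T}" for x t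
  proof -
    have "\<bar>q x t * F x t\<bar> \<le> (K * t powr (-1/2) * exp (- (1 / (4 * a_plus)) * (x\<^sup>2 / t))) * (C * t powr s * (1 + x\<^sup>2 / t) ^ n)"
      unfolding abs_mult using K C F[OF t, of x] t by (intro mult_mono) auto
    also have "\<dots> = (K * C * (t powr s * t powr (-1/2))) * ((1 + x\<^sup>2 / t) ^ n * exp (- (1 / (4 * a_plus)) * (x\<^sup>2 / t)))"
      by (simp only: mult_ac)
    also have "\<dots> \<le> (K * C * (t powr s * t powr (-1/2))) * M"
      using K C t by (intro mult_left_mono M) auto
    also have "t powr s * t powr (-1/2) = t powr (s - 1/2)" by (simp flip: powr_add)
    finally show ?thesis by (simp add: mult_ac)
  qed
  moreover have "K * C * M \<ge> 0" using K C M by simp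
  ultimately show ?thesis by blast
qed

text \<open>\<open>q_x = k q\<close> with \<open>k = - \<xi> / A\<close> of order
  \<open>-1/2\<close>, so differentiating \<open>q G\<close> amounts to replacing \<open>G\<close>
  by \<open>G_x + k G\<close>, half an order lower. The further loss of \<open>1/2\<close> in every
  bound is the normalisation of \<open>q\<close>.\<close>

lemma q_times_par_order:
  assumes "par_order T s G"
  shows "\<exists>R1 R2 C. 0 \<le> C \<and> (\<forall>x. \<forall>t\<in>{0<..T}.
     ((\<lambda>x. q x t * G x t) has_real_derivative R1 x t) (at x) \<and>
     ((\<lambda>x. R1 x t) has_real_derivative R2 x t) (at x) \<and>
     \<bar>q x t * G x t\<bar> \<le> C * t powr (s - 1/2) \<and> \<bar>R1 x t\<bar> \<le> C * t powr (s - 1) \<and> \<bar>R2 x t\<bar> \<le> C * t powr (s - 3/2))"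
proof -
  from assms obtain G1 G2 where G:
    "\<And>x t. t \<in> {0<..T} \<Longrightarrow> ((\<lambda>x. G x t) has_real_derivative G1 x t) (at x)"
    "\<And>x t. t \<in> {0<..T} \<Longrightarrow> ((\<lambda>x. G1 x t) has_real_derivative G2 x t) (at x)"
    "par_bound T s G" "par_bound T (s - 1/2) G1" "par_bound T (s - 1) G2" by (rule par_orderE) blast
  define k where "k x t = - (\<xi> x t * inverse (A t))" for x t
  have k: "par_bound T (-1/2) k"
  proof -
    have "par_order T (1/2 + -1) (\<lambda>x t. \<xi> x t * inverse (A t))"
      by (rule par_order_mult[OF par_order_\<xi> par_order_inverse_A])
    hence "par_bound T (-1/2) (\<lambda>x t. \<xi> x t * inverse (A t))" by (rule par_orderE) simp
    from par_bound_cmult[OF this, of "-1"] show ?thesis unfolding k_def[abs_def] by simp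
  qed
  have iA: "par_bound T (-1) (\<lambda>x t. inverse (A t))" using par_order_inverse_A by (rule par_orderE)
  define H1 H2 where "H1 x t = G1 x t + k x t * G x t"
    and "H2 x t = (G2 x t + (k x t * G1 x t - inverse (A t) * G x t)) + k x t * H1 x t" for x t
  have H1: "par_bound T (s - 1/2) H1"
    unfolding H1_def[abs_def] using G(4) par_bound_mult[OF k G(3)] by (intro par_bound_add) simp_all
  have H2: "par_bound T (s - 1) H2"
    unfolding H2_def[abs_def]
    using G(5) par_bound_mult[OF k G(4)] par_bound_mult[OF iA G(3)] par_bound_mult[OF k H1]
    by (intro par_bound_add par_bound_diff) simp_all
  have dk: "((\<lambda>x. k x t) has_real_derivative - inverse (A t)) (at x)" for x t
    unfolding k_def using DERIV_minus[OF DERIV_cmult_right[OF \<xi>_dx[of t x], of "inverse (A t)"]] by simp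
  have dq: "((\<lambda>x. q x t) has_real_derivative k x t * q x t) (at x)" if "t \<in> {0<..T}" for x t
    using q_dx[OF that, of x] unfolding k_def divide_inverse by simp
  have d0: "((\<lambda>x. q x t * G x t) has_real_derivative q x t * H1 x t) (at x)" if "t \<in> {0<..T}" for x t
    by (rule DERIV_cong[OF DERIV_mult[OF dq[OF that] G(1)[OF that]]]) (simp add: H1_def algebra_simps)
  have d1: "((\<lambda>x. q x t * H1 x t) has_real_derivative q x t * H2 x t) (at x)" if "t \<in> {0<..T}" for x t
  proof -
    have "((\<lambda>x. H1 x t) has_real_derivative G2 x t + (- inverse (A t) * G x t + G1 x t * k x t)) (at x)"
      unfolding H1_def by (intro DERIV_add DERIV_mult dk G that)
    from DERIV_mult[OF dq[OF that] this] show ?thesis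
      by (rule DERIV_cong) (simp add: H2_def algebra_simps)
  qed
  obtain C0 C1 C2 where C: "C0 \<ge> 0" "C1 \<ge> 0" "C2 \<ge> 0"
    "\<And>x t. t \<in> {0<..T} \<Longrightarrow> \<bar>q x t * G x t\<bar> \<le> C0 * t powr (s - 1/2)"
    "\<And>x t. t \<in> {0<..T} \<Longrightarrow> \<bar>q x t * H1 x t\<bar> \<le> C1 * t powr (s - 1)"
    "\<And>x t. t \<in> {0<..T} \<Longrightarrow> \<bar>q x t * H2 x t\<bar> \<le> C2 * t powr (s - 3/2)"
    using q_times_par_bound[OF G(3)] q_times_par_bound[OF H1] q_times_par_bound[OF H2]
    by (auto simp: diff_diff_eq)
  define C where "C = C0 + C1 + C2"
  have "\<bar>q x t * G x t\<bar> \<le> C * t powr (s - 1/2) \<and> \<bar>q x t * H1 x t\<bar> \<le> C * t powr (s - 1) \<and> \<bar>q x t * H2 x t\<bar> \<le> C * t powr (s - 3/2)"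
    if "t \<in> {0<..T}" for x t
    using order_trans[OF C(4)[OF that] mult_right_mono[of C0 C]] order_trans[OF C(5)[OF that] mult_right_mono[of C1 C]]
      order_trans[OF C(6)[OF that] mult_right_mono[of C2 C]] C(1-3) unfolding C_def by simp
  moreover have "C \<ge> 0" using C(1-3) unfolding C_def by simp
  ultimately show ?thesis using d0 d1 by (intro exI[of _ "\<lambda>x t. q x t * H1 x t"] exI[of _ "\<lambda>x t. q x t * H2 x t"] exI[of _ C]) auto
qed

end

section \<open>The leading term of the correction\<close>

text \<open>Explicit derivatives are supplied once, both for membership and for evaluating
  \<open>log_operator\<close>, which is defined through opaque derivative operators.\<close>

lemma growth_classI:
  fixes u ut ux uxx :: "real \<Rightarrow> real \<Rightarrow> real"
  assumes T: "0 < T"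
    and cont: "continuous_on (UNIV \<times> {0..T}) (\<lambda>(x, t). u x t)"
    and dt: "\<And>x t. t \<in> {0<..T} \<Longrightarrow> (u x has_real_derivative ut x t) (at t within {0..T})"
    and dx: "\<And>x t. t \<in> {0<..T} \<Longrightarrow> ((\<lambda>x. u x t) has_real_derivative ux x t) (at x)"
    and dxx: "\<And>x t. t \<in> {0<..T} \<Longrightarrow> ((\<lambda>x. ux x t) has_real_derivative uxx x t) (at x)"
    and cont': "continuous_on (UNIV \<times> {0<..T}) (\<lambda>(x, t). ut x t)"
      "continuous_on (UNIV \<times> {0<..T}) (\<lambda>(x, t). ux x t)"
      "continuous_on (UNIV \<times> {0<..T}) (\<lambda>(x, t). uxx x t)"
    and bound: "\<And>x t. t \<in> {0..T} \<Longrightarrow> \<bar>u x t\<bar> \<le> M * exp (m * \<bar>x\<bar>)"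
  shows "growth_class T u"
    and "\<And>x t. t \<in> {0<..T} \<Longrightarrow> log_operator T r abar u x t
           = ut x t - 1/2 * abar x t * uxx x t - (r - 1/2 * abar x t) * ux x t + r * u x t"
proof -
  have ux: "d_space u x t = ux x t" if "t \<in> {0<..T}" for x t
    unfolding d_space_def by (rule DERIV_imp_deriv[OF dx[OF that]])
  have uxx: "d_space (d_space u) x t = uxx x t" if "t \<in> {0<..T}" for x t
    unfolding d_space_def[of "d_space u"] by (simp add: ux[OF that] DERIV_imp_deriv[OF dxx[OF that]])
  \<comment> \<open>\<open>0 < T\<close> makes the derivative within the interval unique, at
    \<open>t = T\<close> as well.\<close>
  have ut: "d_time T u x t = ut x t" if "t \<in> {0<..T}" for x t
    unfolding d_time_def
    using vector_derivative_within_cbox[of 0 T t "u x" "ut x t"] T that dt[OF that, of x]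
    by (simp add: has_real_derivative_iff_has_vector_derivative)
  show "growth_class T u"
    unfolding growth_class_def
  proof (intro conjI allI ballI)
    fix x t assume t: "t \<in> {0<..T}"
    show "(\<lambda>z. u z t) differentiable at x" using dx[OF t] real_differentiable_def by blast
    show "(\<lambda>z. d_space u z t) differentiable at x"
      unfolding ux[OF t] using dxx[OF t] real_differentiable_def by blast
    show "u x differentiable at t within {0..T}" using dt[OF t] real_differentiable_def by blast
  next
    show "continuous_on (UNIV \<times> {0<..T}) (\<lambda>(x, t). d_time T u x t)"
      by (rule continuous_on_eq[OF cont'(1)]) (auto simp: ut)
    show "continuous_on (UNIV \<times> {0<..T}) (\<lambda>(x, t). d_space u x t)"
      by (rule continuous_on_eq[OF cont'(2)]) (auto simp: ux)
    show "continuous_on (UNIV \<times> {0<..T}) (\<lambda>(x, t). d_space (d_space u) x t)"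
      by (rule continuous_on_eq[OF cont'(3)]) (auto simp: uxx)
    show "\<exists>M m. \<forall>x. \<forall>t\<in>{0..T}. \<bar>u x t\<bar> \<le> M * exp (m * \<bar>x\<bar>)" using bound by blast
  qed (rule cont)
  show "log_operator T r abar u x t
      = ut x t - 1/2 * abar x t * uxx x t - (r - 1/2 * abar x t) * ux x t + r * u x t" if "t \<in> {0<..T}" for x t
    unfolding log_operator_def ut[OF that] ux[OF that] uxx[OF that] ..
qed

lemma growth_classD:
  assumes "growth_class T u" and t: "t \<in> {0<..T}"
  shows "(u x has_real_derivative d_time T u x t) (at t within {0..T})"
    and "((\<lambda>x. u x t) has_real_derivative d_space u x t) (at x)"
    and "((\<lambda>x. d_space u x t) has_real_derivative d_space (d_space u) x t) (at x)"
proof -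
  from assms have d: "u x differentiable at t within {0..T}" "(\<lambda>z. u z t) differentiable at x"
    "(\<lambda>z. d_space u z t) differentiable at x" unfolding growth_class_def by blast+
  show "(u x has_real_derivative d_time T u x t) (at t within {0..T})"
    using d(1) unfolding d_time_def has_real_derivative_iff_has_vector_derivative
    by (simp add: vector_derivative_works)
  show "((\<lambda>x. u x t) has_real_derivative d_space u x t) (at x)"
    using d(2) unfolding d_space_def by (simp add: DERIV_deriv_iff_real_differentiable)
  show "((\<lambda>x. d_space u x t) has_real_derivative d_space (d_space u) x t) (at x)"
    using d(3) unfolding d_space_def[of "d_space u"] by (simp add: DERIV_deriv_iff_real_differentiable)
qed

text \<open>The algebra of the time derivative of the corrector, with \<open>h\<close>,
  \<open>a\<close>, \<open>X\<close>, \<open>p\<close> for \<open>\<alpha> t\<close>,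
  \<open>A t\<close>, \<open>\<xi> x t\<close>, \<open>q x t\<close>. Naming the inverse of
  \<open>a\<close> by \<open>i\<close> with \<open>a * i = 1\<close> turns a rational identity into
  a polynomial one.\<close>

lemma lead_polynomial:
  fixes r h l a i X p :: real
  assumes "a * i = 1"
  shows "((l * h) * X + (r - h / 2) * (l * a)) * p
      + ((- r - h / 2 * i - X * (r - h / 2) * i + X\<^sup>2 * (h / 2) * (i * i)) * p) * (l * a * X)
      = h / 2 * (l * (X ^ 3 * i - 3 * X) * p - l * (a - X\<^sup>2) * p) + r * (l * (a - X\<^sup>2) * p)
        - r * (l * a * X * p) + 2 * l * h * X * p"
proof -
  define k where "k = h / 2"
  have h: "h = 2 * k" unfolding k_def by simp
  have "((- r - k * i - X * (r - k) * i + X\<^sup>2 * k * (i * i)) * p) * (l * a * X)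
      = (- r * a - k * (a * i) - X * (r - k) * (a * i) + X\<^sup>2 * k * i * (a * i)) * (l * p * X)"
    by (simp add: algebra_simps)
  thus ?thesis unfolding k_def[symmetric] h assms
    by (simp add: algebra_simps power2_eq_square power3_eq_cube)
qed

section \<open>Regularity of the carrier and of the corrector\<close>

context strike_variance
begin

lemma A_cont_strip: "continuous_on (UNIV \<times> {0<..T}) (\<lambda>p. A (snd p))"
  by (rule continuous_on_compose2[OF A_cont]) (auto intro!: continuous_intros)

lemma \<alpha>_cont_strip: "continuous_on (UNIV \<times> {0<..T}) (\<lambda>p. \<alpha> (snd p))"
  by (rule continuous_on_compose2[OF \<alpha>_cont]) (auto intro!: continuous_intros)

lemma \<xi>_cont_strip: "continuous_on (UNIV \<times> {0<..T}) (\<lambda>p. \<xi> (fst p) (snd p))"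
  unfolding \<xi>_def by (intro continuous_intros A_cont_strip) simp_all

lemma q_cont_strip: "continuous_on (UNIV \<times> {0<..T}) (\<lambda>p. q (fst p) (snd p))"
  unfolding q_def by (intro continuous_intros A_cont_strip \<xi>_cont_strip) (use A_pos in fastforce)+

lemma dp_cont_strip: "continuous_on (UNIV \<times> {0<..T}) (\<lambda>p. dp (fst p) (snd p))"
  unfolding dp_def by (intro continuous_intros A_cont_strip \<xi>_cont_strip) (use A_pos in fastforce)+

lemma dm_cont_strip: "continuous_on (UNIV \<times> {0<..T}) (\<lambda>p. dm (fst p) (snd p))"
  unfolding dm_def by (intro continuous_intros A_cont_strip \<xi>_cont_strip) (use A_pos in fastforce)+

lemma \<Phi>_dp_cont_strip: "continuous_on (UNIV \<times> {0<..T}) (\<lambda>p. std_normal_cdf (dp (fst p) (snd p)))"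
  by (rule continuous_on_compose2[OF std_normal_cdf_continuous[of UNIV] dp_cont_strip]) simp

lemma c_cont_strip: "continuous_on (UNIV \<times> {0<..T}) (\<lambda>p. c (fst p) (snd p))"
proof -
  have "continuous_on (UNIV \<times> {0<..T}) (\<lambda>p. std_normal_cdf (dm (fst p) (snd p)))"
    by (rule continuous_on_compose2[OF std_normal_cdf_continuous[of UNIV] dm_cont_strip]) simp
  hence "continuous_on (UNIV \<times> {0<..T}) (\<lambda>p. exp (fst p) * std_normal_cdf (dp (fst p) (snd p))
      - exp (- r * snd p) * std_normal_cdf (dm (fst p) (snd p)))"
    by (intro continuous_intros \<Phi>_dp_cont_strip) simp_all
  thus ?thesis by (rule continuous_on_eq) (auto simp: c_def)
qed

text \<open>With \<open>D = exp x - exp (- r t)\<close> the carrier is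
  \<open>D \<Phi>(dp) + exp (- r t) (\<Phi>(dp) - \<Phi>(dm))\<close>, and the second term is
  \<open>O(sqrt A)\<close> because \<open>dp - dm = sqrt A\<close>. In the first,
  \<open>\<Phi>(dp)\<close> converges away from the strike; at the strike it need not converge, but
  \<open>D\<close> tends to 0.\<close>

lemma c_cont: "continuous_on (UNIV \<times> {0..T}) (\<lambda>(x, t). c x t)"
proof (rule continuous_on_closed_strip)
  show "continuous_on (UNIV \<times> {0<..T}) (\<lambda>(x, t). c x t)"
    using c_cont_strip by (simp add: split_def)
  show "continuous_on UNIV (\<lambda>x. c x 0)"
    unfolding c_def by (simp, intro continuous_intros)
  fix x0 :: real
  let ?F = "at (x0, 0::real) within UNIV \<times> {0<..T}"
  have fst: "(fst \<longlongrightarrow> x0) ?F" and snd: "(snd \<longlongrightarrow> 0) ?F"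
    using tendsto_fst[OF tendsto_ident_at, of "(x0, 0::real)" "UNIV \<times> {0<..T}"]
      tendsto_snd[OF tendsto_ident_at, of "(x0, 0::real)" "UNIV \<times> {0<..T}"] by simp_all
  have ev: "\<forall>\<^sub>F p in ?F. snd p \<in> {0<..T}"
    unfolding eventually_at_filter by (rule always_eventually) auto
  have A: "((\<lambda>p. A (snd p)) \<longlongrightarrow> 0) ?F"
  proof (rule tendsto_sandwich)
    show "\<forall>\<^sub>F p in ?F. 0 \<le> A (snd p)" using ev by eventually_elim (simp add: A_nonneg)
    show "\<forall>\<^sub>F p in ?F. A (snd p) \<le> a_plus * snd p" using ev by eventually_elim (simp add: A_bounds)
    show "((\<lambda>p. a_plus * snd p) \<longlongrightarrow> 0) ?F" using tendsto_mult_left[OF snd, of a_plus] by simp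
  qed simp
  have sqrtA: "((\<lambda>p. sqrt (A (snd p))) \<longlongrightarrow> 0) ?F" using tendsto_real_sqrt[OF A] by simp
  have sqrtA_pos: "\<forall>\<^sub>F p in ?F. 0 < sqrt (A (snd p))" using ev by eventually_elim (simp add: A_pos)
  have num: "((\<lambda>p. \<xi> (fst p) (snd p) + A (snd p)) \<longlongrightarrow> x0) ?F"
  proof -
    have "((\<lambda>p. fst p + r * snd p - A (snd p) / 2 + A (snd p)) \<longlongrightarrow> x0 + r * 0 - 0 / 2 + 0) ?F"
      by (intro tendsto_intros fst snd A) simp
    thus ?thesis unfolding \<xi>_def by simp
  qed
  define D where "D p = exp (fst p) - exp (- r * snd p)" for p :: "real \<times> real"
  have D: "(D \<longlongrightarrow> exp x0 - 1) ?F"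
  proof -
    have "((\<lambda>p. exp (fst p) - exp (- r * snd p)) \<longlongrightarrow> exp x0 - exp (- r * 0)) ?F"
      by (intro tendsto_intros fst snd)
    thus ?thesis unfolding D_def[abs_def] by simp
  qed
  have main: "((\<lambda>p. D p * std_normal_cdf (dp (fst p) (snd p))) \<longlongrightarrow> max (exp x0 - 1) 0) ?F"
  proof -
    consider "x0 > 0" | "x0 < 0" | "x0 = 0" by linarith
    thus ?thesis
    proof cases
      case 1
      have "filterlim (\<lambda>p. dp (fst p) (snd p)) at_top ?F"
        unfolding dp_def by (rule LIM_at_top_divide[OF num 1 sqrtA sqrtA_pos])
      hence "((\<lambda>p. std_normal_cdf (dp (fst p) (snd p))) \<longlongrightarrow> 1) ?F"
        by (rule filterlim_compose[OF std_normal_cdf_limits(1)])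
      from tendsto_mult[OF D this] show ?thesis using 1 by simp
    next
      case 2
      have "filterlim (\<lambda>p. - (\<xi> (fst p) (snd p) + A (snd p)) / sqrt (A (snd p))) at_top ?F"
        using 2 by (intro LIM_at_top_divide[OF tendsto_minus[OF num] _ sqrtA sqrtA_pos]) simp
      hence "filterlim (\<lambda>p. - dp (fst p) (snd p)) at_top ?F"
        unfolding dp_def by (simp only: minus_divide_left)
      hence "filterlim (\<lambda>p. dp (fst p) (snd p)) at_bot ?F"
        by (simp add: filterlim_uminus_at_bot)
      hence "((\<lambda>p. std_normal_cdf (dp (fst p) (snd p))) \<longlongrightarrow> 0) ?F"
        by (rule filterlim_compose[OF std_normal_cdf_limits(2)])
      from tendsto_mult[OF D this] show ?thesis using 2 by simp
    next
      case 3
      have "((\<lambda>p. D p * std_normal_cdf (dp (fst p) (snd p))) \<longlongrightarrow> 0) ?F"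
      proof (rule Lim_null_comparison)
        show "\<forall>\<^sub>F p in ?F. norm (D p * std_normal_cdf (dp (fst p) (snd p))) \<le> norm (D p)"
          by (rule always_eventually) (simp add: abs_mult std_normal_cdf_range mult_left_le)
        show "((\<lambda>p. norm (D p)) \<longlongrightarrow> 0) ?F" using tendsto_norm_zero[OF D[unfolded 3, simplified]] 3 by simp
      qed
      thus ?thesis using 3 by simp
    qed
  qed
  have rest: "((\<lambda>p. exp (- r * snd p) * (std_normal_cdf (dp (fst p) (snd p)) - std_normal_cdf (dm (fst p) (snd p)))) \<longlongrightarrow> 0) ?F"
  proof (rule Lim_null_comparison)
    show "\<forall>\<^sub>F p in ?F. norm (exp (- r * snd p) * (std_normal_cdf (dp (fst p) (snd p)) - std_normal_cdf (dm (fst p) (snd p))))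
        \<le> exp (- r * snd p) * sqrt (A (snd p))"
      using ev
    proof eventually_elim
      case (elim p)
      have "dp (fst p) (snd p) - dm (fst p) (snd p) = A (snd p) / sqrt (A (snd p))"
        unfolding dp_def dm_def by (simp add: add_divide_distrib)
      also have "\<dots> = sqrt (A (snd p))" using A_pos[OF elim] by (simp add: real_div_sqrt)
      finally have "\<bar>std_normal_cdf (dp (fst p) (snd p)) - std_normal_cdf (dm (fst p) (snd p))\<bar> \<le> sqrt (A (snd p))"
        using std_normal_cdf_lipschitz[of "dp (fst p) (snd p)" "dm (fst p) (snd p)"] A_pos[OF elim] by simp
      thus ?case by (simp add: abs_mult mult_left_mono)
    qed
    have "((\<lambda>p. exp (- r * snd p) * sqrt (A (snd p))) \<longlongrightarrow> exp (- r * 0) * 0) ?F"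
      by (intro tendsto_intros snd sqrtA)
    thus "((\<lambda>p. exp (- r * snd p) * sqrt (A (snd p))) \<longlongrightarrow> 0) ?F" by simp
  qed
  have "((\<lambda>p. D p * std_normal_cdf (dp (fst p) (snd p))
      + exp (- r * snd p) * (std_normal_cdf (dp (fst p) (snd p)) - std_normal_cdf (dm (fst p) (snd p)))) \<longlongrightarrow> c x0 0) ?F"
    using tendsto_add[OF main rest] by (simp add: c_def)
  moreover have "\<forall>\<^sub>F p in ?F. D p * std_normal_cdf (dp (fst p) (snd p))
      + exp (- r * snd p) * (std_normal_cdf (dp (fst p) (snd p)) - std_normal_cdf (dm (fst p) (snd p)))
      = (case p of (x, t) \<Rightarrow> c x t)"
    using ev by eventually_elim (auto simp: D_def c_def algebra_simps)
  ultimately show "((\<lambda>(x, t). c x t) \<longlongrightarrow> c x0 0) ?F"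
    by (rule Lim_transform_eventually)
qed

lemma c_growth:
  assumes "t \<in> {0..T}"
  shows "\<bar>c x t\<bar> \<le> (1 + exp (\<bar>r\<bar> * T)) * exp (1 * \<bar>x\<bar>)"
proof -
  have x: "exp x \<le> exp \<bar>x\<bar>" "1 \<le> exp \<bar>x\<bar>" by simp_all
  have rt: "exp (- r * t) \<le> exp (\<bar>r\<bar> * T)"
    using assms mult_mono[of "- r" "\<bar>r\<bar>" t T] by auto
  have 1: "1 \<le> exp (\<bar>r\<bar> * T)" using T_pos by simp
  have "exp x * std_normal_cdf (dp x t) \<le> exp \<bar>x\<bar>" "0 \<le> exp x * std_normal_cdf (dp x t)"
    using mult_mono[OF x(1) std_normal_cdf_range(2)[of "dp x t"]] std_normal_cdf_range by simp_all
  moreover have "exp (- r * t) * std_normal_cdf (dm x t) \<le> exp (\<bar>r\<bar> * T)" "0 \<le> exp (- r * t) * std_normal_cdf (dm x t)"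
    using mult_mono[OF rt std_normal_cdf_range(2)[of "dm x t"]] std_normal_cdf_range by simp_all
  moreover have "exp (\<bar>r\<bar> * T) * 1 \<le> exp (\<bar>r\<bar> * T) * exp \<bar>x\<bar>" by (intro mult_left_mono x) simp
  ultimately have bounds: "\<bar>exp x * std_normal_cdf (dp x t) - exp (- r * t) * std_normal_cdf (dm x t)\<bar>
      \<le> exp \<bar>x\<bar> + exp (\<bar>r\<bar> * T) * exp \<bar>x\<bar>" by linarith
  have payoff: "\<bar>max (exp x - 1) 0\<bar> \<le> exp \<bar>x\<bar>"
    using x(1) exp_gt_zero[of x] exp_gt_zero[of "\<bar>x\<bar>"] unfolding max_def by (auto simp: abs_if)
  have "\<bar>c x t\<bar> \<le> exp \<bar>x\<bar> + exp (\<bar>r\<bar> * T) * exp \<bar>x\<bar>"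
  proof (cases "t = 0")
    case True
    hence "\<bar>c x t\<bar> \<le> exp \<bar>x\<bar>" using payoff unfolding c_def by (simp only: refl if_True)
    moreover have "0 \<le> exp (\<bar>r\<bar> * T) * exp \<bar>x\<bar>" by simp
    ultimately show ?thesis by linarith
  next
    case False
    hence "c x t = exp x * std_normal_cdf (dp x t) - exp (- r * t) * std_normal_cdf (dm x t)"
      unfolding c_def by (simp only: if_False)
    thus ?thesis using bounds by linarith
  qed
  thus ?thesis by (simp add: distrib_right)
qed

text \<open>By \<open>q_x = - (\<xi> / A) q\<close> this is \<open>- l A^2 q_x\<close> for positive
  times.\<close>

definition lead :: "real \<Rightarrow> real \<Rightarrow> real \<Rightarrow> real" where
  "lead l x t = l * A t * \<xi> x t * q x t"

definition lead_x :: "real \<Rightarrow> real \<Rightarrow> real \<Rightarrow> real" where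
  "lead_x l x t = l * (A t - (\<xi> x t)\<^sup>2) * q x t"

definition lead_xx :: "real \<Rightarrow> real \<Rightarrow> real \<Rightarrow> real" where
  "lead_xx l x t = l * ((\<xi> x t) ^ 3 * inverse (A t) - 3 * \<xi> x t) * q x t"

lemma lead_dx:
  assumes "t \<in> {0<..T}"
  shows "((\<lambda>x. lead l x t) has_real_derivative lead_x l x t) (at x)"
proof -
  have "((\<lambda>x. lead l x t) has_real_derivative
      (l * A t * 1) * q x t + (- (\<xi> x t / A t) * q x t) * (l * A t * \<xi> x t)) (at x)"
    unfolding lead_def by (intro DERIV_mult DERIV_cmult \<xi>_dx q_dx assms)
  moreover have "l * a * 1 * p + - k * p * (l * a * X) = l * (a - X\<^sup>2) * p" if "k * a = X" for k p a X
    unfolding that[symmetric] by (simp add: algebra_simps power2_eq_square)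
  ultimately show ?thesis unfolding lead_x_def
    using A_pos[OF assms] by (metis (no_types, lifting) less_irrefl nonzero_eq_divide_eq)
qed

lemma lead_dxx:
  assumes "t \<in> {0<..T}"
  shows "((\<lambda>x. lead_x l x t) has_real_derivative lead_xx l x t) (at x)"
proof -
  have "((\<lambda>x. lead_x l x t) has_real_derivative
      (l * (0 - 2 * \<xi> x t)) * q x t + (- (\<xi> x t / A t) * q x t) * (l * (A t - (\<xi> x t)\<^sup>2))) (at x)"
    unfolding lead_x_def
    by (intro DERIV_mult DERIV_cmult DERIV_diff DERIV_const q_dx assms)
       (auto intro!: derivative_eq_intros \<xi>_dx)
  thus ?thesis
  proof (rule DERIV_cong)
    have *: "(\<xi> x t / A t) * (A t - (\<xi> x t)\<^sup>2) = \<xi> x t - (\<xi> x t) ^ 3 * inverse (A t)"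
      using A_pos[OF assms] by (simp add: right_diff_distrib divide_inverse power2_eq_square power3_eq_cube)
    have e: "(- (\<xi> x t / A t) * q x t) * (l * (A t - (\<xi> x t)\<^sup>2)) = - l * (\<xi> x t - (\<xi> x t) ^ 3 * inverse (A t)) * q x t"
    proof -
      have "(- k * p) * (l * w) = - l * (k * w) * p" for k p w :: real by (simp add: mult_ac)
      thus ?thesis using * by metis
    qed
    show "(l * (0 - 2 * \<xi> x t)) * q x t + (- (\<xi> x t / A t) * q x t) * (l * (A t - (\<xi> x t)\<^sup>2)) = lead_xx l x t"
      unfolding e lead_xx_def by (simp add: algebra_simps)
  qed
qed

text \<open>The first terms are the operator frozen at the strike, applied to the corrector. The
  last is the time derivative of the prefactor \<open>A^2\<close> in \<open>- l A^2 q_x\<close>; it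
  is the forcing that has to balance the source.\<close>

lemma lead_dt:
  assumes "t \<in> {0<..T}"
  shows "(lead l x has_real_derivative
     \<alpha> t / 2 * (lead_xx l x t - lead_x l x t) + r * lead_x l x t - r * lead l x t + 2 * l * \<alpha> t * \<xi> x t * q x t)
     (at t within {0..T})"
proof -
  have t: "t \<in> {0..T}" using assms by auto
  have i: "A t * inverse (A t) = 1" using A_pos[OF assms] by simp
  have "(lead l x has_real_derivative
      ((l * \<alpha> t) * \<xi> x t + (r - \<alpha> t / 2) * (l * A t)) * q x t
      + ((- r - \<alpha> t / (2 * A t) - \<xi> x t * (r - \<alpha> t / 2) / A t + (\<xi> x t)\<^sup>2 * \<alpha> t / (2 * (A t)\<^sup>2)) * q x t)
        * (l * A t * \<xi> x t)) (at t within {0..T})"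
    unfolding lead_def[abs_def]
    by (intro DERIV_mult DERIV_cmult \<xi>_dt q_dt assms A_has_derivative t)
  moreover have "- r - \<alpha> t / (2 * A t) - \<xi> x t * (r - \<alpha> t / 2) / A t + (\<xi> x t)\<^sup>2 * \<alpha> t / (2 * (A t)\<^sup>2)
      = - r - \<alpha> t / 2 * inverse (A t) - \<xi> x t * (r - \<alpha> t / 2) * inverse (A t)
        + (\<xi> x t)\<^sup>2 * (\<alpha> t / 2) * (inverse (A t) * inverse (A t))"
    unfolding divide_inverse inverse_mult_distrib power2_eq_square by (simp only: mult_ac)
  ultimately show ?thesis
    unfolding lead_xx_def lead_x_def lead_def
    by (elim DERIV_cong) (simp only: lead_polynomial[OF i, of l "\<alpha> t"])
qed

text \<open>The orders add up: 1 for \<open>A\<close>, \<open>1/2\<close> for \<open>\<xi>\<close>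
  and \<open>-1/2\<close> for \<open>q\<close>. Being uniform in \<open>x\<close>, the bound yields
  both boundedness and continuity at \<open>t = 0\<close>.\<close>

lemma lead_bound: "\<exists>C\<ge>0. \<forall>x. \<forall>t\<in>{0..T}. \<bar>lead l x t\<bar> \<le> C * t"
proof -
  have "par_bound T (1 + 1/2) (\<lambda>x t. A t * \<xi> x t)"
    by (rule par_orderE[OF par_order_mult[OF par_order_A par_order_\<xi>]])
  from q_times_par_bound[OF par_bound_cmult[OF this, of l]]
  obtain C where C: "C \<ge> 0" "\<And>x t. t \<in> {0<..T} \<Longrightarrow> \<bar>q x t * (l * (A t * \<xi> x t))\<bar> \<le> C * t"
    by auto
  have "\<bar>lead l x t\<bar> \<le> C * t" if "t \<in> {0..T}" for x t
  proof (cases "t = 0")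
    case False
    with that have "t \<in> {0<..T}" by auto
    from C(2)[OF this, of x] show ?thesis unfolding lead_def by (simp only: mult_ac)
  qed (simp add: lead_def)
  with C(1) show ?thesis by blast
qed

lemma lead_cont_strip:
  "continuous_on (UNIV \<times> {0<..T}) (\<lambda>p. lead l (fst p) (snd p))"
  "continuous_on (UNIV \<times> {0<..T}) (\<lambda>p. lead_x l (fst p) (snd p))"
  "continuous_on (UNIV \<times> {0<..T}) (\<lambda>p. lead_xx l (fst p) (snd p))"
  unfolding lead_def lead_x_def lead_xx_def
  by (intro continuous_intros A_cont_strip \<xi>_cont_strip q_cont_strip; use A_pos in fastforce)+

lemma lead_cont: "continuous_on (UNIV \<times> {0..T}) (\<lambda>(x, t). lead l x t)"
proof (rule continuous_on_closed_strip)
  show "continuous_on (UNIV \<times> {0<..T}) (\<lambda>(x, t). lead l x t)"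
    using lead_cont_strip(1) by (simp add: split_def)
  show "continuous_on UNIV (\<lambda>x. lead l x 0)" unfolding lead_def by simp
  fix x0 :: real
  obtain C where C: "C \<ge> 0" "\<And>x t. t \<in> {0..T} \<Longrightarrow> \<bar>lead l x t\<bar> \<le> C * t" using lead_bound by blast
  let ?F = "at (x0, 0::real) within UNIV \<times> {0<..T}"
  have snd: "(snd \<longlongrightarrow> 0) ?F"
    using tendsto_snd[OF tendsto_ident_at, of "(x0, 0::real)" "UNIV \<times> {0<..T}"] by simp
  have "((\<lambda>(x, t). lead l x t) \<longlongrightarrow> 0) ?F"
  proof (rule Lim_null_comparison)
    show "\<forall>\<^sub>F p in ?F. norm (case p of (x, t) \<Rightarrow> lead l x t) \<le> C * snd p"
      unfolding eventually_at_filter by (rule always_eventually) (auto intro!: C)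
    show "((\<lambda>p. C * snd p) \<longlongrightarrow> 0) ?F" using tendsto_mult_left[OF snd, of C] by simp
  qed
  thus "((\<lambda>(x, t). lead l x t) \<longlongrightarrow> lead l x0 0) ?F" by (simp add: lead_def)
qed

end

section \<open>The remainder\<close>

text \<open>The lower bound \<open>m\<close> keeps the square root away from its singularity.
  Applied to \<open>abar\<close>, whose square root is the dispersion in the coupling.\<close>

lemma sqrt_has_second_derivative:
  fixes f f1 f2 :: "real \<Rightarrow> real"
  assumes d1: "\<And>x. (f has_real_derivative f1 x) (at x)" and d2: "\<And>x. (f1 has_real_derivative f2 x) (at x)"
    and pos: "0 < m" "\<And>x. m \<le> f x" and b1: "\<And>x. \<bar>f1 x\<bar> \<le> B" and b2: "\<And>x. \<bar>f2 x\<bar> \<le> B"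
  shows "\<exists>g1 g2. \<forall>x. ((\<lambda>x. sqrt (f x)) has_real_derivative g1 x) (at x) \<and> (g1 has_real_derivative g2 x) (at x) \<and>
    \<bar>g1 x\<bar> \<le> B * inverse (sqrt m) \<and> \<bar>g2 x\<bar> \<le> B * inverse (sqrt m) + (B * inverse (sqrt m)) * (B * inverse (sqrt m)) * inverse (sqrt m)"
proof -
  define s where "s x = inverse (sqrt (f x))" for x
  define g1 g2 where "g1 x = f1 x * s x / 2" and "g2 x = (f2 x * s x + - (s x * (f1 x * s x / 2) * s x) * f1 x) / 2" for x
  define M where "M = inverse (sqrt m)"
  have f_pos: "f x > 0" for x using pos(1) pos(2)[of x] by linarith
  have B0: "0 \<le> B" using b1[of 0] by linarith
  have M0: "0 \<le> M" using pos(1) unfolding M_def by simp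
  have s: "0 \<le> s x" "s x \<le> M" for x
    using f_pos[of x] pos(1) pos(2)[of x] unfolding s_def M_def by (auto intro!: le_imp_inverse_le)
  have ds: "((\<lambda>x. sqrt (f x)) has_real_derivative g1 x) (at x)" for x
    using DERIV_chain2[OF DERIV_real_sqrt[OF f_pos] d1, of x] unfolding g1_def s_def by (simp add: mult_ac)
  have dinv: "(s has_real_derivative - (s x * (f1 x * s x / 2) * s x)) (at x)" for x
    using DERIV_inverse'[OF ds[of x]] f_pos[of x] unfolding s_def g1_def by simp
  have dg: "(g1 has_real_derivative g2 x) (at x)" for x
    unfolding g1_def g2_def by (intro DERIV_cdivide DERIV_mult d2 dinv)
  have fs: "\<bar>f1 x * s x\<bar> \<le> B * M" "\<bar>f2 x * s x\<bar> \<le> B * M" for x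
    unfolding abs_mult using b1[of x] b2[of x] s[of x] B0 by (auto intro!: mult_mono)
  have "\<bar>g1 x\<bar> \<le> B * M" for x
    using fs(1)[of x] unfolding g1_def by linarith
  moreover have "\<bar>g2 x\<bar> \<le> B * M + (B * M) * (B * M) * M" for x
  proof -
    have "\<bar>(f1 x * s x) * (f1 x * s x) * s x\<bar> \<le> (B * M) * (B * M) * M"
      unfolding abs_mult[of "_ * _" "s x"] abs_mult[of "f1 x * s x" "f1 x * s x"]
      using fs(1)[of x] s[of x] B0 M0 by (intro mult_mono) auto
    moreover have "g2 x = f2 x * s x / 2 - (f1 x * s x) * (f1 x * s x) * s x / 4"
      unfolding g2_def by (simp add: field_simps)
    ultimately show ?thesis using fs(2)[of x] by linarith
  qed
  ultimately show ?thesis using ds dg unfolding M_def by blast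
qed

text \<open>\<open>\<gamma>\<close> stands for \<open>\<zeta> / 2\<close> and \<open>b\<close> for
  the slope of \<open>abar\<close> in \<open>x\<close> at the strike and time 0. The bound
  \<open>\<gamma> < 1/2\<close> lets contributions of order 1 to the residual count as order
  \<open>\<gamma> + 1/2\<close>.\<close>

locale local_variance = strike_variance T r a_minus a_plus "abar 0"
  for T r a_minus a_plus :: real and abar :: "real \<Rightarrow> real \<Rightarrow> real" +
  fixes a1 a2 :: "real \<Rightarrow> real \<Rightarrow> real" and B b \<gamma> :: real
  assumes elliptic: "\<And>x t. t \<in> {0..T} \<Longrightarrow> a_minus \<le> abar x t \<and> abar x t \<le> a_plus"
    and da: "\<And>x t. t \<in> {0<..T} \<Longrightarrow> ((\<lambda>x. abar x t) has_real_derivative a1 x t) (at x)"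
    and da1: "\<And>x t. t \<in> {0<..T} \<Longrightarrow> ((\<lambda>x. a1 x t) has_real_derivative a2 x t) (at x)"
    and a1_bound: "\<And>x t. t \<in> {0<..T} \<Longrightarrow> \<bar>a1 x t\<bar> \<le> B"
    and a2_bound: "\<And>x t. t \<in> {0<..T} \<Longrightarrow> \<bar>a2 x t\<bar> \<le> B"
    and \<gamma>: "0 < \<gamma>" "\<gamma> < 1/2"
    and slope_time: "\<And>t. t \<in> {0<..T} \<Longrightarrow> \<bar>a1 0 t - b\<bar> \<le> B * t powr \<gamma>"
    and level_time: "\<And>t. t \<in> {0<..T} \<Longrightarrow> \<bar>abar 0 t - abar 0 0\<bar> \<le> B * t powr \<gamma>"
begin

definition amplitude :: real where "amplitude = b / (4 * abar 0 0)"

text \<open>The defect of \<open>c\<close> plus corrector in the full equation, divided by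
  \<open>q\<close>: the source left by the carrier, minus the forcing of the corrector, plus the
  variance increment acting on \<open>lead_xx - lead_x\<close>.\<close>

definition residual_factor :: "real \<Rightarrow> real \<Rightarrow> real" where
  "residual_factor x t = (abar x t - abar 0 t) / 2 - 2 * amplitude * abar 0 t * \<xi> x t
     + (abar x t - abar 0 t) / 2 * (amplitude * ((\<xi> x t) ^ 3 * inverse (A t) - 3 * \<xi> x t - A t + (\<xi> x t)\<^sup>2))"

lemma B_nonneg: "0 \<le> B"
  using a1_bound[of T 0] T_pos by fastforce

lemma abar_0_pos: "0 < abar 0 0"
  using elliptic[of 0 0] T_pos a_minus_pos by simp

lemma par_order_increment: "par_order T (1/2) (\<lambda>x t. abar x t - abar 0 t)"
proof (rule par_orderI)
  show "((\<lambda>x. abar x t - abar 0 t) has_real_derivative a1 x t) (at x)" if "t \<in> {0<..T}" for x t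
    using DERIV_diff[OF da[OF that] DERIV_const] by simp
  show "((\<lambda>x. a1 x t) has_real_derivative a2 x t) (at x)" if "t \<in> {0<..T}" for x t by (rule da1[OF that])
  show "par_bound T (1/2) (\<lambda>x t. abar x t - abar 0 t)"
  proof (rule par_bound_mono)
    show "par_bound T (1/2) (\<lambda>x t. B * x)" by (intro par_bound_cmult par_bound_space)
    show "\<bar>abar x t - abar 0 t\<bar> \<le> \<bar>B * x\<bar>" if "t \<in> {0<..T}" for x t
      using lipschitz_of_bounded_derivative[OF da[OF that] a1_bound[OF that], of x 0] B_nonneg
      by (simp add: abs_mult)
  qed
  have B: "\<bar>B\<bar> = B" using B_nonneg by simp
  show "par_bound T (1/2 - 1/2) a1"
    using par_bound_mono[OF par_bound_const[of T B], of a1] a1_bound B by simp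
  show "par_bound T (1/2 - 1) a2"
    using par_bound_weaken[OF par_bound_mono[OF par_bound_const[of T B], of a2], of "1/2 - 1"] a2_bound B by simp
qed

text \<open>The order is \<open>\<gamma> + 1/2\<close> rather than 1 because the slope at the strike
  is compared with its value at time 0, at the cost of \<open>t powr \<gamma>\<close>. The second
  derivative is merely bounded, which is enough since \<open>\<gamma> - 1/2 < 0\<close>.\<close>

lemma par_order_taylor_remainder: "par_order T (\<gamma> + 1/2) (\<lambda>x t. abar x t - abar 0 t - b * x)"
proof (rule par_orderI)
  show "((\<lambda>x. abar x t - abar 0 t - b * x) has_real_derivative a1 x t - b) (at x)" if "t \<in> {0<..T}" for x t
    using DERIV_diff[OF DERIV_diff[OF da[OF that] DERIV_const] DERIV_cmult[OF DERIV_ident]] by simp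
  show "((\<lambda>x. a1 x t - b) has_real_derivative a2 x t) (at x)" if "t \<in> {0<..T}" for x t
    using DERIV_diff[OF da1[OF that] DERIV_const] by simp
  have pw: "par_bound T \<gamma> (\<lambda>x t. B * t powr \<gamma>)"
    by (rule par_bound_time[of _ _ B]) (simp add: B_nonneg)
  have sp: "par_bound T (1/2) (\<lambda>x t. B * \<bar>x\<bar>)" by (intro par_bound_cmult par_bound_abs par_bound_space)
  have w: "par_bound T \<gamma> (\<lambda>x t. B * \<bar>x\<bar> + B * t powr \<gamma>)"
    by (intro par_bound_add pw par_bound_weaken[OF sp]) (use \<gamma> in simp)
  have slope: "\<bar>a1 x t - b\<bar> \<le> B * \<bar>x\<bar> + B * t powr \<gamma>" if "t \<in> {0<..T}" for x t
    using lipschitz_of_bounded_derivative[OF da1[OF that] a2_bound[OF that], of x 0] slope_time[OF that] by simp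
  show "par_bound T (\<gamma> + 1/2 - 1/2) (\<lambda>x t. a1 x t - b)"
    using par_bound_mono[OF w, of "\<lambda>x t. a1 x t - b"] order_trans[OF slope abs_ge_self] by simp
  show "par_bound T (\<gamma> + 1/2) (\<lambda>x t. abar x t - abar 0 t - b * x)"
  proof (rule par_bound_mono)
    show "par_bound T (\<gamma> + 1/2) (\<lambda>x t. (B * \<bar>x\<bar> + B * t powr \<gamma>) * x)"
      by (rule par_bound_mult[OF w par_bound_space])
    show "\<bar>abar x t - abar 0 t - b * x\<bar> \<le> \<bar>(B * \<bar>x\<bar> + B * t powr \<gamma>) * x\<bar>" if t: "t \<in> {0<..T}" for x t
    proof -
      obtain \<eta> where \<eta>: "\<bar>\<eta> - 0\<bar> \<le> \<bar>x - 0\<bar>" "abar x t - abar 0 t = (x - 0) * a1 \<eta> t"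
        using mean_value_between[OF da[OF t]] by blast
      have "abar x t - abar 0 t - b * x = (a1 \<eta> t - b) * x" using \<eta>(2) by (simp add: algebra_simps)
      moreover have "\<bar>a1 \<eta> t - b\<bar> \<le> B * \<bar>x\<bar> + B * t powr \<gamma>"
        using slope[OF t, of \<eta>] mult_left_mono[OF \<eta>(1) B_nonneg] by simp
      ultimately show ?thesis by (simp add: abs_mult mult_right_mono)
    qed
  qed
  have "par_bound T 0 a2"
    using par_bound_mono[OF par_bound_const[of T B], of a2] a2_bound B_nonneg by simp
  thus "par_bound T (\<gamma> + 1/2 - 1) a2" by (rule par_bound_weaken) (use \<gamma> in simp)
qed

text \<open>Once the linear terms cancel, four errors remain: the Taylor remainder of the variance,
  the shift \<open>\<xi> - x\<close>, the change of \<open>abar 0 t\<close> since time 0, and the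
  product of the variance increment with the cubic factor of the corrector. The second and fourth
  have order 1, the others \<open>\<gamma> + 1/2\<close>.\<close>

lemma par_order_residual_factor: "par_order T (\<gamma> + 1/2) residual_factor"
proof -
  define a where "a = abar 0 0"
  have a: "a > 0" unfolding a_def by (rule abar_0_pos)
  have 1: "par_order T (\<gamma> + 1/2) (\<lambda>x t. (1/2) * (abar x t - abar 0 t - b * x))"
    by (intro par_order_cmult par_order_taylor_remainder)
  have 2: "par_order T (\<gamma> + 1/2) (\<lambda>x t. (- b / 2) * (r * t - A t / 2))"
    by (intro par_order_cmult par_order_weaken[OF par_order_drift]) (use \<gamma> in simp)
  have 3: "par_order T (\<gamma> + 1/2) (\<lambda>x t. (- b / (2 * a)) * ((abar 0 t - a) * \<xi> x t))"
    by (intro par_order_cmult par_order_mult par_order_\<xi> par_order_time[of _ _ B])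
       (use level_time in \<open>simp add: a_def\<close>)
  have \<xi>2: "par_order T (1/2 + 1/2) (\<lambda>x t. \<xi> x t * \<xi> x t)"
    by (intro par_order_mult par_order_\<xi>)
  have \<xi>3: "par_order T ((1/2 + 1/2) + (1/2 + -1)) (\<lambda>x t. (\<xi> x t * \<xi> x t) * (\<xi> x t * inverse (A t)))"
    by (intro par_order_mult[OF \<xi>2] par_order_mult par_order_\<xi> par_order_inverse_A)
  have "par_order T (1/2) (\<lambda>x t. (\<xi> x t * \<xi> x t) * (\<xi> x t * inverse (A t)) - 3 * \<xi> x t - A t + \<xi> x t * \<xi> x t)"
    using \<xi>3
    by (intro par_order_add par_order_diff par_order_cmult par_order_\<xi> par_order_weaken[OF par_order_A] par_order_weaken[OF \<xi>2])
       simp_all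
  from par_order_mult[OF par_order_increment this]
  have 4: "par_order T (\<gamma> + 1/2) (\<lambda>x t. (amplitude / 2) * ((abar x t - abar 0 t)
      * ((\<xi> x t * \<xi> x t) * (\<xi> x t * inverse (A t)) - 3 * \<xi> x t - A t + \<xi> x t * \<xi> x t)))"
    by (intro par_order_cmult) (rule par_order_weaken, assumption, use \<gamma> in simp)
  have eq: "residual_factor = (\<lambda>x t. ((1/2) * (abar x t - abar 0 t - b * x) + (- b / 2) * (r * t - A t / 2)
      + (- b / (2 * a)) * ((abar 0 t - a) * \<xi> x t))
      + (amplitude / 2) * ((abar x t - abar 0 t)
      * ((\<xi> x t * \<xi> x t) * (\<xi> x t * inverse (A t)) - 3 * \<xi> x t - A t + \<xi> x t * \<xi> x t)))"
  proof (intro ext)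
    fix x t
    have x: "(1/2) * (abar x t - abar 0 t - b * x) + (- b / 2) * (r * t - A t / 2)
        = (abar x t - abar 0 t) / 2 - b / 2 * \<xi> x t"
      unfolding \<xi>_def by (simp add: field_simps)
    \<comment> \<open>This is where the value of \<open>amplitude\<close> matters:
      \<open>2 * amplitude * a = b / 2\<close>, so the linear terms cancel up to
      \<open>abar 0 t - a\<close>.\<close>
    have lin: "- b / (2 * a) * ((abar 0 t - a) * \<xi> x t) = b / 2 * \<xi> x t - 2 * amplitude * abar 0 t * \<xi> x t"
      unfolding amplitude_def a_def[symmetric] using a by (simp add: field_simps)
    show "residual_factor x t = ((1/2) * (abar x t - abar 0 t - b * x) + (- b / 2) * (r * t - A t / 2)
      + (- b / (2 * a)) * ((abar 0 t - a) * \<xi> x t))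
      + (amplitude / 2) * ((abar x t - abar 0 t)
      * ((\<xi> x t * \<xi> x t) * (\<xi> x t * inverse (A t)) - 3 * \<xi> x t - A t + \<xi> x t * \<xi> x t))"
      unfolding x lin residual_factor_def by (simp add: power2_eq_square power3_eq_cube)
  qed
  show ?thesis unfolding eq by (intro par_order_add 1 2 3 4)
qed

definition ansatz :: "real \<Rightarrow> real \<Rightarrow> real" where "ansatz x t = c x t + lead amplitude x t"

definition ansatz_x :: "real \<Rightarrow> real \<Rightarrow> real" where
  "ansatz_x x t = exp x * std_normal_cdf (dp x t) + lead_x amplitude x t"

definition ansatz_xx :: "real \<Rightarrow> real \<Rightarrow> real" where
  "ansatz_xx x t = exp x * std_normal_cdf (dp x t) + q x t + lead_xx amplitude x t"

definition ansatz_t :: "real \<Rightarrow> real \<Rightarrow> real" where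
  "ansatz_t x t = (abar 0 t / 2 * q x t + r * (exp x * std_normal_cdf (dp x t) - c x t))
     + (abar 0 t / 2 * (lead_xx amplitude x t - lead_x amplitude x t) + r * lead_x amplitude x t - r * lead amplitude x t
        + 2 * amplitude * abar 0 t * \<xi> x t * q x t)"

lemma ansatz_derivs:
  assumes "t \<in> {0<..T}"
  shows "((\<lambda>x. ansatz x t) has_real_derivative ansatz_x x t) (at x)"
    and "((\<lambda>x. ansatz_x x t) has_real_derivative ansatz_xx x t) (at x)"
    and "(ansatz x has_real_derivative ansatz_t x t) (at t within {0..T})"
  unfolding ansatz_def[abs_def] ansatz_x_def ansatz_xx_def ansatz_t_def
  by (intro DERIV_add c_dx lead_dx lead_dxx c_dxx c_dt lead_dt assms)+

lemma ansatz_equation: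
  "ansatz_t x t = abar x t / 2 * (ansatz_xx x t - ansatz_x x t) + r * ansatz_x x t - r * ansatz x t - q x t * residual_factor x t"
proof -
  define D where "D = (\<xi> x t) ^ 3 * inverse (A t) - 3 * \<xi> x t - A t + (\<xi> x t)\<^sup>2"
  have 1: "lead_xx amplitude x t - lead_x amplitude x t = amplitude * D * q x t"
    unfolding lead_xx_def lead_x_def D_def by (simp add: algebra_simps)
  have 2: "ansatz_xx x t - ansatz_x x t = q x t + amplitude * D * q x t"
    unfolding ansatz_xx_def ansatz_x_def 1[symmetric] by simp
  have 3: "residual_factor x t = (abar x t - abar 0 t) / 2 - 2 * amplitude * abar 0 t * \<xi> x t + (abar x t - abar 0 t) / 2 * (amplitude * D)"
    unfolding residual_factor_def D_def ..
  show ?thesis unfolding 2 3 ansatz_t_def 1 unfolding ansatz_x_def ansatz_def by (simp add: field_simps)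
qed

lemma ansatz_cont: "continuous_on (UNIV \<times> {0..T}) (\<lambda>(x, t). ansatz x t)"
  using continuous_on_add[OF c_cont lead_cont[of amplitude]] unfolding ansatz_def by (simp add: split_def)

lemma ansatz_cont_strip:
  "continuous_on (UNIV \<times> {0<..T}) (\<lambda>(x, t). ansatz x t)"
  "continuous_on (UNIV \<times> {0<..T}) (\<lambda>(x, t). ansatz_x x t)"
  "continuous_on (UNIV \<times> {0<..T}) (\<lambda>(x, t). ansatz_xx x t)"
  "continuous_on (UNIV \<times> {0<..T}) (\<lambda>(x, t). ansatz_t x t)"
  unfolding ansatz_def ansatz_x_def ansatz_xx_def ansatz_t_def split_def
  by (intro continuous_intros c_cont_strip lead_cont_strip q_cont_strip \<Phi>_dp_cont_strip \<alpha>_cont_strip \<xi>_cont_strip; simp)+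

lemma ansatz_growth: "\<exists>M\<ge>0. \<forall>x. \<forall>t\<in>{0..T}. \<bar>ansatz x t\<bar> \<le> M * exp (1 * \<bar>x\<bar>)"
proof -
  obtain C where C: "C \<ge> 0" "\<And>x t. t \<in> {0..T} \<Longrightarrow> \<bar>lead amplitude x t\<bar> \<le> C * t" using lead_bound by blast
  have "\<bar>ansatz x t\<bar> \<le> ((1 + exp (\<bar>r\<bar> * T)) + C * T) * exp (1 * \<bar>x\<bar>)" if "t \<in> {0..T}" for x t
  proof -
    have "\<bar>lead amplitude x t\<bar> \<le> C * T * 1"
      using C(2)[OF that, of x] mult_left_mono[of t T C] C(1) that by simp
    also have "\<dots> \<le> C * T * exp (1 * \<bar>x\<bar>)" using C(1) T_pos by (intro mult_left_mono) auto
    finally show ?thesis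
      using c_growth[OF that, of x] abs_triangle_ineq[of "c x t" "lead amplitude x t"] unfolding ansatz_def
      by (simp only: distrib_right)
  qed
  moreover have "0 \<le> (1 + exp (\<bar>r\<bar> * T)) + C * T" using C T_pos by simp
  ultimately show ?thesis by blast
qed

lemma residual_bounds:
  "\<exists>R1 R2 C. 0 \<le> C \<and> (\<forall>x. \<forall>t\<in>{0<..T}.
     ((\<lambda>x. q x t * residual_factor x t) has_real_derivative R1 x t) (at x) \<and>
     ((\<lambda>x. R1 x t) has_real_derivative R2 x t) (at x) \<and>
     \<bar>q x t * residual_factor x t\<bar> \<le> C * t powr \<gamma> \<and> \<bar>R1 x t\<bar> \<le> C * t powr (\<gamma> - 1/2) \<and> \<bar>R2 x t\<bar> \<le> C * t powr (\<gamma> - 1))"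
  using q_times_par_order[OF par_order_residual_factor] by simp

lemma barrier_derivative:
  assumes "t > 0"
  shows "((\<lambda>t. M * (t powr (1 + \<gamma>) * exp (\<bar>r\<bar> * t))) has_real_derivative
    M * ((1 + \<gamma>) * t powr \<gamma> * exp (\<bar>r\<bar> * t) + \<bar>r\<bar> * exp (\<bar>r\<bar> * t) * t powr (1 + \<gamma>))) (at t within {0..T})"
proof -
  have "((\<lambda>t. t powr (1 + \<gamma>)) has_real_derivative (1 + \<gamma>) * t powr (1 + \<gamma> - 1)) (at t within {0..T})"
    by (rule has_field_derivative_at_within) (rule has_real_derivative_powr[OF assms])
  moreover have "((\<lambda>t. exp (\<bar>r\<bar> * t)) has_real_derivative \<bar>r\<bar> * exp (\<bar>r\<bar> * t)) (at t within {0..T})"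
    by (auto intro!: derivative_eq_intros)
  ultimately show ?thesis using DERIV_cmult[OF DERIV_mult] by force
qed

text \<open>For suitable \<open>M\<close> of either sign these functions are super- and
  subsolutions. The factor \<open>exp (|r| t)\<close> turns the zero-order contribution into
  \<open>(|r| + r)\<close> times a nonnegative term, whatever the sign of \<open>r\<close>.\<close>

lemma barrier_growth:
  fixes M :: real
  defines "v \<equiv> \<lambda>x t. ansatz x t + M * (t powr (1 + \<gamma>) * exp (\<bar>r\<bar> * t))"
  shows "growth_class T v"
    and "t \<in> {0<..T} \<Longrightarrow> log_operator T r abar v x t =
      - (q x t * residual_factor x t) + M * (((1 + \<gamma>) * t powr \<gamma> + (\<bar>r\<bar> + r) * t powr (1 + \<gamma>)) * exp (\<bar>r\<bar> * t))"
proof -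
  define e where "e t = M * (t powr (1 + \<gamma>) * exp (\<bar>r\<bar> * t))" for t
  define e' where "e' t = M * ((1 + \<gamma>) * t powr \<gamma> * exp (\<bar>r\<bar> * t) + \<bar>r\<bar> * exp (\<bar>r\<bar> * t) * t powr (1 + \<gamma>))" for t
  obtain N where N: "N \<ge> 0" "\<And>x t. t \<in> {0..T} \<Longrightarrow> \<bar>ansatz x t\<bar> \<le> N * exp (1 * \<bar>x\<bar>)"
    using ansatz_growth by blast
  have e_cont: "continuous_on {0..T} e"
    unfolding e_def using \<gamma> by (auto intro!: continuous_intros continuous_on_powr')
  have cont: "continuous_on (UNIV \<times> {0..T}) (\<lambda>(x, t). ansatz x t + e t)"
  proof -
    have "continuous_on (UNIV \<times> {0..T}) (\<lambda>p :: real \<times> real. e (snd p))"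
      by (rule continuous_on_compose2[OF e_cont]) (auto intro!: continuous_intros)
    from continuous_on_add[OF ansatz_cont this] show ?thesis by (simp add: split_def)
  qed
  have cont': "continuous_on (UNIV \<times> {0<..T}) (\<lambda>(x, t). ansatz_t x t + e' t)"
  proof -
    have "continuous_on (UNIV \<times> {0<..T}) (\<lambda>p :: real \<times> real. e' (snd p))"
      unfolding e'_def by (intro continuous_intros) auto
    from continuous_on_add[OF ansatz_cont_strip(4) this] show ?thesis by (simp add: split_def)
  qed
  have e_bound: "\<bar>e t\<bar> \<le> \<bar>M\<bar> * (T powr (1 + \<gamma>) * exp (\<bar>r\<bar> * T))" if "t \<in> {0..T}" for t
    unfolding e_def abs_mult using that \<gamma>
    by (intro mult_left_mono mult_mono) (auto intro!: powr_mono2 mult_left_mono)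
  have bound: "\<bar>ansatz x t + e t\<bar> \<le> (N + \<bar>M\<bar> * (T powr (1 + \<gamma>) * exp (\<bar>r\<bar> * T))) * exp (1 * \<bar>x\<bar>)"
    if "t \<in> {0..T}" for x t
  proof -
    have "\<bar>e t\<bar> \<le> \<bar>M\<bar> * (T powr (1 + \<gamma>) * exp (\<bar>r\<bar> * T)) * 1" using e_bound[OF that] by simp
    also have "\<dots> \<le> \<bar>M\<bar> * (T powr (1 + \<gamma>) * exp (\<bar>r\<bar> * T)) * exp (1 * \<bar>x\<bar>)" by (intro mult_left_mono) auto
    finally show ?thesis using N(2)[OF that, of x] abs_triangle_ineq[of "ansatz x t" "e t"]
      by (simp only: distrib_right)
  qed
  have dt: "((\<lambda>t. ansatz x t + e t) has_real_derivative ansatz_t x t + e' t) (at t within {0..T})" if "t \<in> {0<..T}" for x t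
    unfolding e_def e'_def by (intro DERIV_add ansatz_derivs barrier_derivative) (use that in auto)
  have dx: "((\<lambda>x. ansatz x t + e t) has_real_derivative ansatz_x x t) (at x)" if "t \<in> {0<..T}" for x t
    using DERIV_add[OF ansatz_derivs(1)[OF that] DERIV_const] by simp
  have v_eq: "v = (\<lambda>x t. ansatz x t + e t)" unfolding v_def e_def ..
  note gc = growth_classI[where u = "\<lambda>x t. ansatz x t + e t", OF T_pos cont dt dx ansatz_derivs(2) cont' ansatz_cont_strip(2,3) bound]
  show "growth_class T v" unfolding v_eq by (rule gc(1))
  show "log_operator T r abar v x t =
      - (q x t * residual_factor x t) + M * (((1 + \<gamma>) * t powr \<gamma> + (\<bar>r\<bar> + r) * t powr (1 + \<gamma>)) * exp (\<bar>r\<bar> * t))"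
    if t: "t \<in> {0<..T}"
  proof -
    have "log_operator T r abar v x t = (ansatz_t x t + e' t) - 1/2 * abar x t * ansatz_xx x t
        - (r - 1/2 * abar x t) * ansatz_x x t + r * (ansatz x t + e t)"
      unfolding v_eq by (rule gc(2)) (use t in simp_all)
    thus ?thesis unfolding ansatz_equation[of x t] e_def e'_def by (simp add: algebra_simps)
  qed
qed

lemma coefficients_coupled:
  "\<exists>L. coupled_coefficients T L (\<lambda>x t. sqrt (abar x t)) (\<lambda>x t. r - abar x t / 2)"
proof -
  define C1 C2 where "C1 = B * inverse (sqrt a_minus)"
    and "C2 = C1 + C1 * C1 * inverse (sqrt a_minus)"
  \<comment> \<open>One constant for the sizes of dispersion and drift and for the first two
    derivatives of both.\<close>
  define L where "L = sqrt a_plus + (\<bar>r\<bar> + a_plus) + C1 + C2 + B"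
  have C0: "0 \<le> C1" "0 \<le> C2" using B_nonneg a_minus_pos unfolding C1_def C2_def by simp_all
  have ap: "0 < sqrt a_plus" "0 < a_plus" using a_plus_pos by simp_all
  have L: "0 \<le> L" "C1 \<le> L" "C2 \<le> L" "B \<le> L" "sqrt a_plus \<le> L" "\<bar>r\<bar> + a_plus \<le> L"
    unfolding L_def using C0 ap B_nonneg by linarith+
  have three: "\<bar>f x + f y - 2 * f m\<bar> \<le> L * (\<bar>x + y - 2 * m\<bar> + (x - y)\<^sup>2)"
    if "\<And>x. (f has_real_derivative f1 x) (at x)" "\<And>x. (f1 has_real_derivative f2 x) (at x)"
      "\<And>x. \<bar>f1 x\<bar> \<le> L" "\<And>x. \<bar>f2 x\<bar> \<le> L" for f f1 f2 :: "real \<Rightarrow> real" and x y m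
    using three_point_of_bounded_derivatives[OF that, of x y m] by (simp add: distrib_left)
  have sigma: "\<exists>g1 g2. \<forall>x. ((\<lambda>x. sqrt (abar x t)) has_real_derivative g1 x) (at x) \<and> (g1 has_real_derivative g2 x) (at x)
      \<and> \<bar>g1 x\<bar> \<le> L \<and> \<bar>g2 x\<bar> \<le> L" if t: "t \<in> {0<..T}" for t
  proof -
    have "a_minus \<le> abar x t" for x using elliptic[of t x] t by simp
    from sqrt_has_second_derivative[OF da[OF t] da1[OF t] a_minus_pos this a1_bound[OF t] a2_bound[OF t]]
    obtain g1 g2 where "\<forall>x. ((\<lambda>x. sqrt (abar x t)) has_real_derivative g1 x) (at x) \<and> (g1 has_real_derivative g2 x) (at x)
      \<and> \<bar>g1 x\<bar> \<le> C1 \<and> \<bar>g2 x\<bar> \<le> C2" unfolding C1_def C2_def by blast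
    thus ?thesis using L by (meson order_trans)
  qed
  have beta: "((\<lambda>x. r - abar x t / 2) has_real_derivative - (a1 x t / 2)) (at x)"
      "((\<lambda>x. - (a1 x t / 2)) has_real_derivative - (a2 x t / 2)) (at x)"
      "\<bar>- (a1 x t / 2)\<bar> \<le> L" "\<bar>- (a2 x t / 2)\<bar> \<le> L" if t: "t \<in> {0<..T}" for x t
    using DERIV_diff[OF DERIV_const DERIV_cdivide[OF da[OF t]], of r 2 x] DERIV_minus[OF DERIV_cdivide[OF da1[OF t]], of 2 x]
      a1_bound[OF t, of x] a2_bound[OF t, of x] L(1,4) by simp_all
  have "coupled_coefficients T L (\<lambda>x t. sqrt (abar x t)) (\<lambda>x t. r - abar x t / 2)"
  proof
    show "0 \<le> L" by (rule L)
    fix x y m t assume t: "t \<in> {0<..T}"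
    obtain g1 g2 where g: "\<And>x. ((\<lambda>x. sqrt (abar x t)) has_real_derivative g1 x) (at x)" "\<And>x. (g1 has_real_derivative g2 x) (at x)"
      "\<And>x. \<bar>g1 x\<bar> \<le> L" "\<And>x. \<bar>g2 x\<bar> \<le> L" using sigma[OF t] by blast
    have e: "a_minus \<le> abar x t" "abar x t \<le> a_plus" using elliptic[of t x] t by auto
    show "\<bar>sqrt (abar x t)\<bar> \<le> L"
      using e a_minus_pos order_trans[OF real_sqrt_le_mono[OF e(2)] L(5)] by simp
    show "\<bar>r - abar x t / 2\<bar> \<le> L"
      using e a_minus_pos L(6) by linarith
    show "\<bar>sqrt (abar x t) - sqrt (abar y t)\<bar> \<le> L * \<bar>x - y\<bar>"
      by (rule lipschitz_of_bounded_derivative[OF g(1,3)])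
    show "\<bar>(r - abar x t / 2) - (r - abar y t / 2)\<bar> \<le> L * \<bar>x - y\<bar>"
      by (rule lipschitz_of_bounded_derivative[OF beta(1,3)[OF t]])
    show "\<bar>sqrt (abar x t) + sqrt (abar y t) - 2 * sqrt (abar m t)\<bar> \<le> L * (\<bar>x + y - 2 * m\<bar> + (x - y)\<^sup>2)"
      by (rule three[OF g])
    show "\<bar>(r - abar x t / 2) + (r - abar y t / 2) - 2 * (r - abar m t / 2)\<bar> \<le> L * (\<bar>x + y - 2 * m\<bar> + (x - y)\<^sup>2)"
      by (rule three[OF beta[OF t]])
  qed
  thus ?thesis ..
qed

section \<open>Comparison and derivative estimates for the remainder\<close>

context
  fixes u :: "real \<Rightarrow> real \<Rightarrow> real"
  assumes u_growth: "growth_class T u"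
    and u_eq: "\<And>x t. t \<in> {0<..T} \<Longrightarrow> log_operator T r abar u x t = 0"
    and u_init: "\<And>x. u x 0 = max (exp x - 1) 0"
    and comparison: "comparison_principle T r abar"
begin

text \<open>Comparison is applied to the whole price \<open>u\<close> against \<open>ansatz\<close>
  plus and minus a barrier. The operator maps \<open>t powr (1 + \<gamma>) * exp (|r| t)\<close> to
  at least \<open>t powr \<gamma>\<close>, so the constant \<open>C\<close> of the residual itself
  serves as barrier height.\<close>

lemma remainder_bound:
  "\<exists>M\<ge>0. \<forall>x. \<forall>t\<in>{0..T}. \<bar>u x t - ansatz x t\<bar> \<le> M * t powr (1 + \<gamma>)"
proof -
  obtain C where C: "C \<ge> 0" "\<And>x t. t \<in> {0<..T} \<Longrightarrow> \<bar>q x t * residual_factor x t\<bar> \<le> C * t powr \<gamma>"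
    using residual_bounds by blast
  define e where "e t = ((1 + \<gamma>) * t powr \<gamma> + (\<bar>r\<bar> + r) * t powr (1 + \<gamma>)) * exp (\<bar>r\<bar> * t)" for t
  have e: "C * e t \<ge> C * t powr \<gamma>" if "t \<in> {0<..T}" for t
  proof -
    have "1 * t powr \<gamma> \<le> (1 + \<gamma>) * t powr \<gamma>" using \<gamma> by (intro mult_right_mono) auto
    moreover have "0 \<le> (\<bar>r\<bar> + r) * t powr (1 + \<gamma>)" by (intro mult_nonneg_nonneg) auto
    ultimately have le: "t powr \<gamma> \<le> (1 + \<gamma>) * t powr \<gamma> + (\<bar>r\<bar> + r) * t powr (1 + \<gamma>)" by linarith
    have "t powr \<gamma> * 1 \<le> e t" unfolding e_def
      by (rule mult_mono[OF le]) (use that le powr_ge_zero[of t \<gamma>] in \<open>auto intro: order_trans[OF powr_ge_zero le]\<close>)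
    thus ?thesis using C(1) by (simp add: mult_left_mono)
  qed
  have init: "u x 0 = ansatz x 0 + M * (0 powr (1 + \<gamma>) * exp (\<bar>r\<bar> * 0))" for x M
    unfolding ansatz_def u_init by (simp add: c_def lead_def)
  have upper: "u x t \<le> ansatz x t + C * (t powr (1 + \<gamma>) * exp (\<bar>r\<bar> * t))" if "t \<in> {0..T}" for x t
  proof -
    have "\<forall>x. \<forall>t\<in>{0<..T}. log_operator T r abar u x t
        \<le> log_operator T r abar (\<lambda>x t. ansatz x t + C * (t powr (1 + \<gamma>) * exp (\<bar>r\<bar> * t))) x t"
    proof (intro allI ballI)
      fix x t assume t: "t \<in> {0<..T}"
      show "log_operator T r abar u x t
        \<le> log_operator T r abar (\<lambda>x t. ansatz x t + C * (t powr (1 + \<gamma>) * exp (\<bar>r\<bar> * t))) x t"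
        unfolding u_eq[OF t] barrier_growth(2)[OF t] e_def[symmetric]
        using C(2)[OF t, of x] e[OF t] by linarith
    qed
    thus ?thesis
      using comparison[unfolded comparison_principle_def, rule_format, OF u_growth barrier_growth(1)[of C]] init that
      by (metis (no_types, lifting) order_refl)
  qed
  have lower: "ansatz x t + (- C) * (t powr (1 + \<gamma>) * exp (\<bar>r\<bar> * t)) \<le> u x t" if "t \<in> {0..T}" for x t
  proof -
    have "\<forall>x. \<forall>t\<in>{0<..T}. log_operator T r abar (\<lambda>x t. ansatz x t + (- C) * (t powr (1 + \<gamma>) * exp (\<bar>r\<bar> * t))) x t
        \<le> log_operator T r abar u x t"
    proof (intro allI ballI)
      fix x t assume t: "t \<in> {0<..T}"
      show "log_operator T r abar (\<lambda>x t. ansatz x t + (- C) * (t powr (1 + \<gamma>) * exp (\<bar>r\<bar> * t))) x t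
          \<le> log_operator T r abar u x t"
        unfolding u_eq[OF t] barrier_growth(2)[OF t] e_def[symmetric]
        using C(2)[OF t, of x] e[OF t] by linarith
    qed
    thus ?thesis
      using comparison[unfolded comparison_principle_def, rule_format, OF barrier_growth(1)[of "- C"] u_growth] init that
      by (metis (no_types, lifting) order_refl)
  qed
  have "\<bar>u x t - ansatz x t\<bar> \<le> (C * exp (\<bar>r\<bar> * T)) * t powr (1 + \<gamma>)" if "t \<in> {0..T}" for x t
  proof -
    have "\<bar>u x t - ansatz x t\<bar> \<le> C * (t powr (1 + \<gamma>) * exp (\<bar>r\<bar> * t))"
      using upper[OF that, of x] lower[OF that, of x] by linarith
    also have "\<dots> \<le> C * (t powr (1 + \<gamma>) * exp (\<bar>r\<bar> * T))"
      using that C(1) by (intro mult_left_mono) (auto intro!: mult_left_mono)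
    finally show ?thesis by (simp add: mult_ac)
  qed
  moreover have "C * exp (\<bar>r\<bar> * T) \<ge> 0" using C(1) by simp
  ultimately show ?thesis by blast
qed

lemma remainder_derivative_bounds:
  "\<exists>C\<ge>0. \<forall>x. \<forall>t\<in>{0<..T}. \<bar>u x t - ansatz x t\<bar> \<le> C * t powr (1 + \<gamma>) \<and>
     \<bar>d_space u x t - ansatz_x x t\<bar> \<le> C * t powr (1/2 + \<gamma>) \<and>
     \<bar>d_space (d_space u) x t - ansatz_xx x t\<bar> \<le> C * t powr \<gamma>"
proof -
  obtain M where M: "M \<ge> 0" "\<And>x t. t \<in> {0..T} \<Longrightarrow> \<bar>u x t - ansatz x t\<bar> \<le> M * t powr (1 + \<gamma>)"
    using remainder_bound by blast
  obtain R1 R2 C where C: "0 \<le> C" and R: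
    "\<And>x t. t \<in> {0<..T} \<Longrightarrow> ((\<lambda>x. q x t * residual_factor x t) has_real_derivative R1 x t) (at x)"
    "\<And>x t. t \<in> {0<..T} \<Longrightarrow> ((\<lambda>x. R1 x t) has_real_derivative R2 x t) (at x)"
    "\<And>x t. t \<in> {0<..T} \<Longrightarrow> \<bar>R1 x t\<bar> \<le> C * t powr (\<gamma> - 1/2)"
    "\<And>x t. t \<in> {0<..T} \<Longrightarrow> \<bar>R2 x t\<bar> \<le> C * t powr (\<gamma> - 1)"
    using residual_bounds by blast
  obtain L where "coupled_coefficients T L (\<lambda>x t. sqrt (abar x t)) (\<lambda>x t. r - abar x t / 2)"
    using coefficients_coupled by blast
  then interpret cc: coupled_coefficients T L "\<lambda>x t. sqrt (abar x t)" "\<lambda>x t. r - abar x t / 2" .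
  \<comment> \<open>\<open>R1\<close> obeys the better power \<open>\<gamma> - 1/2\<close>; the
    factor \<open>T powr (1/2)\<close> converts it to the power \<open>\<gamma> - 1\<close> that the
    three-point hypothesis demands of both derivatives.\<close>
  define H where "H = C * T powr (1/2) + C"
  have H: "0 \<le> H" using C unfolding H_def by simp
  have dx: "((\<lambda>x. u x t - ansatz x t) has_real_derivative d_space u x t - ansatz_x x t) (at x)"
    and dxx: "((\<lambda>x. d_space u x t - ansatz_x x t) has_real_derivative d_space (d_space u) x t - ansatz_xx x t) (at x)"
    and dt: "((\<lambda>t. u x t - ansatz x t) has_real_derivative d_time T u x t - ansatz_t x t) (at t within {0..T})"
    if "t \<in> {0<..T}" for x t
    by (intro DERIV_diff growth_classD[OF u_growth that] ansatz_derivs[OF that])+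
  have "\<exists>D\<ge>0. \<forall>x. \<forall>t\<in>{0<..T}. \<bar>d_space (d_space u) x t - ansatz_xx x t\<bar> \<le> D * t powr \<gamma>"
  proof (rule cc.second_derivative_bound[where z = "\<lambda>x t. u x t - ansatz x t" and zx = "\<lambda>x t. d_space u x t - ansatz_x x t"
        and zt = "\<lambda>x t. d_time T u x t - ansatz_t x t" and R = "\<lambda>x t. q x t * residual_factor x t" and r = r
        and B = "M * T powr (1 + \<gamma>)", OF \<gamma>(1) H _ _ _ dt dx dxx])
    have "continuous_on (UNIV \<times> {0..T}) (\<lambda>(x, t). u x t)" using u_growth unfolding growth_class_def by blast
    from continuous_on_diff[OF this ansatz_cont]
    show "continuous_on (UNIV \<times> {0..T}) (\<lambda>(x, t). u x t - ansatz x t)" by (simp add: split_def)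
    show "\<bar>u x t - ansatz x t\<bar> \<le> M * T powr (1 + \<gamma>)" if "t \<in> {0..T}" for x t
      using order_trans[OF M(2)[OF that] mult_left_mono[OF powr_mono2 M(1)]] that \<gamma> by simp
    show "u x 0 - ansatz x 0 = 0" for x unfolding ansatz_def u_init by (simp add: c_def lead_def)
    show "d_time T u x t - ansatz_t x t = (sqrt (abar x t))\<^sup>2 * (d_space (d_space u) x t - ansatz_xx x t) / 2
        + (r - abar x t / 2) * (d_space u x t - ansatz_x x t) - r * (u x t - ansatz x t) + q x t * residual_factor x t"
      if "t \<in> {0<..T}" for x t
    proof -
      have "0 \<le> abar x t" using elliptic[of t x] a_minus_pos that by simp
      hence sq: "(sqrt (abar x t))\<^sup>2 = abar x t" by simp
      have ut: "d_time T u x t = abar x t / 2 * d_space (d_space u) x t + (r - abar x t / 2) * d_space u x t - r * u x t"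
        using u_eq[OF that, of x] unfolding log_operator_def by simp
      show ?thesis unfolding sq ut ansatz_equation[of x t] by (simp add: field_simps)
    qed
    show "\<bar>q x t * residual_factor x t + q y t * residual_factor y t - 2 * (q m t * residual_factor m t)\<bar>
        \<le> H * t powr (\<gamma> - 1) * (\<bar>x + y - 2 * m\<bar> + (x - y)\<^sup>2)" if t: "t \<in> {0<..T}" for x y m t
    proof -
      have "t powr (\<gamma> - 1/2) = t powr (1/2) * t powr (\<gamma> - 1)" by (simp flip: powr_add)
      also have "\<dots> \<le> T powr (1/2) * t powr (\<gamma> - 1)" using t by (intro mult_right_mono powr_mono2) auto
      finally have "C * t powr (\<gamma> - 1/2) \<le> C * (T powr (1/2) * t powr (\<gamma> - 1))" using C by (rule mult_left_mono)
      also have "\<dots> \<le> H * t powr (\<gamma> - 1)" unfolding H_def using C by (simp add: distrib_right)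
      finally have 1: "C * t powr (\<gamma> - 1/2) \<le> H * t powr (\<gamma> - 1)" .
      have 2: "C * t powr (\<gamma> - 1) \<le> H * t powr (\<gamma> - 1)" unfolding H_def using C by (simp add: distrib_right)
      have "\<bar>q x t * residual_factor x t + q y t * residual_factor y t - 2 * (q m t * residual_factor m t)\<bar>
          \<le> H * t powr (\<gamma> - 1) * \<bar>x + y - 2 * m\<bar> + H * t powr (\<gamma> - 1) * (x - y)\<^sup>2"
        by (rule three_point_of_bounded_derivatives[OF R(1,2)[OF t] order_trans[OF R(3)[OF t] 1] order_trans[OF R(4)[OF t] 2]])
      thus ?thesis by (simp only: distrib_left)
    qed
  qed
  then obtain D where D: "D \<ge> 0" "\<And>x t. t \<in> {0<..T} \<Longrightarrow> \<bar>d_space (d_space u) x t - ansatz_xx x t\<bar> \<le> D * t powr \<gamma>"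
    by blast
  define E where "E = 2 * M + D"
  have E: "E \<ge> 0" "M \<le> E" "D \<le> E" using M(1) D(1) unfolding E_def by simp_all
  have "\<bar>u x t - ansatz x t\<bar> \<le> E * t powr (1 + \<gamma>) \<and> \<bar>d_space u x t - ansatz_x x t\<bar> \<le> E * t powr (1/2 + \<gamma>) \<and>
     \<bar>d_space (d_space u) x t - ansatz_xx x t\<bar> \<le> E * t powr \<gamma>" if t: "t \<in> {0<..T}" for x t
  proof (intro conjI)
    have t': "t \<in> {0..T}" "t > 0" using t by auto
    show "\<bar>u x t - ansatz x t\<bar> \<le> E * t powr (1 + \<gamma>)"
      by (rule order_trans[OF M(2)[OF t'(1)] mult_right_mono[OF E(2)]]) simp
    show "\<bar>d_space (d_space u) x t - ansatz_xx x t\<bar> \<le> E * t powr \<gamma>"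
      by (rule order_trans[OF D(2)[OF t] mult_right_mono[OF E(3)]]) simp
    \<comment> \<open>The step \<open>h = t powr (1/2)\<close> balances both terms at
      \<open>t powr (1/2 + \<gamma>)\<close>.\<close>
    have "\<bar>d_space u x t - ansatz_x x t\<bar> \<le> 2 * (M * t powr (1 + \<gamma>)) / t powr (1/2) + D * t powr \<gamma> * t powr (1/2)"
      by (rule first_derivative_interpolation[OF dx[OF t] dxx[OF t] M(2)[OF t'(1)] D(2)[OF t]]) (use t' in simp)
    also have "t powr (1 + \<gamma>) = t powr (1/2 + \<gamma>) * t powr (1/2)" by (simp flip: powr_add)
    also have "D * t powr \<gamma> * t powr (1/2) = D * t powr (1/2 + \<gamma>)" by (simp add: powr_add)
    also have "2 * (M * (t powr (1/2 + \<gamma>) * t powr (1/2))) / t powr (1/2) = 2 * M * t powr (1/2 + \<gamma>)"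
      using t'(2) by simp
    finally show "\<bar>d_space u x t - ansatz_x x t\<bar> \<le> E * t powr (1/2 + \<gamma>)"
      unfolding E_def by (simp only: distrib_right)
  qed
  with E(1) show ?thesis by blast
qed

end

end

section \<open>Limits in parabolic scaling\<close>

lemma powr_tendsto_0: "0 < p \<Longrightarrow> ((\<lambda>t::real. t powr p) \<longlongrightarrow> 0) (at_right 0)"
  using tendsto_powr'[OF tendsto_ident_at tendsto_const, of 0 p "{0<..}"]
  by (simp add: eventually_at_right_less order.strict_implies_order eventually_mono[OF eventually_at_right_less])

text \<open>A negative power is inverted, which is allowed for a nonzero limit, so both signs reduce
  to a positive power tending to 0.\<close>

lemma powr_limit_exponent:
  fixes p k :: real
  assumes lim: "((\<lambda>t. t powr p) \<longlongrightarrow> k) (at_right 0)" and k: "k \<noteq> 0"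
  shows "p = 0"
proof (rule ccontr)
  assume "p \<noteq> 0"
  then consider "p > 0" | "p < 0" by linarith
  thus False
  proof cases
    case 1
    from tendsto_unique[OF _ lim powr_tendsto_0[OF 1]] k show False by simp
  next
    case 2
    have "((\<lambda>t. inverse (t powr p)) \<longlongrightarrow> inverse k) (at_right 0)" by (rule tendsto_inverse[OF lim k])
    hence "((\<lambda>t. t powr (- p)) \<longlongrightarrow> inverse k) (at_right 0)" by (simp add: powr_minus)
    from tendsto_unique[OF _ this powr_tendsto_0] 2 k show False by simp
  qed
qed

text \<open>The quotient of the two normalised quantities is a constant multiple of
  \<open>t powr (1 - p)\<close>, which has a nonzero limit only for exponent 0. Dividing is
  legitimate because \<open>m \<noteq> 0\<close> keeps \<open>f\<close> away from 0
  eventually.\<close>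

lemma scaled_limit_exponent:
  fixes f :: "real \<Rightarrow> real"
  assumes K: "0 < K" and T: "0 < T" and lim: "((\<lambda>t. f t / (K * t)) \<longlongrightarrow> m) (at_right 0)" and m: "m \<noteq> 0"
  shows "(\<exists>k. k \<noteq> 0 \<and> ((\<lambda>t. f t / (t / T) powr p) \<longlongrightarrow> k) (at_right 0)) \<longleftrightarrow> p = 1"
proof
  assume "\<exists>k. k \<noteq> 0 \<and> ((\<lambda>t. f t / (t / T) powr p) \<longlongrightarrow> k) (at_right 0)"
  then obtain k where k: "k \<noteq> 0" "((\<lambda>t. f t / (t / T) powr p) \<longlongrightarrow> k) (at_right 0)" by blast
  have "((\<lambda>t. (f t / (t / T) powr p) / (f t / (K * t)) / (K * T powr p)) \<longlongrightarrow> k / m / (K * T powr p)) (at_right 0)"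
    using K T by (intro tendsto_divide k lim m tendsto_const) simp
  moreover have "\<forall>\<^sub>F t in at_right 0. (f t / (t / T) powr p) / (f t / (K * t)) / (K * T powr p) = t powr (1 - p)"
    using tendsto_imp_eventually_ne[OF lim m] eventually_at_right_less[of "0::real"]
  proof eventually_elim
    case (elim t)
    hence "f t \<noteq> 0" by auto
    hence "(f t / (v / w)) / (f t / (K * t)) / (K * w) = t / v" if "w \<noteq> 0" "v \<noteq> 0" for v w
      using that K elim by (simp add: field_simps)
    from this[of "T powr p" "t powr p"] show ?case using elim T by (simp add: powr_divide powr_diff)
  qed
  ultimately have "((\<lambda>t. t powr (1 - p)) \<longlongrightarrow> k / m / (K * T powr p)) (at_right 0)"
    by (rule Lim_transform_eventually)
  hence "1 - p = 0" by (rule powr_limit_exponent) (use k m K T in simp)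
  thus "p = 1" by simp
next
  assume p: "p = 1"
  have "((\<lambda>t. f t / (K * t) * (K * T)) \<longlongrightarrow> m * (K * T)) (at_right 0)"
    by (intro tendsto_mult lim tendsto_const)
  moreover have "\<forall>\<^sub>F t in at_right 0. f t / (K * t) * (K * T) = f t / (t / T) powr p"
    using eventually_at_right_less[of "0::real"] by eventually_elim (use K T in \<open>simp add: p\<close>)
  ultimately have "((\<lambda>t. f t / (t / T) powr p) \<longlongrightarrow> m * (K * T)) (at_right 0)"
    by (rule Lim_transform_eventually)
  thus "\<exists>k. k \<noteq> 0 \<and> ((\<lambda>t. f t / (t / T) powr p) \<longlongrightarrow> k) (at_right 0)"
    using m K T by (intro exI[of _ "m * (K * T)"]) simp
qed

section \<open>Passage between spot and log-moneyness\<close>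

lemma log_coordinate_derivative:
  fixes F f :: "real \<Rightarrow> real"
  assumes K: "0 < K" and s: "0 < s" and eq: "\<And>z. 0 < z \<Longrightarrow> F z = f (ln (z / K))"
    and d: "(f has_real_derivative d) (at (ln (s / K)))"
  shows "(F has_real_derivative d / s) (at s)"
proof -
  have "((\<lambda>z. ln (z / K)) has_real_derivative 1 / s) (at s)"
    using K s by (auto intro!: derivative_eq_intros)
  from DERIV_chain2[OF d this] have "((\<lambda>z. f (ln (z / K))) has_real_derivative d / s) (at s)" by simp
  thus ?thesis
    by (rule has_field_derivative_transform_within_open[of _ _ _ "{0<..}"]) (use s eq in auto)
qed

text \<open>The first spot derivative is again a function of the log coordinate, namely
  \<open>f1 x * exp (- x)\<close>, so the same chain rule serves a second time.\<close>

lemma log_coordinate_derivatives: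
  fixes F f f1 f2 :: "real \<Rightarrow> real"
  assumes K: "0 < K" and eq: "\<And>z. 0 < z \<Longrightarrow> F z = K * f (ln (z / K))"
    and d1: "\<And>x. (f has_real_derivative f1 x) (at x)" and d2: "\<And>x. (f1 has_real_derivative f2 x) (at x)"
  shows "deriv F (K * exp x) = f1 x / exp x"
    and "deriv (deriv F) (K * exp x) = (f2 x - f1 x) / (K * (exp x)\<^sup>2)"
proof -
  have D1: "deriv F z = K * f1 (ln (z / K)) / z" if "0 < z" for z
    by (rule DERIV_imp_deriv, rule log_coordinate_derivative[OF K that, where f = "\<lambda>x. K * f x"])
       (auto simp: eq intro!: DERIV_cmult d1)
  have "deriv F (K * exp x) = K * f1 (ln (K * exp x / K)) / (K * exp x)" using K by (intro D1) simp
  thus "deriv F (K * exp x) = f1 x / exp x" using K by simp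
  have "deriv (deriv F) (K * exp x) = (f2 x * exp (- x) + (- exp (- x)) * f1 x) / (K * exp x)"
  proof (rule DERIV_imp_deriv, rule log_coordinate_derivative[OF K, where f = "\<lambda>x. f1 x * exp (- x)"])
    show "0 < K * exp x" using K by simp
    show "deriv F z = f1 (ln (z / K)) * exp (- ln (z / K))" if "0 < z" for z
      using D1[OF that] that K by (simp add: exp_minus exp_ln)
    have "((\<lambda>x. f1 x * exp (- x)) has_real_derivative f2 x * exp (- x) + (- exp (- x)) * f1 x) (at x)"
      by (intro DERIV_mult d2) (auto intro!: derivative_eq_intros)
    thus "((\<lambda>x. f1 x * exp (- x)) has_real_derivative f2 x * exp (- x) + (- exp (- x)) * f1 x) (at (ln (K * exp x / K)))"
      using K by simp
  qed
  also have "\<dots> = (f2 x - f1 x) / (K * (exp x)\<^sup>2)"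
    by (simp add: exp_minus power2_eq_square field_simps)
  finally show "deriv (deriv F) (K * exp x) = (f2 x - f1 x) / (K * (exp x)\<^sup>2)" .
qed

text \<open>The sign comes from time reversal and the factor \<open>K\<close> from the normalisation
  of the price; the term \<open>d_space (d_space u) - d_space u\<close> in the spot gamma accounts
  for the drift \<open>r - abar / 2\<close>.\<close>

lemma pricing_operator_log_coordinates:
  fixes V a :: "real \<Rightarrow> real \<Rightarrow> real"
  assumes K: "0 < K" and T: "0 < T" and gc: "growth_class T (log_price K T V)" and \<tau>: "\<tau> \<in> {0<..T}"
  shows "pricing_operator T r a V (K * exp x) (T - \<tau>) = - K * log_operator T r (log_variance K T a) (log_price K T V) x \<tau>"
proof -
  define u where "u = log_price K T V"
  have V_eq: "V z t = K * u (ln (z / K)) (T - t)" if "0 < z" for z t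
    unfolding u_def log_price_def using that K by simp
  have sx: "0 < K * exp x" using K by simp
  note D = growth_classD[OF gc \<tau>, folded u_def]
  have VS: "d_space V (K * exp x) (T - \<tau>) = d_space u x \<tau> / exp x"
    unfolding d_space_def[of V]
    by (rule log_coordinate_derivatives(1)[OF K, where f = "\<lambda>x. u x \<tau>" and ?f2.0 = "\<lambda>x. d_space (d_space u) x \<tau>"])
       (auto simp: V_eq intro!: D)
  have VSS: "d_space (d_space V) (K * exp x) (T - \<tau>)
      = (d_space (d_space u) x \<tau> - d_space u x \<tau>) / (K * (exp x)\<^sup>2)"
    unfolding d_space_def[of "d_space V"] unfolding d_space_def[of V, abs_def]
    by (rule log_coordinate_derivatives(2)[OF K, where f = "\<lambda>x. u x \<tau>"])
       (auto simp: V_eq intro!: D)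
  have Vt: "d_time T V (K * exp x) (T - \<tau>) = - K * d_time T u x \<tau>"
  proof -
    \<comment> \<open>Time reversal maps the interval onto itself, so the one-sided derivative at
      \<open>\<tau> = T\<close> corresponds to the one at calendar time 0.\<close>
    have im: "(\<lambda>t. T - t) ` {0..T} = {0..T}" by (force simp: image_iff intro: bexI[of _ "T - _"])
    have "((u x \<circ> (\<lambda>t. T - t)) has_real_derivative d_time T u x \<tau> * (0 - 1)) (at (T - \<tau>) within {0..T})"
      by (rule DERIV_image_chain) (use D(1)[of x] in \<open>auto simp: im intro!: derivative_eq_intros\<close>)
    from DERIV_cmult[OF this, of K]
    have "((\<lambda>t. K * u x (T - t)) has_real_derivative - K * d_time T u x \<tau>) (at (T - \<tau>) within {0..T})"
      by (simp add: o_def)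
    moreover have "V (K * exp x) = (\<lambda>t. K * u x (T - t))"
      using V_eq[OF sx] K by (simp add: fun_eq_iff)
    ultimately show ?thesis
      unfolding d_time_def[of T V]
      using vector_derivative_within_cbox[of 0 T "T - \<tau>" "V (K * exp x)" "- K * d_time T u x \<tau>"] T \<tau>
      by (simp add: has_real_derivative_iff_has_vector_derivative)
  qed
  have V0: "V (K * exp x) (T - \<tau>) = K * u x \<tau>" using V_eq[OF sx] K by simp
  have e: "w1 * (K * exp x)\<^sup>2 * (w / (K * (exp x)\<^sup>2)) = w1 * (K * w)" "w1 * (K * exp x) * (w / exp x) = w1 * (K * w)" for w w1
    using K by (simp_all add: power2_eq_square)
  show ?thesis
    unfolding pricing_operator_def log_operator_def log_variance_def u_def[symmetric] VS VSS Vt V0 e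
    by (simp add: algebra_simps)
qed

section \<open>Limits along \<open>x = y * sqrt t\<close>\<close>

context strike_variance
begin

lemma eventually_in_interval: "\<forall>\<^sub>F t in at_right 0. t \<in> {0<..T}"
  using T_pos by (auto simp: eventually_at_right_field)

lemma sqrt_tendsto_0: "((\<lambda>t::real. sqrt t) \<longlongrightarrow> 0) (at_right 0)"
  using tendsto_real_sqrt[OF tendsto_ident_at, of 0 "{0<..}"] by simp

text \<open>The shift of the centre is \<open>O(t)\<close>, hence negligible against
  \<open>sqrt t\<close>; neither the rate nor the convexity term reaches the limits.\<close>

lemma \<xi>_scaled_tendsto: "((\<lambda>t. \<xi> (y * sqrt t) t / sqrt t) \<longlongrightarrow> y) (at_right 0)"
proof -
  have "((\<lambda>t. y + r * sqrt t - A t / t * sqrt t / 2) \<longlongrightarrow> y + r * 0 - \<alpha> 0 * 0 / 2) (at_right 0)"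
    by (intro tendsto_intros sqrt_tendsto_0 A_over_tendsto) simp
  moreover have "\<forall>\<^sub>F t in at_right 0. y + r * sqrt t - A t / t * sqrt t / 2 = \<xi> (y * sqrt t) t / sqrt t"
    using eventually_at_right_less[of "0::real"]
  proof eventually_elim
    case (elim t)
    have "\<xi> (y * sqrt t) t / sqrt t = y + r * (t / sqrt t) - A t / sqrt t / 2"
      using elim unfolding \<xi>_def by (simp add: add_divide_distrib diff_divide_distrib)
    also have "t / sqrt t = sqrt t" using elim by (simp add: real_div_sqrt)
    also have "A t / sqrt t = A t / t * sqrt t"
    proof -
      have "w / h = w / (h * h) * h" if "h > 0" for w h :: real using that by simp
      from this[of "sqrt t" "A t"] elim show ?thesis by simp
    qed
    finally show ?case by simp
  qed
  ultimately have "((\<lambda>t. \<xi> (y * sqrt t) t / sqrt t) \<longlongrightarrow> y + r * 0 - \<alpha> 0 * 0 / 2) (at_right 0)"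
    by (rule Lim_transform_eventually)
  thus ?thesis by simp
qed

lemma \<alpha>_0_pos: "0 < \<alpha> 0"
  using \<alpha>_bounds[of 0] a_minus_pos T_pos by simp

lemma q_scaled_tendsto: "((\<lambda>t. sqrt t * q (y * sqrt t) t) \<longlongrightarrow> gauss_density (\<alpha> 0) y) (at_right 0)"
proof -
  have "((\<lambda>t. exp (- r * t) / sqrt (2 * pi * (A t / t)) * exp (- ((\<xi> (y * sqrt t) t / sqrt t)\<^sup>2 / (2 * (A t / t)))))
      \<longlongrightarrow> exp (- r * 0) / sqrt (2 * pi * \<alpha> 0) * exp (- (y\<^sup>2 / (2 * \<alpha> 0)))) (at_right 0)"
    using \<alpha>_0_pos by (intro tendsto_intros A_over_tendsto \<xi>_scaled_tendsto tendsto_ident_at) simp_all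
  moreover have "\<forall>\<^sub>F t in at_right 0. exp (- r * t) / sqrt (2 * pi * (A t / t)) * exp (- ((\<xi> (y * sqrt t) t / sqrt t)\<^sup>2 / (2 * (A t / t))))
      = sqrt t * q (y * sqrt t) t"
    using eventually_in_interval
  proof eventually_elim
    case (elim t)
    have "(\<xi> (y * sqrt t) t / sqrt t)\<^sup>2 / (2 * (A t / t)) = (\<xi> (y * sqrt t) t)\<^sup>2 / (2 * A t)"
      using elim by (simp add: power_divide)
    moreover have "sqrt (2 * pi * (A t / t)) = sqrt (2 * pi * A t) / sqrt t"
      by (simp only: times_divide_eq_right real_sqrt_divide)
    ultimately show ?case unfolding q_def by simp
  qed
  ultimately have "((\<lambda>t. sqrt t * q (y * sqrt t) t)
      \<longlongrightarrow> exp (- r * 0) / sqrt (2 * pi * \<alpha> 0) * exp (- (y\<^sup>2 / (2 * \<alpha> 0)))) (at_right 0)"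
    by (rule Lim_transform_eventually)
  moreover have "(2 * pi * \<alpha> 0) powr (- 1/2) = 1 / sqrt (2 * pi * \<alpha> 0)"
  proof -
    have h: "(- 1/2 :: real) = - (1/2)" by simp
    show ?thesis unfolding h powr_minus_divide using \<alpha>_0_pos by (subst powr_half_sqrt) simp_all
  qed
  ultimately show ?thesis unfolding gauss_density_def by simp
qed

lemma lead_scaled_tendsto:
  fixes k y :: real
  defines "g \<equiv> gauss_density (\<alpha> 0) y" and "a \<equiv> \<alpha> 0"
  shows "((\<lambda>t. lead k (y * sqrt t) t / t) \<longlongrightarrow> k * a * y * g) (at_right 0)"
    and "((\<lambda>t. lead_x k (y * sqrt t) t / sqrt t) \<longlongrightarrow> k * (a - y\<^sup>2) * g) (at_right 0)"
    and "((\<lambda>t. lead_xx k (y * sqrt t) t) \<longlongrightarrow> k * (y ^ 3 * inverse a - 3 * y) * g) (at_right 0)"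
proof -
  \<comment> \<open>Scale-free quantities with finite limits. In terms of them each scaled corrector
    derivative is a fixed rational expression, all powers of \<open>sqrt t\<close>
    cancelling.\<close>
  define X Q R where "X t = \<xi> (y * sqrt t) t / sqrt t" and "Q t = sqrt t * q (y * sqrt t) t"
    and "R t = A t / t" for t
  have lims: "(X \<longlongrightarrow> y) (at_right 0)" "(Q \<longlongrightarrow> g) (at_right 0)" "(R \<longlongrightarrow> a) (at_right 0)"
    unfolding X_def Q_def R_def g_def a_def by (rule \<xi>_scaled_tendsto q_scaled_tendsto A_over_tendsto)+
  have a: "a \<noteq> 0" using \<alpha>_0_pos unfolding a_def by simp
  have e: "\<xi> (y * sqrt t) t = sqrt t * X t" "q (y * sqrt t) t = Q t / sqrt t" "A t = sqrt t * sqrt t * R t"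
    "t = sqrt t * sqrt t" "sqrt t > 0"
    if "t > 0" for t
    unfolding X_def Q_def R_def using that by simp_all
  show "((\<lambda>t. lead k (y * sqrt t) t / t) \<longlongrightarrow> k * a * y * g) (at_right 0)"
  proof (rule Lim_transform_eventually)
    show "((\<lambda>t. k * R t * X t * Q t) \<longlongrightarrow> k * a * y * g) (at_right 0)" by (intro tendsto_intros lims)
    show "\<forall>\<^sub>F t in at_right 0. k * R t * X t * Q t = lead k (y * sqrt t) t / t"
      using eventually_at_right_less[of "0::real"]
      by eventually_elim (use e in \<open>simp add: lead_def\<close>)
  qed
  show "((\<lambda>t. lead_x k (y * sqrt t) t / sqrt t) \<longlongrightarrow> k * (a - y\<^sup>2) * g) (at_right 0)"
  proof (rule Lim_transform_eventually)
    show "((\<lambda>t. k * (R t - (X t)\<^sup>2) * Q t) \<longlongrightarrow> k * (a - y\<^sup>2) * g) (at_right 0)" by (intro tendsto_intros lims)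
    show "\<forall>\<^sub>F t in at_right 0. k * (R t - (X t)\<^sup>2) * Q t = lead_x k (y * sqrt t) t / sqrt t"
      using eventually_at_right_less[of "0::real"]
    proof eventually_elim
      case (elim t)
      have "lead_x k (y * sqrt t) t = k * (sqrt t * sqrt t * R t - (sqrt t * X t)\<^sup>2) * (Q t / sqrt t)"
        unfolding lead_x_def e(1,2)[OF elim] using e(3)[OF elim] by simp
      also have "\<dots> = k * (R t - (X t)\<^sup>2) * Q t * sqrt t"
      proof -
        have "k * (h * h * v - (h * w)\<^sup>2) * (p / h) = k * (v - w\<^sup>2) * p * h" if "h > 0" for h v w p :: real
          using that by (simp add: field_simps power2_eq_square)
        from this[OF e(5)[OF elim]] show ?thesis .
      qed
      finally show ?case using e(5)[OF elim] by simp
    qed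
  qed
  show "((\<lambda>t. lead_xx k (y * sqrt t) t) \<longlongrightarrow> k * (y ^ 3 * inverse a - 3 * y) * g) (at_right 0)"
  proof (rule Lim_transform_eventually)
    show "((\<lambda>t. k * ((X t) ^ 3 * inverse (R t) - 3 * X t) * Q t) \<longlongrightarrow> k * (y ^ 3 * inverse a - 3 * y) * g) (at_right 0)"
      by (intro tendsto_intros lims a)
    show "\<forall>\<^sub>F t in at_right 0. k * ((X t) ^ 3 * inverse (R t) - 3 * X t) * Q t = lead_xx k (y * sqrt t) t"
      using eventually_at_right_less[of "0::real"]
    proof eventually_elim
      case (elim t)
      have "lead_xx k (y * sqrt t) t = k * ((sqrt t * X t) ^ 3 * inverse (sqrt t * sqrt t * R t) - 3 * (sqrt t * X t)) * (Q t / sqrt t)"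
        unfolding lead_xx_def e(1,2)[OF elim] using e(3)[OF elim] by simp
      also have "\<dots> = k * ((X t) ^ 3 * inverse (R t) - 3 * X t) * Q t"
      proof -
        have "k * ((h * w) ^ 3 * inverse (h * h * v) - 3 * (h * w)) * (p / h) = k * (w ^ 3 * inverse v - 3 * w) * p"
          if "h > 0" for h v w p :: real
        proof -
          have "(h * w) ^ 3 * inverse (h * h * v) = (h * inverse h) * (h * inverse h) * (h * (w ^ 3 * inverse v))"
            by (simp only: power3_eq_cube inverse_mult_distrib mult_ac)
          hence "(h * w) ^ 3 * inverse (h * h * v) = h * (w ^ 3 * inverse v)" using that by simp
          hence "(h * w) ^ 3 * inverse (h * h * v) - 3 * (h * w) = h * (w ^ 3 * inverse v - 3 * w)"
            by (simp add: right_diff_distrib)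
          thus ?thesis using that by simp
        qed
        from this[OF e(5)[OF elim]] show ?thesis .
      qed
      finally show ?case by simp
    qed
  qed
qed

end

context local_variance
begin

text \<open>Split \<open>u - c = lead + (u - ansatz)\<close>. At each level of differentiation the
  remainder is smaller than the normalisation \<open>t\<close>, \<open>sqrt t\<close> or 1 by the
  factor \<open>t powr \<gamma>\<close>, so the limits are those of the corrector, with
  \<open>amplitude * a = b / 4\<close>.\<close>

lemma scaled_correction_limits:
  fixes u :: "real \<Rightarrow> real \<Rightarrow> real" and y :: real
  assumes u: "growth_class T u" "\<And>x t. t \<in> {0<..T} \<Longrightarrow> log_operator T r abar u x t = 0"
      "\<And>x. u x 0 = max (exp x - 1) 0" "comparison_principle T r abar"
  defines "g \<equiv> gauss_density (abar 0 0) y" and "a \<equiv> abar 0 0"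
  shows "((\<lambda>t. (u (y * sqrt t) t - c (y * sqrt t) t) / t) \<longlongrightarrow> b / 4 * y * g) (at_right 0)"
    and "((\<lambda>t. (d_space u (y * sqrt t) t - exp (y * sqrt t) * std_normal_cdf (dp (y * sqrt t) t)) / sqrt t)
           \<longlongrightarrow> b / 4 * (1 - y\<^sup>2 / a) * g) (at_right 0)"
    and "((\<lambda>t. d_space (d_space u) (y * sqrt t) t
             - (exp (y * sqrt t) * std_normal_cdf (dp (y * sqrt t) t) + q (y * sqrt t) t))
           \<longlongrightarrow> b / 4 * (y ^ 3 / a\<^sup>2 - 3 * y / a) * g) (at_right 0)"
proof -
  obtain C where C: "C \<ge> 0" "\<And>x t. t \<in> {0<..T} \<Longrightarrow> \<bar>u x t - ansatz x t\<bar> \<le> C * t powr (1 + \<gamma>)"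
     "\<And>x t. t \<in> {0<..T} \<Longrightarrow> \<bar>d_space u x t - ansatz_x x t\<bar> \<le> C * t powr (1/2 + \<gamma>)"
     "\<And>x t. t \<in> {0<..T} \<Longrightarrow> \<bar>d_space (d_space u) x t - ansatz_xx x t\<bar> \<le> C * t powr \<gamma>"
    using remainder_derivative_bounds[OF u] by blast
  have C\<gamma>: "((\<lambda>t. C * t powr \<gamma>) \<longlongrightarrow> 0) (at_right 0)"
    using tendsto_mult_left[OF powr_tendsto_0[OF \<gamma>(1)], of C] by simp
  have small: "((\<lambda>t. f t / t powr p) \<longlongrightarrow> 0) (at_right 0)" if f: "\<And>t. t \<in> {0<..T} \<Longrightarrow> \<bar>f t\<bar> \<le> C * t powr (p + \<gamma>)" for f p
  proof (rule Lim_null_comparison[OF _ C\<gamma>])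
    show "\<forall>\<^sub>F t in at_right 0. norm (f t / t powr p) \<le> C * t powr \<gamma>"
      using eventually_in_interval
    proof eventually_elim
      case (elim t)
      have "norm (f t / t powr p) = \<bar>f t\<bar> / t powr p" by simp
      also have "\<dots> \<le> C * t powr (p + \<gamma>) / t powr p" by (intro divide_right_mono f elim) simp
      also have "\<dots> = C * t powr \<gamma>" using elim by (simp add: powr_add)
      finally show ?case .
    qed
  qed
  have a: "a > 0" unfolding a_def by (rule abar_0_pos)
  have la: "amplitude * a = b / 4" unfolding amplitude_def using a by (simp add: a_def)
  note lims = lead_scaled_tendsto[of amplitude y, folded g_def a_def]
  have "((\<lambda>t. lead amplitude (y * sqrt t) t / t + (u (y * sqrt t) t - ansatz (y * sqrt t) t) / t powr 1) \<longlongrightarrow> amplitude * a * y * g + 0) (at_right 0)"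
    by (intro tendsto_add lims(1) small C)
  hence "((\<lambda>t. lead amplitude (y * sqrt t) t / t + (u (y * sqrt t) t - ansatz (y * sqrt t) t) / t powr 1) \<longlongrightarrow> b / 4 * y * g) (at_right 0)"
    unfolding la by simp
  thus "((\<lambda>t. (u (y * sqrt t) t - c (y * sqrt t) t) / t) \<longlongrightarrow> b / 4 * y * g) (at_right 0)"
  proof (rule Lim_transform_eventually)
    show "\<forall>\<^sub>F t in at_right 0. lead amplitude (y * sqrt t) t / t + (u (y * sqrt t) t - ansatz (y * sqrt t) t) / t powr 1
        = (u (y * sqrt t) t - c (y * sqrt t) t) / t"
      using eventually_at_right_less[of "0::real"]
      by eventually_elim (simp add: ansatz_def flip: add_divide_distrib)
  qed
  have "((\<lambda>t. lead_x amplitude (y * sqrt t) t / sqrt t + (d_space u (y * sqrt t) t - ansatz_x (y * sqrt t) t) / t powr (1/2))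
      \<longlongrightarrow> amplitude * (a - y\<^sup>2) * g + 0) (at_right 0)"
    by (intro tendsto_add lims(2) small C)
  moreover have "amplitude * (a - y\<^sup>2) * g + 0 = b / 4 * (1 - y\<^sup>2 / a) * g"
    unfolding la[symmetric] using a by (simp add: right_diff_distrib)
  ultimately have "((\<lambda>t. lead_x amplitude (y * sqrt t) t / sqrt t + (d_space u (y * sqrt t) t - ansatz_x (y * sqrt t) t) / t powr (1/2))
      \<longlongrightarrow> b / 4 * (1 - y\<^sup>2 / a) * g) (at_right 0)" by (simp only:)
  thus "((\<lambda>t. (d_space u (y * sqrt t) t - exp (y * sqrt t) * std_normal_cdf (dp (y * sqrt t) t)) / sqrt t)
           \<longlongrightarrow> b / 4 * (1 - y\<^sup>2 / a) * g) (at_right 0)"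
  proof (rule Lim_transform_eventually)
    show "\<forall>\<^sub>F t in at_right 0. lead_x amplitude (y * sqrt t) t / sqrt t + (d_space u (y * sqrt t) t - ansatz_x (y * sqrt t) t) / t powr (1/2)
        = (d_space u (y * sqrt t) t - exp (y * sqrt t) * std_normal_cdf (dp (y * sqrt t) t)) / sqrt t"
      using eventually_at_right_less[of "0::real"]
      by eventually_elim (simp add: ansatz_x_def powr_half_sqrt flip: add_divide_distrib)
  qed
  have "((\<lambda>t. lead_xx amplitude (y * sqrt t) t + (d_space (d_space u) (y * sqrt t) t - ansatz_xx (y * sqrt t) t) / t powr 0)
      \<longlongrightarrow> amplitude * (y ^ 3 * inverse a - 3 * y) * g + 0) (at_right 0)"
    by (intro tendsto_add lims(3) small) (use C(4) in simp)
  moreover have "amplitude * (y ^ 3 * inverse a - 3 * y) * g + 0 = b / 4 * (y ^ 3 / a\<^sup>2 - 3 * y / a) * g"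
  proof -
    have "a * (y ^ 3 / a\<^sup>2 - 3 * y / a) = y ^ 3 * inverse a - 3 * y"
      using a by (simp add: field_simps power2_eq_square)
    thus ?thesis unfolding la[symmetric] by (simp only: mult.assoc add_0_right)
  qed
  ultimately have "((\<lambda>t. lead_xx amplitude (y * sqrt t) t + (d_space (d_space u) (y * sqrt t) t - ansatz_xx (y * sqrt t) t) / t powr 0)
      \<longlongrightarrow> b / 4 * (y ^ 3 / a\<^sup>2 - 3 * y / a) * g) (at_right 0)" by (simp only:)
  thus "((\<lambda>t. d_space (d_space u) (y * sqrt t) t
             - (exp (y * sqrt t) * std_normal_cdf (dp (y * sqrt t) t) + q (y * sqrt t) t))
           \<longlongrightarrow> b / 4 * (y ^ 3 / a\<^sup>2 - 3 * y / a) * g) (at_right 0)"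
  proof (rule Lim_transform_eventually)
    show "\<forall>\<^sub>F t in at_right 0. lead_xx amplitude (y * sqrt t) t + (d_space (d_space u) (y * sqrt t) t - ansatz_xx (y * sqrt t) t) / t powr 0
        = d_space (d_space u) (y * sqrt t) t
             - (exp (y * sqrt t) * std_normal_cdf (dp (y * sqrt t) t) + q (y * sqrt t) t)"
      using eventually_at_right_less[of "0::real"]
      by eventually_elim (simp add: ansatz_xx_def)
  qed
qed

end

section \<open>From the Hoelder class to the working hypotheses\<close>

lemma Cb_3_1_local_variance:
  assumes T: "0 < T" and a_minus: "0 < a_minus"
    and elliptic: "\<And>x t. t \<in> {0..T} \<Longrightarrow> a_minus \<le> abar x t \<and> abar x t \<le> a_plus"
    and zeta: "0 < \<zeta>" "\<zeta> < 1" and regular: "Cb_3_1 T \<zeta> abar"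
  shows "\<exists>B. local_variance T a_minus a_plus abar (d_space abar) (d_space (d_space abar)) B (d_space abar 0 0) (\<zeta> / 2)"
proof -
  have h: "bounded_continuous_holder T \<zeta> abar" "bounded_continuous_holder T \<zeta> (d_space abar)"
    "bounded_continuous_holder T \<zeta> (d_space (d_space abar))"
  proof -
    have *: "bounded_continuous_holder T \<zeta> ((d_space ^^ j) abar)" if "j \<le> 3" for j
      using regular that unfolding Cb_3_1_def by blast
    show "bounded_continuous_holder T \<zeta> abar" "bounded_continuous_holder T \<zeta> (d_space abar)"
      "bounded_continuous_holder T \<zeta> (d_space (d_space abar))"
      using *[of 0] *[of 1] *[of 2] by (simp_all add: numeral_2_eq_2)
  qed
  have d: "((\<lambda>x. abar x t) has_real_derivative d_space abar x t) (at x)"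
    "((\<lambda>x. d_space abar x t) has_real_derivative d_space (d_space abar) x t) (at x)" if "t \<in> {0..T}" for x t
  proof -
    have *: "(\<lambda>z. (d_space ^^ j) abar z t) differentiable at x" if "j < 3" for j
      using regular that \<open>t \<in> {0..T}\<close> unfolding Cb_3_1_def by blast
    show "((\<lambda>x. abar x t) has_real_derivative d_space abar x t) (at x)"
      using *[of 0] unfolding d_space_def by (simp add: DERIV_deriv_iff_real_differentiable)
    show "((\<lambda>x. d_space abar x t) has_real_derivative d_space (d_space abar) x t) (at x)"
      using *[of 1] unfolding d_space_def[of "d_space abar"] by (simp add: DERIV_deriv_iff_real_differentiable)
  qed
  have bound: "\<exists>B. \<forall>x. \<forall>t\<in>{0..T}. \<bar>f x t\<bar> \<le> B" if "bounded_continuous_holder T \<zeta> f" for f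
  proof -
    have "bounded ((\<lambda>(x, t). f x t) ` (UNIV \<times> {0..T}))" using that unfolding bounded_continuous_holder_def by blast
    then obtain B where B: "\<And>v. v \<in> (\<lambda>(x, t). f x t) ` (UNIV \<times> {0..T}) \<Longrightarrow> norm v \<le> B" unfolding bounded_iff by blast
    have "\<bar>f x t\<bar> \<le> B" if "t \<in> {0..T}" for x t using B[of "f x t"] that by force
    thus ?thesis by blast
  qed
  have time: "\<exists>H. \<forall>t\<in>{0..T}. \<bar>f 0 t - f 0 0\<bar> \<le> H * t powr (\<zeta> / 2)" if "bounded_continuous_holder T \<zeta> f" for f
  proof -
    from that obtain H where H: "\<And>x x' t t'. t \<in> {0..T} \<Longrightarrow> t' \<in> {0..T} \<Longrightarrow>
        \<bar>f x t - f x' t'\<bar> \<le> H * (\<bar>x - x'\<bar> powr \<zeta> + \<bar>t - t'\<bar> powr (\<zeta> / 2))"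
      unfolding bounded_continuous_holder_def parabolic_holder_def by blast
    \<comment> \<open>With both points at the strike the space term is
      \<open>0 powr \<zeta> = 0\<close>.\<close>
    have "\<bar>f 0 t - f 0 0\<bar> \<le> H * t powr (\<zeta> / 2)" if "t \<in> {0..T}" for t
      using H[OF that, of 0 0 0] T that by simp
    thus ?thesis by blast
  qed
  obtain B1 B2 H0 H1 where B: "\<And>x t. t \<in> {0..T} \<Longrightarrow> \<bar>d_space abar x t\<bar> \<le> B1"
      "\<And>x t. t \<in> {0..T} \<Longrightarrow> \<bar>d_space (d_space abar) x t\<bar> \<le> B2"
      "\<And>t. t \<in> {0..T} \<Longrightarrow> \<bar>abar 0 t - abar 0 0\<bar> \<le> H0 * t powr (\<zeta> / 2)"
      "\<And>t. t \<in> {0..T} \<Longrightarrow> \<bar>d_space abar 0 t - d_space abar 0 0\<bar> \<le> H1 * t powr (\<zeta> / 2)"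
    using bound[OF h(2)] bound[OF h(3)] time[OF h(1)] time[OF h(2)] by blast
  define B where "B = \<bar>B1\<bar> + \<bar>B2\<bar> + \<bar>H0\<bar> + \<bar>H1\<bar>"
  have le: "B1 \<le> B" "B2 \<le> B" "H0 \<le> B" "H1 \<le> B" unfolding B_def by linarith+
  have "local_variance T a_minus a_plus abar (d_space abar) (d_space (d_space abar)) B (d_space abar 0 0) (\<zeta> / 2)"
  proof
    have "continuous_on (UNIV \<times> {0..T}) (\<lambda>(x, t). abar x t)"
      using h(1) unfolding bounded_continuous_holder_def by blast
    hence "continuous_on {0..T} (\<lambda>t. (\<lambda>(x, t). abar x t) (0, t))"
      by (rule continuous_on_compose2) (auto intro!: continuous_intros)
    thus "continuous_on {0..T} (abar 0)" by simp
    show "\<bar>d_space abar x t\<bar> \<le> B" if "t \<in> {0<..T}" for x t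
      using order_trans[OF B(1) le(1)] that by simp
    show "\<bar>d_space (d_space abar) x t\<bar> \<le> B" if "t \<in> {0<..T}" for x t
      using order_trans[OF B(2) le(2)] that by simp
    show "\<bar>d_space abar 0 t - d_space abar 0 0\<bar> \<le> B * t powr (\<zeta> / 2)" if "t \<in> {0<..T}" for t
      using order_trans[OF B(4) mult_right_mono[OF le(4)]] that by simp
    show "\<bar>abar 0 t - abar 0 0\<bar> \<le> B * t powr (\<zeta> / 2)" if "t \<in> {0<..T}" for t
      using order_trans[OF B(3) mult_right_mono[OF le(3)]] that by simp
  qed (use T a_minus elliptic zeta d in auto)
  thus ?thesis ..
qed

theorem proposition3p2:
  fixes K T r a_minus a_plus \<zeta> a_star b_star :: real
    and a V W Cref abar :: "real \<Rightarrow> real \<Rightarrow> real"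
    and S :: "real \<Rightarrow> real \<Rightarrow> real"
  assumes contract: "K > 0" "T > 0"
    and abar_eq: "abar = log_variance K T a"
    and elliptic: "0 < a_minus" "\<And>x \<tau>. \<tau> \<in> {0..T} \<Longrightarrow> a_minus \<le> abar x \<tau> \<and> abar x \<tau> \<le> a_plus"
    and lipschitz: "\<exists>L. \<forall>\<tau>\<in>{0..T}. L-lipschitz_on UNIV (\<lambda>x. abar x \<tau>)"
    and pricing: "pricing_problem_well_posed K T r a"
    and correction: "correction_problem_well_posed K T r a"
    and comparison: "comparison_principle T r abar"
    and zeta: "0 < \<zeta>" "\<zeta> < 1"
    and regular: "Cb_3_1 T \<zeta> abar"
    and V_call: "pricing_solution K T r a V"
    and Cref_eq: "Cref = carrier_price K T r a"
    and W_eq: "W = (\<lambda>s t. V s t - Cref s t)"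
    and a_star_eq: "a_star = abar 0 0"
    and b_star_eq: "b_star = d_space abar 0 0"
    and S_eq: "S = (\<lambda>y \<tau>. K * exp (y * sqrt \<tau>))"
  shows "a_star = a K T \<and> b_star = K * d_space a K T \<and>
    (\<forall>y::real.
      ((\<lambda>\<tau>. W (S y \<tau>) (T - \<tau>) / (K * \<tau>))
         \<longlongrightarrow> b_star / 4 * y * gauss_density a_star y) (at_right 0) \<and>
      ((\<lambda>\<tau>. d_space W (S y \<tau>) (T - \<tau>) / sqrt \<tau>)
         \<longlongrightarrow> b_star / 4 * (1 - y\<^sup>2 / a_star) * gauss_density a_star y) (at_right 0) \<and>
      ((\<lambda>\<tau>. K * d_space (d_space W) (S y \<tau>) (T - \<tau>))
         \<longlongrightarrow> b_star / 4 * (y ^ 3 / a_star\<^sup>2 - 3 * y / a_star) * gauss_density a_star y) (at_right 0) \<and>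
      ((\<lambda>\<tau>. sqrt \<tau> * K * d_space (d_space Cref) (S y \<tau>) (T - \<tau>))
         \<longlongrightarrow> gauss_density a_star y) (at_right 0) \<and>
      (b_star * y \<noteq> 0 \<longrightarrow>
        (\<forall>\<alpha>::real.
          (\<exists>l. l \<noteq> 0 \<and> ((\<lambda>\<tau>. W (S y \<tau>) (T - \<tau>) / (\<tau> / T) powr \<alpha>) \<longlongrightarrow> l) (at_right 0))
            \<longleftrightarrow> \<alpha> = 1)))"
proof -
  obtain B where "local_variance T a_minus a_plus abar (d_space abar) (d_space (d_space abar)) B b_star (\<zeta> / 2)"
    using Cb_3_1_local_variance[OF contract(2) elliptic zeta regular] unfolding b_star_eq by blast
  \<comment> \<open>The assumptions of the locale do not mention the rate, so its predicate carries
    no \<open>r\<close>; the interpretation supplies it.\<close>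
  then interpret lv: local_variance T r a_minus a_plus abar "d_space abar" "d_space (d_space abar)" B b_star "\<zeta> / 2" .

  define u where "u = log_price K T V"
  have u_growth: "growth_class T u"
    and V_eqn: "\<And>S t. S > 0 \<Longrightarrow> t \<in> {0..<T} \<Longrightarrow> pricing_operator T r a V S t = 0"
    and V_final: "\<And>S. S > 0 \<Longrightarrow> V S T = max (S - K) 0"
    using V_call unfolding pricing_solution_def u_def by blast+
  have u_eqn: "log_operator T r abar u x \<tau> = 0" if "\<tau> \<in> {0<..T}" for x \<tau>
    using pricing_operator_log_coordinates[OF contract u_growth[unfolded u_def] that, of r a x]
      V_eqn[of "K * exp x" "T - \<tau>"] that contract unfolding u_def abar_eq by simp
  have u_init: "u x 0 = max (exp x - 1) 0" for x
  proof -
    have "max (K * exp x - K) 0 = K * max (exp x - 1) 0"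
      using contract(1) max_mult_distrib_left[of K "exp x - 1" 0] by (simp add: algebra_simps)
    thus ?thesis unfolding u_def log_price_def using V_final[of "K * exp x"] contract(1) by simp
  qed
  note limits = lv.scaled_correction_limits[OF u_growth u_eqn u_init comparison, folded a_star_eq]

  have variance: "total_variance K T a \<tau> = lv.A \<tau>" for \<tau>
  proof -
    have "(\<lambda>s. a K (T - s)) = abar 0" unfolding abar_eq log_variance_def by simp
    thus ?thesis unfolding total_variance_def lv.A_def by simp
  qed
  have Cref_log: "Cref z t = K * lv.c (ln (z / K)) (T - t)" if "0 < z" for z t
  proof (cases "t = T")
    case True
    have "max (z - K) 0 = K * max (z / K - 1) 0"
      using contract(1) max_mult_distrib_left[of K "z / K - 1" 0] by (simp add: algebra_simps)
    thus ?thesis using that contract True unfolding Cref_eq carrier_price_def lv.c_def by simp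
  next
    case False
    have "d_plus K T r a z (T - t) = lv.dp (ln (z / K)) (T - t)" "d_minus K T r a z (T - t) = lv.dm (ln (z / K)) (T - t)"
      unfolding d_plus_def d_minus_def lv.dp_def lv.dm_def lv.\<xi>_def variance by simp_all
    thus ?thesis using that contract False unfolding Cref_eq carrier_price_def lv.c_def
      by (simp add: right_diff_distrib)
  qed
  have W_log: "W z t = K * (u (ln (z / K)) (T - t) - lv.c (ln (z / K)) (T - t))" if "0 < z" for z t
    unfolding W_eq Cref_log[OF that] u_def log_price_def using that contract(1) by (simp add: right_diff_distrib)

  have "a_star = a K T" unfolding a_star_eq abar_eq log_variance_def by simp
  moreover have "b_star = K * d_space a K T"
  proof -
    have "((\<lambda>x. abar x 0) has_real_derivative b_star) (at 0)"
    proof -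
      have "(\<lambda>z. (d_space ^^ 0) abar z 0) differentiable at 0"
        using regular contract(2) unfolding Cb_3_1_def by (meson atLeastAtMost_iff less_imp_le order_refl zero_less_numeral)
      thus ?thesis unfolding b_star_eq d_space_def by (simp add: DERIV_deriv_iff_real_differentiable)
    qed
    \<comment> \<open>At spot \<open>K\<close> the log coordinate is 0, and the chain rule
      contributes \<open>1 / K\<close>.\<close>
    hence "((\<lambda>z. a z T) has_real_derivative b_star / K) (at K)"
      by (intro log_coordinate_derivative[OF contract(1,1), where f = "\<lambda>x. abar x 0"])
         (use contract(1) in \<open>simp_all add: abar_eq log_variance_def\<close>)
    hence "d_space a K T = b_star / K" unfolding d_space_def by (rule DERIV_imp_deriv)
    thus ?thesis using contract(1) by simp
  qed
  moreover have "((\<lambda>\<tau>. W (S y \<tau>) (T - \<tau>) / (K * \<tau>)) \<longlongrightarrow> b_star / 4 * y * gauss_density a_star y) (at_right 0)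
      \<and> ((\<lambda>\<tau>. d_space W (S y \<tau>) (T - \<tau>) / sqrt \<tau>)
         \<longlongrightarrow> b_star / 4 * (1 - y\<^sup>2 / a_star) * gauss_density a_star y) (at_right 0)
      \<and> ((\<lambda>\<tau>. K * d_space (d_space W) (S y \<tau>) (T - \<tau>))
         \<longlongrightarrow> b_star / 4 * (y ^ 3 / a_star\<^sup>2 - 3 * y / a_star) * gauss_density a_star y) (at_right 0)
      \<and> ((\<lambda>\<tau>. sqrt \<tau> * K * d_space (d_space Cref) (S y \<tau>) (T - \<tau>)) \<longlongrightarrow> gauss_density a_star y) (at_right 0)
      \<and> (b_star * y \<noteq> 0 \<longrightarrow> (\<forall>\<alpha>::real.
          (\<exists>l. l \<noteq> 0 \<and> ((\<lambda>\<tau>. W (S y \<tau>) (T - \<tau>) / (\<tau> / T) powr \<alpha>) \<longlongrightarrow> l) (at_right 0)) \<longleftrightarrow> \<alpha> = 1))"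
    for y :: real
  proof -
    define X where "X \<tau> = y * sqrt \<tau>" for \<tau>
    have "((\<lambda>\<tau>. y * sqrt \<tau>) \<longlongrightarrow> y * 0) (at_right 0)" by (intro tendsto_intros lv.sqrt_tendsto_0)
    hence X: "(X \<longlongrightarrow> 0) (at_right 0)" unfolding X_def by simp
    have S_X: "S y \<tau> = K * exp (X \<tau>)" for \<tau> unfolding S_eq X_def ..
    define wx where "wx \<tau> = d_space u (X \<tau>) \<tau> - exp (X \<tau>) * std_normal_cdf (lv.dp (X \<tau>) \<tau>)" for \<tau>
    define wxx where "wxx \<tau> = d_space (d_space u) (X \<tau>) \<tau>
        - (exp (X \<tau>) * std_normal_cdf (lv.dp (X \<tau>) \<tau>) + lv.q (X \<tau>) \<tau>)" for \<tau>
    note lims = limits[of y, folded X_def, folded wx_def wxx_def]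
    have W_val: "W (S y \<tau>) (T - \<tau>) = K * (u (X \<tau>) \<tau> - lv.c (X \<tau>) \<tau>)" for \<tau>
      using W_log[of "S y \<tau>" "T - \<tau>"] contract(1) unfolding S_X by simp
    have W_derivs: "d_space W (S y \<tau>) (T - \<tau>) = wx \<tau> / exp (X \<tau>)"
      "d_space (d_space W) (S y \<tau>) (T - \<tau>) = (wxx \<tau> - wx \<tau>) / (K * (exp (X \<tau>))\<^sup>2)" if "\<tau> \<in> {0<..T}" for \<tau>
      using log_coordinate_derivatives[OF contract(1), of "\<lambda>z. W z (T - \<tau>)" "\<lambda>x. u x \<tau> - lv.c x \<tau>",
          OF _ DERIV_diff[OF growth_classD(2)[OF u_growth that] lv.c_dx[OF that]]
             DERIV_diff[OF growth_classD(3)[OF u_growth that] lv.c_dxx[OF that]], of "X \<tau>"] W_log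
      unfolding S_X d_space_def[of "d_space W"] unfolding d_space_def[of W, abs_def] wx_def wxx_def by simp_all
    have Cref_derivs: "d_space (d_space Cref) (S y \<tau>) (T - \<tau>) = lv.q (X \<tau>) \<tau> / (K * (exp (X \<tau>))\<^sup>2)"
      if "\<tau> \<in> {0<..T}" for \<tau>
      using log_coordinate_derivatives(2)[OF contract(1), of "\<lambda>z. Cref z (T - \<tau>)" "\<lambda>x. lv.c x \<tau>",
          OF _ lv.c_dx[OF that] lv.c_dxx[OF that], of "X \<tau>"] Cref_log
      unfolding S_X d_space_def[of "d_space Cref"] unfolding d_space_def[of Cref, abs_def] by simp
    have value_lim: "((\<lambda>\<tau>. W (S y \<tau>) (T - \<tau>) / (K * \<tau>)) \<longlongrightarrow> b_star / 4 * y * gauss_density a_star y) (at_right 0)"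
      unfolding W_val using lims(1) contract(1) by simp
    \<comment> \<open>The conversion factor \<open>exp (X \<tau>)\<close> between log and spot
      derivatives tends to 1.\<close>
    have delta_lim: "((\<lambda>\<tau>. d_space W (S y \<tau>) (T - \<tau>) / sqrt \<tau>)
        \<longlongrightarrow> b_star / 4 * (1 - y\<^sup>2 / a_star) * gauss_density a_star y) (at_right 0)"
    proof (rule Lim_transform_eventually)
      have "((\<lambda>\<tau>. wx \<tau> / sqrt \<tau> / exp (X \<tau>))
          \<longlongrightarrow> b_star / 4 * (1 - y\<^sup>2 / a_star) * gauss_density a_star y / exp 0) (at_right 0)"
        by (intro tendsto_divide tendsto_exp X) (use lims(2) in simp_all)
      thus "((\<lambda>\<tau>. wx \<tau> / sqrt \<tau> / exp (X \<tau>))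
          \<longlongrightarrow> b_star / 4 * (1 - y\<^sup>2 / a_star) * gauss_density a_star y) (at_right 0)" by simp
      show "\<forall>\<^sub>F \<tau> in at_right 0. wx \<tau> / sqrt \<tau> / exp (X \<tau>) = d_space W (S y \<tau>) (T - \<tau>) / sqrt \<tau>"
        using lv.eventually_in_interval by eventually_elim (simp add: W_derivs)
    qed
    \<comment> \<open>The second spot derivative involves \<open>wxx - wx\<close>; the delta limit
      already forces \<open>wx\<close> to vanish like \<open>sqrt \<tau>\<close>, so it drops out of
      the gamma limit.\<close>
    have wx_lim: "(wx \<longlongrightarrow> 0) (at_right 0)"
    proof (rule Lim_transform_eventually)
      show "((\<lambda>\<tau>. wx \<tau> / sqrt \<tau> * sqrt \<tau>) \<longlongrightarrow> 0) (at_right 0)"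
        using tendsto_mult[OF lims(2) lv.sqrt_tendsto_0] by simp
      show "\<forall>\<^sub>F \<tau> in at_right 0. wx \<tau> / sqrt \<tau> * sqrt \<tau> = wx \<tau>"
        using lv.eventually_in_interval by eventually_elim simp
    qed
    have gamma_lim: "((\<lambda>\<tau>. K * d_space (d_space W) (S y \<tau>) (T - \<tau>))
        \<longlongrightarrow> b_star / 4 * (y ^ 3 / a_star\<^sup>2 - 3 * y / a_star) * gauss_density a_star y) (at_right 0)"
    proof (rule Lim_transform_eventually)
      have "((\<lambda>\<tau>. (wxx \<tau> - wx \<tau>) / (exp (X \<tau>))\<^sup>2)
          \<longlongrightarrow> (b_star / 4 * (y ^ 3 / a_star\<^sup>2 - 3 * y / a_star) * gauss_density a_star y - 0) / (exp 0)\<^sup>2) (at_right 0)"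
        by (intro tendsto_divide tendsto_diff tendsto_power wx_lim tendsto_exp X) (use lims(3) in simp_all)
      thus "((\<lambda>\<tau>. (wxx \<tau> - wx \<tau>) / (exp (X \<tau>))\<^sup>2)
          \<longlongrightarrow> b_star / 4 * (y ^ 3 / a_star\<^sup>2 - 3 * y / a_star) * gauss_density a_star y) (at_right 0)" by simp
      show "\<forall>\<^sub>F \<tau> in at_right 0. (wxx \<tau> - wx \<tau>) / (exp (X \<tau>))\<^sup>2 = K * d_space (d_space W) (S y \<tau>) (T - \<tau>)"
        using lv.eventually_in_interval by eventually_elim (use contract(1) in \<open>simp add: W_derivs\<close>)
    qed
    have carrier_lim: "((\<lambda>\<tau>. sqrt \<tau> * K * d_space (d_space Cref) (S y \<tau>) (T - \<tau>)) \<longlongrightarrow> gauss_density a_star y) (at_right 0)"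
    proof (rule Lim_transform_eventually)
      have "((\<lambda>\<tau>. sqrt \<tau> * lv.q (X \<tau>) \<tau> / (exp (X \<tau>))\<^sup>2) \<longlongrightarrow> gauss_density a_star y / (exp 0)\<^sup>2) (at_right 0)"
        by (intro tendsto_divide tendsto_power tendsto_exp X)
           (use lv.q_scaled_tendsto[of y] in \<open>simp_all add: X_def a_star_eq\<close>)
      thus "((\<lambda>\<tau>. sqrt \<tau> * lv.q (X \<tau>) \<tau> / (exp (X \<tau>))\<^sup>2) \<longlongrightarrow> gauss_density a_star y) (at_right 0)" by simp
      show "\<forall>\<^sub>F \<tau> in at_right 0. sqrt \<tau> * lv.q (X \<tau>) \<tau> / (exp (X \<tau>))\<^sup>2 = sqrt \<tau> * K * d_space (d_space Cref) (S y \<tau>) (T - \<tau>)"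
        using lv.eventually_in_interval by eventually_elim (use contract(1) in \<open>simp add: Cref_derivs\<close>)
    qed
    \<comment> \<open>The Gaussian density is positive, so the value limit at order
      \<open>\<tau>\<close> is nonzero and pins down the exponent.\<close>
    have "b_star / 4 * y * gauss_density a_star y \<noteq> 0" if "b_star * y \<noteq> 0"
      using that lv.abar_0_pos unfolding gauss_density_def a_star_eq by auto
    hence exponent: "(\<exists>l. l \<noteq> 0 \<and> ((\<lambda>\<tau>. W (S y \<tau>) (T - \<tau>) / (\<tau> / T) powr \<alpha>) \<longlongrightarrow> l) (at_right 0)) \<longleftrightarrow> \<alpha> = 1"
      if "b_star * y \<noteq> 0" for \<alpha>
      using scaled_limit_exponent[OF contract value_lim] that by blast
    show ?thesis using value_lim delta_lim gamma_lim carrier_lim exponent by blast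
  qed
  ultimately show ?thesis by blast
qed

end
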